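(* Let $\eta>0$ and let $w:[0,\eta]\to[0,+\infty)$ be a non-increasing Lipschitz function with $\int_0^\eta w(x)\,dx=1$. Let $v:[0,1]\to[0,+\infty)$ be a Lipschitz and non-increasing function with $v(1)=0$, and let $\rho_0\in BV_c(\mathbb{R},[0,1])$. Then the Cauchy problem $$\begin{cases}\partial_t\rho+\partial_x\left(\rho\, v\left(\int_x^{x+\eta}\rho(t,y)\,w(y-x)\,dy\right)\right)=0, & x\in\mathbb{R},\ t>0,\\ \rho(0,x)=\rho_0(x), & x\in\mathbb{R},\end{cases}$$ admits a unique solution in the weak sense (that is, for every $T>0$ there is a unique weak solution on $[0,T]$), and it satisfies $$0\le \rho(t,x)\le \max\{\rho_0\}\qquad\text{for a.e. } x\in\mathbb{R},\ t>0.$$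
   Context: $BV_c(\mathbb{R},[0,1])$ is the set of functions $\mathbb{R}\to[0,1]$ of bounded variation with compact support; $\max\{\rho_0\}$ means the (essential) supremum of $\rho_0$. The function $v$ is extended by $v(x)=0$ for $x>1$. $\mathcal{M}(\mathbb{R})$ is the set of (finite) non-negative Borel measures on $\mathbb{R}$; $\rho_0$ is identified with the measure $\rho_0(x)\,dx$, and absolutely continuous measures are identified with their densities. For two measures $\mu,\nu$ of equal mass, $\Pi(\mu,\nu)$ is the set of non-negative measures $\pi$ on $\mathbb{R}\times\mathbb{R}$ with marginals $\mu$ and $\nu$, and the $\infty$-Wasserstein distance is $W_\infty(\mu,\nu)=\inf\{\pi\text{-}\mathrm{ess\,sup}\,|x-y| : \pi\in\Pi(\mu,\nu)\}$. Continuity in time is with respect to $W_\infty$ (the total mass being constant in time). A weak solution on $[0,T]$ is $\mu\in C^0([0,T],\mathcal{M}(\mathbb{R}))$ with $\mu(0)=\rho_0$ such that for all $\varphi\in C_c^\infty((0,T)\times\mathbb{R})$ $$\int_0^T\int_{\mathbb{R}}\left(\partial_t\varphi+\partial_x\varphi\; v\left(\int_{[x,x+\eta]}w(y-x)\,d\mu(t,y)\right)\right)d\mu(t,x)\,dt=0.$$ *)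

theory Defs
  imports "HOL-Probability.Probability"
begin

definition bounded_variation :: "(real \<Rightarrow> real) \<Rightarrow> bool" where
  "bounded_variation f \<longleftrightarrow>
     (\<exists>C. \<forall>p :: nat \<Rightarrow> real. \<forall>n. mono p \<longrightarrow> (\<Sum>i<n. \<bar>f (p (Suc i)) - f (p i)\<bar>) \<le> C)"

definition compact_support :: "('a::topological_space \<Rightarrow> real) \<Rightarrow> bool" where
  "compact_support f \<longleftrightarrow> compact (closure {x. f x \<noteq> 0})"

definition BV_c :: "(real \<Rightarrow> real) set" where
  "BV_c = {f. range f \<subseteq> {0..1} \<and> bounded_variation f \<and> compact_support f}"

text \<open>\<open>C_k k f\<close>: all directional derivatives of \<open>f\<close> up to order \<open>k\<close> exist (in the Frechet sense)
  and are continuous.\<close>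

primrec C_k :: "nat \<Rightarrow> ('a::euclidean_space \<Rightarrow> real) \<Rightarrow> bool" where
  "C_k 0 f \<longleftrightarrow> continuous_on UNIV f"
| "C_k (Suc k) f \<longleftrightarrow>
     (\<forall>x. f differentiable (at x)) \<and> (\<forall>h. C_k k (\<lambda>x. frechet_derivative f (at x) h))"

definition smooth :: "('a::euclidean_space \<Rightarrow> real) \<Rightarrow> bool" where
  "smooth f \<longleftrightarrow> (\<forall>k. C_k k f)"

text \<open>A test function on the open set \<open>U\<close> is identified with its extension by zero to the whole
  space.\<close>

definition test_functions :: "'a::euclidean_space set \<Rightarrow> ('a \<Rightarrow> real) set" where
  "test_functions U = {\<phi>. smooth \<phi> \<and> compact_support \<phi> \<and> closure {x. \<phi> x \<noteq> 0} \<subseteq> U}"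

definition finite_borel_measures :: "real measure set" where
  "finite_borel_measures = {\<mu>. sets \<mu> = sets borel \<and> finite_measure \<mu>}"

definition couplings :: "real measure \<Rightarrow> real measure \<Rightarrow> (real \<times> real) measure set" where
  "couplings \<mu> \<nu> = {\<pi>. sets \<pi> = sets borel \<and> distr \<pi> borel fst = \<mu> \<and> distr \<pi> borel snd = \<nu>}"

text \<open>The distance takes values in \<open>[0,\<infinity>]\<close>. For measures of different mass there is no coupling and
  the value is \<open>\<infinity>\<close>; hence continuity with respect to \<open>W_infty\<close> forces the mass to be constant in
  time. Taking the essential supremum in \<^typ>\<open>ennreal\<close> makes it \<open>0\<close> for the null measure.\<close>

definition W_infty :: "real measure \<Rightarrow> real measure \<Rightarrow> ennreal" where
  "W_infty \<mu> \<nu> = (INF \<pi>\<in>couplings \<mu> \<nu>. esssup \<pi> (\<lambda>(x, y). ennreal \<bar>x - y\<bar>))"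

definition W_infty_continuous_on :: "real set \<Rightarrow> (real \<Rightarrow> real measure) \<Rightarrow> bool" where
  "W_infty_continuous_on I \<mu> \<longleftrightarrow>
     (\<forall>s\<in>I. ((\<lambda>t. W_infty (\<mu> t) (\<mu> s)) \<longlongrightarrow> 0) (at s within I))"

definition extend_velocity :: "(real \<Rightarrow> real) \<Rightarrow> real \<Rightarrow> real" where
  "extend_velocity v s = (if s > 1 then 0 else v s)"

definition nonlocal_velocity ::
  "real \<Rightarrow> (real \<Rightarrow> real) \<Rightarrow> (real \<Rightarrow> real) \<Rightarrow> real measure \<Rightarrow> real \<Rightarrow> real" where
  "nonlocal_velocity \<eta> w v \<mu> x =
     extend_velocity v (set_lebesgue_integral \<mu> {x..x + \<eta>} (\<lambda>y. w (y - x)))"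

definition weak_solution ::
  "real \<Rightarrow> (real \<Rightarrow> real) \<Rightarrow> (real \<Rightarrow> real) \<Rightarrow> (real \<Rightarrow> real) \<Rightarrow> real \<Rightarrow> (real \<Rightarrow> real measure) \<Rightarrow> bool"
where
  "weak_solution \<eta> w v \<rho>\<^sub>0 T \<mu> \<longleftrightarrow>
     (\<forall>t\<in>{0..T}. \<mu> t \<in> finite_borel_measures) \<and>
     W_infty_continuous_on {0..T} \<mu> \<and>
     \<mu> 0 = density lborel (\<lambda>x. ennreal (\<rho>\<^sub>0 x)) \<and>
     (\<forall>\<phi>\<in>test_functions ({0<..<T} \<times> UNIV).
        set_lebesgue_integral lborel {0..T} (\<lambda>t. \<integral>x.
          (deriv (\<lambda>s. \<phi> (s, x)) t + deriv (\<lambda>y. \<phi> (t, y)) x * nonlocal_velocity \<eta> w v (\<mu> t) x)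
          \<partial>(\<mu> t)) = 0)"

end

theory Submission
  imports Defs
begin

text \<open>A particle at \<open>x\<close> moves with velocity \<open>v I\<close>, where \<open>I\<close> is the weighted mass in the window \<open>[x, x + \<eta>]\<close>
ahead of it. Labelling particles by their initial position, the equation becomes an ordinary differential equation
for configurations \<open>X\<close>, monotone maps of the line. The weight jumps at both ends of the window, so \<open>I\<close>
depends on the measure in a Lipschitz way only where the mass has bounded density; two observations make this
sufficient.

The density cannot grow. Take two particles at distance \<open>d\<close> with mass \<open>h\<close> between them, in a configuration of density
at most \<open>R\<close>. As the weight decreases with the distance, the particle in front sees at most \<open>k 0 (R d - h)\<close>
more mass than the one behind (\<open>downstream_slope\<close>). So an explicit Euler step of fixed small length preserves
the inequality \<open>h \<le> R d\<close>, which says that the density is at most \<open>R\<close> (\<open>euler_step_admissible\<close>). This constraint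
is convex, and the equation can be written as relaxation of \<open>X\<close> towards its Euler step; the Picard iterates of that
form are averages of Euler steps, hence satisfy the constraint exactly, and they converge to a flow. The initial mass
transported by the flow is a weak solution with density at most \<open>R\<close>, the essential supremum of the initial
density (\<open>\<mu>_weak_solution\<close>).

For uniqueness, let \<open>\<nu>\<close> be any weak solution, possibly with atoms, and \<open>\<mu>\<close> the constructed one. Measure
their distance by the shift that is needed to compare the masses of half-lines. If the distance is at most
\<open>A exp (c t)\<close> at all times, then the velocities of \<open>\<nu>\<close> and \<open>\<mu>\<close> differ by a multiple of this quantity; here
only \<open>\<mu>\<close> needs a bounded density (\<open>downstream_close\<close>). The velocity of \<open>\<mu>\<close> is Lipschitz in space, so its
trajectories, displaced by half of \<open>A exp (c t)\<close> with \<open>c\<close> large, are barriers that no mass of \<open>\<nu>\<close> can cross in the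
wrong direction (\<open>\<nu>_mass_beside_barrier\<close>). This follows from the weak equation alone, tested with
smooth approximations of the indicator function of the region beside the barrier. Thus the distance is in
fact at most three quarters of what was assumed (\<open>close_at_improve\<close>), and by iteration it vanishes.\<close>

section \<open>Smooth functions\<close>

lemma C_k_SucD: "C_k (Suc k) f \<Longrightarrow> C_k k f"
proof (induction k arbitrary: f)
  case 0
  then show ?case
    by (auto simp: continuous_at_imp_continuous_on differentiable_imp_continuous_within)
next
  case (Suc k)
  then show ?case by simp
qed

lemma C_k_const: "C_k k (\<lambda>_. c)"
  by (induction k arbitrary: c) (auto simp: frechet_derivative_const)

lemma C_k_linear:
  assumes "bounded_linear f"
  shows "C_k k f"
proof (cases k)
  case 0
  then show ?thesis using assms by (simp add: linear_continuous_on)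
next
  case (Suc j)
  have "(f has_derivative f) (at x)" for x
    using assms by (rule bounded_linear_imp_has_derivative)
  then have "f differentiable (at x)" "frechet_derivative f (at x) = f" for x
    by (auto simp: differentiable_def frechet_derivative_at[symmetric])
  then show ?thesis using Suc by (simp add: C_k_const)
qed

lemma C_k_add:
  assumes "C_k k f" "C_k k g"
  shows "C_k k (\<lambda>x. f x + g x)"
  using assms
proof (induction k arbitrary: f g)
  case 0
  then show ?case by (auto intro: continuous_intros)
next
  case (Suc k)
  have "((\<lambda>x. f x + g x) has_derivative
      (\<lambda>h. frechet_derivative f (at x) h + frechet_derivative g (at x) h)) (at x)" for x
    using Suc.prems by (intro has_derivative_add) (auto simp: frechet_derivative_works[symmetric])
  then have "(\<lambda>x. f x + g x) differentiable (at x)"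
    "frechet_derivative (\<lambda>x. f x + g x) (at x) =
      (\<lambda>h. frechet_derivative f (at x) h + frechet_derivative g (at x) h)" for x
    by (auto simp: differentiable_def frechet_derivative_at[symmetric])
  then show ?case using Suc by simp
qed

lemma C_k_mult:
  assumes "C_k k f" "C_k k g"
  shows "C_k k (\<lambda>x. f x * g x)"
  using assms
proof (induction k arbitrary: f g)
  case 0
  then show ?case by (auto intro: continuous_intros)
next
  case (Suc k)
  have "((\<lambda>x. f x * g x) has_derivative
      (\<lambda>h. f x * frechet_derivative g (at x) h + frechet_derivative f (at x) h * g x)) (at x)" for x
    using Suc.prems by (intro has_derivative_mult) (auto simp: frechet_derivative_works[symmetric])
  then have "(\<lambda>x. f x * g x) differentiable (at x)"
    "frechet_derivative (\<lambda>x. f x * g x) (at x) =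
      (\<lambda>h. f x * frechet_derivative g (at x) h + frechet_derivative f (at x) h * g x)" for x
    by (auto simp: differentiable_def frechet_derivative_at[symmetric])
  moreover have "C_k k f" "C_k k g" using Suc.prems C_k_SucD by auto
  ultimately show ?case using Suc by (auto intro!: C_k_add Suc.IH)
qed

lemma frechet_derivative_real:
  fixes g :: "real \<Rightarrow> real"
  assumes "(g has_real_derivative d) (at x)"
  shows "g differentiable (at x)" "frechet_derivative g (at x) = (\<lambda>h. d * h)"
proof -
  have "(g has_derivative (\<lambda>h. d * h)) (at x)"
    using assms by (simp add: has_field_derivative_def)
  then show "g differentiable (at x)" "frechet_derivative g (at x) = (\<lambda>h. d * h)"
    by (auto simp: differentiable_def frechet_derivative_at[symmetric])
qed

text \<open>A class of functions that is closed under taking derivatives consists of smooth functions. This is how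
the exponential, the polynomials and the flat functions below are recognised: none of them needs
a formula for its \<open>k\<close>-th derivative.\<close>

lemma smooth_derivative_closed:
  fixes S :: "(real \<Rightarrow> real) set"
  assumes S: "\<And>g. g \<in> S \<Longrightarrow> \<exists>g'\<in>S. \<forall>x. (g has_real_derivative g' x) (at x)"
    and "g \<in> S"
  shows "smooth g"
proof -
  have "C_k k g" for k
    using \<open>g \<in> S\<close>
  proof (induction k arbitrary: g)
    case 0
    then obtain g' where "\<forall>x. (g has_real_derivative g' x) (at x)" using S by blast
    then show ?case by (auto intro!: continuous_at_imp_continuous_on DERIV_isCont)
  next
    case (Suc k)
    then obtain g' where "g' \<in> S" "\<forall>x. (g has_real_derivative g' x) (at x)" using S by blast
    then show ?case
      using Suc.IH[of g'] frechet_derivative_real[of g "g' x" x for x]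
      by (auto intro!: C_k_mult C_k_const)
  qed
  then show ?thesis by (simp add: smooth_def)
qed

lemma smooth_real_derivative:
  fixes g :: "real \<Rightarrow> real"
  assumes "smooth g"
  obtains g' where "smooth g'" "\<And>x. (g has_real_derivative g' x) (at x)"
proof
  let ?g' = "\<lambda>x. frechet_derivative g (at x) 1"
  show "smooth ?g'" unfolding smooth_def
  proof
    fix k
    have "C_k (Suc k) g" using assms by (simp only: smooth_def)
    then show "C_k k ?g'" by simp
  qed
  fix x
  have "C_k (Suc 0) g" using assms by (simp only: smooth_def)
  then have "(g has_derivative frechet_derivative g (at x)) (at x)"
    by (simp add: frechet_derivative_works[symmetric])
  moreover from this have "frechet_derivative g (at x) h = ?g' x * h" for h
    using linear_scale[OF has_derivative_linear, of g "frechet_derivative g (at x)" "at x" h 1]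
    by simp
  then have "frechet_derivative g (at x) = (*) (?g' x)"
    by (rule ext)
  ultimately show "(g has_real_derivative ?g' x) (at x)"
    unfolding has_field_derivative_def by (rule subst[rotated])
qed

text \<open>The induction needs an outer function that is smooth of every order, because each differentiation
replaces \<open>g\<close> by its derivative \<open>g'\<close> while the order demanded of \<open>f\<close> drops by one.\<close>

lemma C_k_comp:
  fixes f :: "'a::euclidean_space \<Rightarrow> real" and g :: "real \<Rightarrow> real"
  assumes "smooth g" "C_k k f"
  shows "C_k k (\<lambda>x. g (f x))"
  using assms
proof (induction k arbitrary: g)
  case 0
  then have "continuous_on UNIV g" by (metis C_k.simps(1) smooth_def)
  then show ?case using 0 by (auto intro: continuous_on_compose2)
next
  case (Suc k)
  obtain g' where g': "smooth g'" "\<And>x. (g has_real_derivative g' x) (at x)"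
    using smooth_real_derivative Suc.prems(1) by blast
  have "((\<lambda>x. g (f x)) has_derivative (\<lambda>h. g' (f x) * frechet_derivative f (at x) h)) (at x)" for x
  proof -
    have "(f has_derivative frechet_derivative f (at x)) (at x)"
      using Suc.prems by (auto simp: frechet_derivative_works[symmetric])
    moreover have "(g has_derivative (\<lambda>h. g' (f x) * h)) (at (f x))"
      using g'(2)[of "f x"] by (simp add: has_field_derivative_def)
    ultimately show ?thesis
      by (rule has_derivative_compose)
  qed
  then have "(\<lambda>x. g (f x)) differentiable (at x)"
    "frechet_derivative (\<lambda>x. g (f x)) (at x) = (\<lambda>h. g' (f x) * frechet_derivative f (at x) h)" for x
    by (auto simp: differentiable_def frechet_derivative_at[symmetric])
  moreover have "C_k k (\<lambda>x. g' (f x))"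
    using Suc.IH[OF g'(1)] Suc.prems C_k_SucD by blast
  moreover from this have "C_k k (\<lambda>x. g' (f x) * frechet_derivative f (at x) h)" for h
    using Suc.prems by (intro C_k_mult) simp_all
  ultimately show ?case by simp
qed

lemma smooth_const: "smooth (\<lambda>_. c)"
  unfolding smooth_def using C_k_const by blast

lemma smooth_linear: "bounded_linear l \<Longrightarrow> smooth l"
  unfolding smooth_def using C_k_linear by blast

lemma smooth_add: "smooth f \<Longrightarrow> smooth g \<Longrightarrow> smooth (\<lambda>x. f x + g x)"
  unfolding smooth_def using C_k_add[of _ f g] by blast

lemma smooth_mult: "smooth f \<Longrightarrow> smooth g \<Longrightarrow> smooth (\<lambda>x. f x * g x)"
  unfolding smooth_def using C_k_mult[of _ f g] by blast

lemma smooth_comp: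
  assumes "smooth h" "smooth f"
  shows "smooth (\<lambda>x. h (f x))"
  using assms C_k_comp[OF assms(1), of _ f] unfolding smooth_def[of f] smooth_def[of "\<lambda>x. h (f x)"]
  by blast

lemma smooth_diff: "smooth f \<Longrightarrow> smooth g \<Longrightarrow> smooth (\<lambda>x. f x - g x)"
  using smooth_add[of f "\<lambda>x. (-1) * g x"] smooth_mult[OF smooth_const[of "-1"], of g] by simp

lemma smooth_fst: "smooth (fst :: real \<times> real \<Rightarrow> real)"
  and smooth_snd: "smooth (snd :: real \<times> real \<Rightarrow> real)"
  by (rule smooth_linear, rule bounded_linear_fst bounded_linear_snd)+

lemma smooth_exp: "smooth (exp :: real \<Rightarrow> real)"
  by (rule smooth_derivative_closed[of "{exp}"]) (auto intro!: derivative_eq_intros)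

lemma smooth_poly: "smooth (poly p)"
  for p :: "real poly"
  by (rule smooth_derivative_closed[of "range poly"]) (auto intro!: poly_DERIV)

lemma smooth_antiderivative:
  fixes F :: "real \<Rightarrow> real"
  assumes f: "smooth f" and F: "\<And>x. (F has_real_derivative f x) (at x)"
  shows "smooth F"
  unfolding smooth_def
proof
  fix k
  have "C_k (Suc k) F"
    using f frechet_derivative_real[OF F] by (auto simp: smooth_def intro!: C_k_mult C_k_const)
  then show "C_k k F" by (rule C_k_SucD)
qed

lemma smooth_continuous: "smooth f \<Longrightarrow> continuous_on UNIV f"
  by (metis C_k.simps(1) smooth_def)

text \<open>The partial derivatives with respect to time and space are all that the transport equation sees of
a test function. They are parameters of the predicate so that explicit formulas can be supplied for them.\<close>

definition has_partials ::
  "(real \<times> real \<Rightarrow> real) \<Rightarrow> (real \<times> real \<Rightarrow> real) \<Rightarrow> (real \<times> real \<Rightarrow> real) \<Rightarrow> bool" where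
  "has_partials \<phi> \<phi>t \<phi>x \<longleftrightarrow> continuous_on UNIV \<phi>t \<and> continuous_on UNIV \<phi>x \<and>
     (\<forall>t x. ((\<lambda>s. \<phi> (s, x)) has_real_derivative \<phi>t (t, x)) (at t)) \<and>
     (\<forall>t x. ((\<lambda>y. \<phi> (t, y)) has_real_derivative \<phi>x (t, x)) (at x))"

lemma has_partialsD:
  assumes "has_partials \<phi> \<phi>t \<phi>x"
  shows "continuous_on UNIV \<phi>t" "continuous_on UNIV \<phi>x"
    "((\<lambda>s. \<phi> (s, x)) has_real_derivative \<phi>t (t, x)) (at t)"
    "((\<lambda>y. \<phi> (t, y)) has_real_derivative \<phi>x (t, x)) (at x)"
  using assms by (auto simp: has_partials_def)

lemma smooth_partial_derivatives:
  fixes \<phi> :: "real \<times> real \<Rightarrow> real"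
  assumes "smooth \<phi>"
  obtains \<phi>t \<phi>x where "has_partials \<phi> \<phi>t \<phi>x"
    "\<And>t x. (\<phi> has_derivative (\<lambda>h. fst h * \<phi>t (t, x) + snd h * \<phi>x (t, x))) (at (t, x))"
proof -
  let ?D = "\<lambda>h p. frechet_derivative \<phi> (at p) h"
  have Ck: "C_k (Suc k) \<phi>" for k using assms by (simp only: smooth_def)
  have sm: "smooth (?D h)" for h
    unfolding smooth_def
  proof
    fix k
    show "C_k k (?D h)" using Ck[of k] by (simp only: C_k.simps)
  qed
  have D: "(\<phi> has_derivative frechet_derivative \<phi> (at p)) (at p)" for p
    using Ck[of 0] by (cases p) (simp add: frechet_derivative_works[symmetric])
  have lin: "?D h p = fst h * ?D (1, 0) p + snd h * ?D (0, 1) p" for h p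
  proof -
    have l: "linear (\<lambda>h. ?D h p)" using D has_derivative_linear by blast
    have "h = fst h *\<^sub>R (1, 0) + snd h *\<^sub>R (0, 1)" by (cases h) simp
    then show ?thesis using linear_add[OF l] linear_scale[OF l] by (metis real_scaleR_def)
  qed
  have full: "(\<phi> has_derivative (\<lambda>h. fst h * ?D (1, 0) (t, x) + snd h * ?D (0, 1) (t, x))) (at (t, x))" for t x
  proof -
    have "?D h (t, x) = fst h * ?D (1, 0) (t, x) + snd h * ?D (0, 1) (t, x)" for h
      by (rule lin)
    then have "frechet_derivative \<phi> (at (t, x)) =
        (\<lambda>h. fst h * ?D (1, 0) (t, x) + snd h * ?D (0, 1) (t, x))" by (rule ext)
    with D[of "(t, x)"] show ?thesis by (rule subst[rotated])
  qed
  have "has_partials \<phi> (?D (1, 0)) (?D (0, 1))"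
    unfolding has_partials_def
  proof (intro conjI allI smooth_continuous sm)
    show "((\<lambda>s. \<phi> (s, x)) has_real_derivative ?D (1, 0) (t, x)) (at t)" for t x
    proof -
      have "((\<lambda>s. (s, x)) has_derivative (\<lambda>h. (h, 0))) (at t)"
        by (auto intro!: derivative_eq_intros)
      from has_derivative_compose[OF this, of \<phi>, OF full] show ?thesis
        by (simp add: has_field_derivative_def mult_commute_abs)
    qed
    show "((\<lambda>y. \<phi> (t, y)) has_real_derivative ?D (0, 1) (t, x)) (at x)" for t x
    proof -
      have "((\<lambda>s. (t, s)) has_derivative (\<lambda>h. (0, h))) (at x)"
        by (auto intro!: derivative_eq_intros)
      from has_derivative_compose[OF this, of \<phi>, OF full] show ?thesis
        by (simp add: has_field_derivative_def mult_commute_abs)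
    qed
  qed
  then show ?thesis using full by (rule that)
qed

section \<open>A smooth ramp\<close>

text \<open>The functions \<open>y \<mapsto> p (1 / y) exp (- 1 / y)\<close>, extended by zero to \<open>y \<le> 0\<close>, form a class that is
closed under differentiation: the polynomial \<open>p\<close> becomes \<open>X\<^sup>2 (p - p')\<close>.\<close>

definition flat :: "real poly \<Rightarrow> real \<Rightarrow> real" where
  "flat p y = (if y > 0 then poly p (1 / y) * exp (- (1 / y)) else 0)"

lemma poly_times_exp_minus_tendsto_0: "((\<lambda>x. poly p x * exp (- x)) \<longlongrightarrow> (0::real)) at_top"
proof -
  have "((\<lambda>x. \<Sum>i\<le>degree p. coeff p i * (x ^ i / exp x)) \<longlongrightarrow> (\<Sum>i\<le>degree p. coeff p i * 0)) at_top"
    by (intro tendsto_sum tendsto_mult tendsto_const tendsto_power_div_exp_0)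
  moreover have "(\<Sum>i\<le>degree p. coeff p i * (x ^ i / exp x)) = poly p x * exp (- x)" for x :: real
    by (simp add: poly_altdef exp_minus sum_distrib_right divide_inverse mult.assoc)
  ultimately show ?thesis by simp
qed

lemma flat_over_tendsto_0: "((\<lambda>y. flat p y / y) \<longlongrightarrow> 0) (at 0)"
proof -
  have "((\<lambda>y. poly (monom 1 1 * p) (inverse y) * exp (- inverse y)) \<longlongrightarrow> 0) (at_right 0)"
    using filterlim_compose[OF poly_times_exp_minus_tendsto_0 filterlim_inverse_at_top_right] .
  then have "((\<lambda>y. flat p y / y) \<longlongrightarrow> 0) (at_right 0)"
    by (rule Lim_transform_eventually)
      (auto simp: eventually_at_right_field flat_def poly_monom field_simps intro!: exI[of _ 1])
  moreover have "((\<lambda>y. flat p y / y) \<longlongrightarrow> 0) (at_left 0)"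
    by (rule tendsto_eventually) (auto simp: flat_def eventually_at_left_field intro!: exI[of _ "-1"])
  ultimately show ?thesis by (simp add: filterlim_split_at)
qed

lemma flat_has_derivative:
  "(flat p has_real_derivative flat (monom 1 2 * (p - pderiv p)) y) (at y)"
proof -
  consider "y > 0" | "y = 0" | "y < 0" by linarith
  then show ?thesis
  proof cases
    case 1
    have "((\<lambda>y. poly p (1 / y) * exp (- (1 / y))) has_real_derivative
       flat (monom 1 2 * (p - pderiv p)) y) (at y)"
      using 1
      by (auto intro!: derivative_eq_intros DERIV_chain2[OF poly_DERIV]
          simp: flat_def poly_monom field_simps power2_eq_square)
    then show ?thesis
      by (rule has_field_derivative_transform_within_open[of _ _ _ "{0<..}"])
        (use 1 in \<open>auto simp: flat_def\<close>)
  next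
    case 2
    then show ?thesis
      using flat_over_tendsto_0[of p] by (simp add: has_field_derivative_iff flat_def)
  next
    case 3
    have "((\<lambda>y. 0) has_real_derivative flat (monom 1 2 * (p - pderiv p)) y) (at y)"
      using 3 by (simp add: flat_def)
    then show ?thesis
      by (rule has_field_derivative_transform_within_open[of _ _ _ "{..<0}"])
        (use 3 in \<open>auto simp: flat_def\<close>)
  qed
qed

lemma smooth_flat: "smooth (flat p)"
  by (rule smooth_derivative_closed[of "range flat"]) (use flat_has_derivative in blast)+

text \<open>A nondecreasing smooth function that vanishes exactly on \<open>y \<le> 0\<close>. The rescaled functions
\<open>y \<mapsto> ramp (n y)\<close> converge to the indicator function of \<open>y > 0\<close>; they serve both to build
compactly supported test functions and to recover the mass of half-lines in the limit.\<close>

definition ramp :: "real \<Rightarrow> real" where "ramp = flat 1"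

definition ramp' :: "real \<Rightarrow> real" where "ramp' = flat (monom 1 2)"

lemma smooth_ramp: "smooth ramp" and smooth_ramp': "smooth ramp'"
  by (simp_all add: ramp_def ramp'_def smooth_flat)

lemma ramp_eq: "ramp y = (if y > 0 then exp (- (1 / y)) else 0)"
  by (simp add: ramp_def flat_def)

lemma ramp_has_derivative: "(ramp has_real_derivative ramp' y) (at y)"
  using flat_has_derivative[of 1 y] by (simp add: ramp_def ramp'_def)

lemma ramp'_nonneg: "0 \<le> ramp' y"
  by (simp add: ramp'_def flat_def poly_monom)

lemma ramp_bounds: "0 \<le> ramp y" "ramp y \<le> 1" "ramp y \<noteq> 0 \<longleftrightarrow> 0 < y" "y \<le> 0 \<Longrightarrow> ramp y = 0"
   "ramp' y \<noteq> 0 \<Longrightarrow> 0 < y"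
  by (auto simp: ramp_eq ramp'_def flat_def split: if_splits)

lemma ramp_scaled_tendsto: "(\<lambda>n. ramp (real n * y)) \<longlonglongrightarrow> (if y > 0 then 1 else 0)"
proof (cases "y > 0")
  case True
  have "(\<lambda>n. exp (- (inverse (real n) / y))) \<longlonglongrightarrow> exp (- (0 / y))"
    by (intro tendsto_intros) (use True lim_inverse_n in auto)
  then have "(\<lambda>n. exp (- (inverse (real n) / y))) \<longlonglongrightarrow> 1" by simp
  then have "(\<lambda>n. ramp (real n * y)) \<longlonglongrightarrow> 1"
    by (rule Lim_transform_eventually)
      (use True in \<open>auto simp: ramp_eq divide_simps intro!: eventually_mono[OF eventually_gt_at_top[of 0]]\<close>)
  then show ?thesis using True by simp
next
  case False
  then have "ramp (real n * y) = 0" for n by (auto simp: ramp_eq zero_less_mult_iff)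
  then show ?thesis using False by simp
qed

section \<open>Functions of bounded variation are Borel\<close>

text \<open>With \<open>V x\<close> the total variation of \<open>f\<close> up to \<open>x\<close>, both \<open>V\<close> and \<open>V - f\<close> are monotone.\<close>

lemma bounded_variation_borel_measurable:
  assumes "bounded_variation f"
  shows "f \<in> borel_measurable borel"
proof -
  define S where "S x = {\<Sum>i<n. \<bar>f (p (Suc i)) - f (p i)\<bar> | p n. mono p \<and> (\<forall>i::nat. p i \<le> x)}" for x
  define V where "V x = Sup (S x)" for x
  obtain C where C: "\<And>p n. mono p \<Longrightarrow> (\<Sum>i<n. \<bar>f (p (Suc i)) - f (p i)\<bar>) \<le> C"
    using assms unfolding bounded_variation_def by blast
  have bdd: "bdd_above (S x)" for x
    unfolding S_def by (rule bdd_aboveI[of _ C]) (auto intro: C)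
  have "0 \<in> S x" for x
    unfolding S_def by (auto intro!: exI[of _ "\<lambda>_. x"] exI[of _ "0::nat"] simp: mono_def)
  then have ne: "S x \<noteq> {}" for x by blast
  have key: "V x + \<bar>f y - f x\<bar> \<le> V y" if "x \<le> y" for x y
  proof -
    have "s \<le> V y - \<bar>f y - f x\<bar>" if s: "s \<in> S x" for s
    proof -
      obtain p n where p: "mono p" "\<And>i::nat. p i \<le> x" "s = (\<Sum>i<n. \<bar>f (p (Suc i)) - f (p i)\<bar>)"
        using s unfolding S_def by blast
      \<comment> \<open>append the points \<open>x\<close> and \<open>y\<close> to a partition that lies to the left of \<open>x\<close>\<close>
      define q where "q i = (if i \<le> n then p i else if i = Suc n then x else y)" for i
      have "mono q" using p \<open>x \<le> y\<close> by (auto simp: mono_iff_le_Suc q_def)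
      moreover have "q i \<le> y" for i using p(2)[of i] \<open>x \<le> y\<close> by (auto simp: q_def)
      ultimately have "(\<Sum>i<Suc (Suc n). \<bar>f (q (Suc i)) - f (q i)\<bar>) \<in> S y"
        unfolding S_def by blast
      then have "(\<Sum>i<Suc (Suc n). \<bar>f (q (Suc i)) - f (q i)\<bar>) \<le> V y"
        unfolding V_def using bdd by (rule cSup_upper)
      moreover have "(\<Sum>i<n. \<bar>f (q (Suc i)) - f (q i)\<bar>) = s"
        unfolding p(3) by (intro sum.cong) (auto simp: q_def)
      ultimately show ?thesis by (simp add: q_def)
    qed
    then have "V x \<le> V y - \<bar>f y - f x\<bar>"
      unfolding V_def[of x] by (rule cSup_least[OF ne])
    then show ?thesis by simp
  qed
  have "mono V" using key by (auto simp: mono_def) (smt (verit))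
  moreover have "mono (\<lambda>x. V x - f x)" using key by (auto simp: mono_def) (smt (verit))
  ultimately have "(\<lambda>x. V x - (V x - f x)) \<in> borel_measurable borel"
    by (intro borel_measurable_diff borel_measurable_mono)
  then show ?thesis by simp
qed

section \<open>Measures with bounded density\<close>

text \<open>The bound \<open>R\<close> on the density is expressed through open intervals, because this is the form in which
a Lagrangian description of the mass delivers it.\<close>

definition density_bounded :: "real \<Rightarrow> real measure \<Rightarrow> bool" where
  "density_bounded R \<mu> \<longleftrightarrow> sets \<mu> = sets borel \<and> finite_measure \<mu> \<and> 0 \<le> R \<and>
     (\<forall>a b. a \<le> b \<longrightarrow> measure \<mu> {a<..<b} \<le> R * (b - a))"

lemma density_bounded_Icc:
  assumes "density_bounded R \<mu>" "a \<le> b"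
  shows "measure \<mu> {a..b} \<le> R * (b - a)"
proof (rule field_le_epsilon)
  fix e :: real assume "e > 0"
  interpret finite_measure \<mu> using assms by (simp add: density_bounded_def)
  have [measurable_cong, simp]: "sets \<mu> = sets borel" using assms by (simp add: density_bounded_def)
  have R: "R \<ge> 0" using assms by (simp add: density_bounded_def)
  define d where "d = e / (2 * R + 1)"
  have d: "d > 0" "2 * R * d \<le> e" using R \<open>e > 0\<close> by (auto simp: d_def field_simps)
  have "measure \<mu> {a..b} \<le> measure \<mu> {a - d<..<b + d}"
    using d by (intro finite_measure_mono) auto
  also have "\<dots> \<le> R * ((b + d) - (a - d))"
  proof -
    have "a - d \<le> b + d" using assms(2) d by simp
    then show ?thesis using assms(1) unfolding density_bounded_def by blast
  qed
  also have "\<dots> \<le> R * (b - a) + e" using d by (simp add: algebra_simps)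
  finally show "measure \<mu> {a..b} \<le> R * (b - a) + e" .
qed

lemma density_bounded_finite_union:
  assumes \<mu>: "density_bounded R \<mu>"
    and D: "finite D" "\<And>K. K \<in> D \<Longrightarrow> K \<noteq> {} \<and> (\<exists>c d. K = {c..d::real})"
      "pairwise (\<lambda>A B. interior A \<inter> interior B = {}) D"
  shows "measure \<mu> (\<Union>D) \<le> R * measure lebesgue (\<Union>D)"
proof -
  interpret finite_measure \<mu> using \<mu> by (simp add: density_bounded_def)
  have [measurable_cong, simp]: "sets \<mu> = sets borel" using \<mu> by (simp add: density_bounded_def)
  have "measure \<mu> (\<Union>D) \<le> (\<Sum>K\<in>D. measure \<mu> K)"
    using D by (intro measure_Union_le) (auto, force)
  also have "\<dots> \<le> (\<Sum>K\<in>D. R * measure lebesgue K)"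
  proof (rule sum_mono)
    fix K assume "K \<in> D"
    then obtain c d where "K = {c..d}" "c \<le> d" using D(2) by force
    then show "measure \<mu> K \<le> R * measure lebesgue K"
      using density_bounded_Icc[OF \<mu>] by simp
  qed
  also have "\<dots> = R * measure lebesgue (\<Union>D)"
  proof -
    have neg: "negligible (A \<inter> B)" if "A \<in> D" "B \<in> D" "A \<noteq> B" for A B
    proof -
      obtain a b c d where "A = {a..b}" "B = {c..d}" using D(2) \<open>A \<in> D\<close> \<open>B \<in> D\<close> by meson
      then have "convex (A \<inter> B)" by (auto intro: convex_Int)
      moreover have "interior (A \<inter> B) = {}" using D(3) that by (simp add: pairwise_def)
      ultimately show ?thesis by (simp add: negligible_convex_interior)
    qed
    have "measure lebesgue (\<Union>D) = (\<Sum>K\<in>D. measure lebesgue K)"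
    proof (rule measure_negligible_finite_Union)
      show "S \<in> lmeasurable" if "S \<in> D" for S using D(2)[OF that] by auto
    qed (use D(1) neg in \<open>auto simp: pairwise_def\<close>)
    then show ?thesis by (simp add: sum_distrib_left)
  qed
  finally show ?thesis .
qed

text \<open>A bounded Borel set is covered, up to a small excess of length, by countably many intervals without
common interior points; the bound passes from the intervals to finite unions and then to the cover.\<close>

lemma density_bounded_borel_set:
  assumes \<mu>: "density_bounded R \<mu>" and A: "A \<in> sets borel" "A \<subseteq> {a..b}"
  shows "measure \<mu> A \<le> R * measure lborel A"
proof (rule field_le_epsilon)
  fix e :: real assume "e > 0"
  interpret finite_measure \<mu> using \<mu> by (simp add: density_bounded_def)
  have [measurable_cong, simp]: "sets \<mu> = sets borel" using \<mu> by (simp add: density_bounded_def)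
  have R: "R \<ge> 0" using \<mu> by (simp add: density_bounded_def)
  define e' where "e' = e / (R + 1)"
  have e': "e' > 0" "R * e' \<le> e" using R \<open>e > 0\<close> by (auto simp: e'_def field_simps)
  have "A \<in> lmeasurable"
    using A bounded_set_imp_lmeasurable[of A] bounded_subset[OF bounded_closed_interval A(2)] by auto
  then obtain D where D: "countable D"
      "\<And>K. K \<in> D \<Longrightarrow> K \<subseteq> cbox a b \<and> K \<noteq> {} \<and> (\<exists>c d. K = cbox c d)"
      "pairwise (\<lambda>A B. interior A \<inter> interior B = {}) D"
      "A \<subseteq> \<Union>D" "\<Union>D \<in> lmeasurable" "measure lebesgue (\<Union>D) \<le> measure lebesgue A + e'"
    using measurable_outer_intervals_bounded[of A a b e'] A(2) e'(1) by (smt (verit) box_real(2))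
  have DI: "K \<noteq> {} \<and> (\<exists>c d. K = {c..d})" if "K \<in> D" for K using D(2)[OF that] by auto
  have fin: "measure \<mu> (\<Union>F) \<le> R * (measure lebesgue A + e')" if F: "F \<subseteq> D" "finite F" for F
  proof -
    have "measure \<mu> (\<Union>F) \<le> R * measure lebesgue (\<Union>F)"
      using F DI D(3) by (intro density_bounded_finite_union[OF \<mu>]) (auto intro: pairwise_subset)
    also have "measure lebesgue (\<Union>F) \<le> measure lebesgue (\<Union>D)"
    proof (rule measure_mono_fmeasurable[OF _ _ D(5)])
      show "\<Union>F \<in> sets lebesgue" using F DI by (intro sets.finite_Union) (auto, force)
    qed (use F in auto)
    finally show ?thesis using R D(6) by (meson mult_left_mono order_trans)
  qed
  have "measure \<mu> (\<Union>D) \<le> R * (measure lebesgue A + e')"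
  proof (cases "D = {}")
    case True then show ?thesis using fin[of "{}"] by simp
  next
    case False
    \<comment> \<open>finite subsets of the cover, as sets, so that repetitions in the enumeration do not count twice\<close>
    define U where "U n = \<Union>(from_nat_into D ` {..n})" for n :: nat
    have UD: "(\<Union>n. U n) = \<Union>D"
      using range_from_nat_into[OF False D(1)] unfolding U_def by auto blast
    have sub: "from_nat_into D ` {..n} \<subseteq> D" for n using from_nat_into[OF False] by auto
    have "(\<lambda>n. measure \<mu> (U n)) \<longlonglongrightarrow> measure \<mu> (\<Union>n. U n)"
    proof (rule finite_Lim_measure_incseq)
      have "from_nat_into D i \<in> sets borel" for i using DI[OF from_nat_into[OF False, of i]] by auto
      then show "range U \<subseteq> sets \<mu>" unfolding U_def by auto
      show "incseq U" unfolding U_def incseq_def by force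
    qed
    then show ?thesis
      unfolding UD using fin[OF sub] by (intro LIMSEQ_le_const2) (auto simp: U_def)
  qed
  moreover have "\<Union>D \<in> sets borel" using D(1) DI by (intro sets.countable_Union) (auto, force)
  ultimately have "measure \<mu> A \<le> R * (measure lebesgue A + e')"
    using finite_measure_mono[OF D(4)] by simp
  also have "measure lebesgue A = measure lborel A" using A by simp
  finally show "measure \<mu> A \<le> R * measure lborel A + e" using e' by (simp add: algebra_simps)
qed

text \<open>The bound on Borel sets gives absolute continuity, hence a Radon-Nikodym density, and it forces that
density to be at most \<open>R\<close> almost everywhere. Truncation makes the bound hold everywhere.\<close>

lemma density_bounded_imp_density:
  assumes \<mu>: "density_bounded R \<mu>"
  obtains \<rho> where "\<rho> \<in> borel_measurable borel" "\<And>x. 0 \<le> \<rho> x" "\<And>x. \<rho> x \<le> R"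
    "\<mu> = density lborel (\<lambda>x. ennreal (\<rho> x))"
proof -
  interpret finite_measure \<mu> using \<mu> by (simp add: density_bounded_def)
  have s[measurable_cong, simp]: "sets \<mu> = sets borel" using \<mu> by (simp add: density_bounded_def)
  have R: "R \<ge> 0" using \<mu> by (simp add: density_bounded_def)
  have bd: "emeasure \<mu> (A \<inter> {- real n..real n}) \<le> ennreal R * emeasure lborel (A \<inter> {- real n..real n})"
    if "A \<in> sets borel" for A n
  proof -
    have "emeasure lborel (A \<inter> {- real n..real n}) \<le> emeasure lborel {- real n..real n}"
      using that by (intro emeasure_mono) auto
    then have "emeasure lborel (A \<inter> {- real n..real n}) < \<infinity>"
      by (rule le_less_trans) simp
    then have e: "emeasure lborel (A \<inter> {- real n..real n}) = ennreal (measure lborel (A \<inter> {- real n..real n}))"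
      by (simp add: emeasure_eq_ennreal_measure)
    show ?thesis
      unfolding e using density_bounded_borel_set[OF \<mu>, of "A \<inter> {- real n..real n}" "- real n" "real n"] that R
      by (simp add: emeasure_eq_measure ennreal_mult[symmetric])
  qed
  have "absolutely_continuous lborel \<mu>"
    unfolding absolutely_continuous_def
  proof
    fix A :: "real set" assume A: "A \<in> null_sets lborel"
    then have Ab: "A \<in> sets borel" by auto
    have "emeasure \<mu> (A \<inter> {- real n..real n}) = 0" for n
    proof -
      have "emeasure lborel (A \<inter> {- real n..real n}) \<le> emeasure lborel A"
        using Ab by (intro emeasure_mono) auto
      then have "emeasure lborel (A \<inter> {- real n..real n}) = 0" using A by auto
      then show ?thesis using bd[OF Ab, of n] by simp
    qed
    then have "emeasure \<mu> (\<Union>n. A \<inter> {- real n..real n}) = 0"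
      using Ab by (intro emeasure_UN_eq_0) auto
    moreover have "(\<Union>n. A \<inter> {- real n..real n}) = A"
    proof -
      have "\<exists>n. - real n \<le> x \<and> x \<le> real n" for x :: real
        using real_arch_simple[of "\<bar>x\<bar>"] by (meson abs_le_D1 abs_le_D2 minus_le_iff)
      then show ?thesis by auto
    qed
    ultimately show "A \<in> null_sets \<mu>" using Ab by auto
  qed
  then obtain f where f[measurable]: "f \<in> borel_measurable lborel" and f\<mu>: "density lborel f = \<mu>"
    using sigma_finite_measure.Radon_Nikodym[OF lborel.sigma_finite_measure_axioms, of \<mu>] by auto
  have "AE x in lborel. x \<in> {- real n..real n} \<longrightarrow> f x \<le> R" for n
  proof -
    define B where "B = {x. f x > R} \<inter> {- real n..real n}"
    have B[measurable]: "B \<in> sets borel" unfolding B_def by measurable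
    have Bfin: "emeasure lborel B < \<infinity>"
      by (rule le_less_trans[OF emeasure_mono[of B "{- real n..real n}"]]) (auto simp: B_def)
    have "(\<integral>\<^sup>+x. f x * indicator B x - ennreal R * indicator B x \<partial>lborel) =
        (\<integral>\<^sup>+x. f x * indicator B x \<partial>lborel) - (\<integral>\<^sup>+x. ennreal R * indicator B x \<partial>lborel)"
      using Bfin
      by (intro nn_integral_diff)
        (auto simp: nn_integral_cmult_indicator ennreal_mult_less_top ennreal_mult_eq_top_iff B_def split: split_indicator)
    also have "(\<integral>\<^sup>+x. f x * indicator B x \<partial>lborel) = emeasure \<mu> B"
      unfolding f\<mu>[symmetric] by (subst emeasure_density) auto
    also have "(\<integral>\<^sup>+x. ennreal R * indicator B x \<partial>lborel) = ennreal R * emeasure lborel B"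
      by (simp add: nn_integral_cmult_indicator)
    also have "emeasure \<mu> B - ennreal R * emeasure lborel B = 0"
      using bd[of "{x. f x > R}" n] by (intro diff_eq_0_ennreal) (auto simp: B_def emeasure_eq_measure)
    finally have "AE x in lborel. f x * indicator B x - ennreal R * indicator B x = 0"
      by (subst (asm) nn_integral_0_iff_AE) auto
    then show ?thesis
    proof eventually_elim
      case (elim x)
      then show ?case
        using diff_gr0_ennreal[of "ennreal R" "f x"]
        by (cases "ennreal R < f x") (auto simp: B_def indicator_def)
    qed
  qed
  then have "AE x in lborel. \<forall>n. x \<in> {- real n..real n} \<longrightarrow> f x \<le> R"
    by (subst AE_all_countable) blast
  then have AE: "AE x in lborel. f x \<le> R"
  proof eventually_elim
    case (elim x)
    obtain n where "\<bar>x\<bar> \<le> real n" using real_arch_simple by blast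
    with elim show ?case by (auto simp: abs_le_iff dest: spec[of _ n])
  qed
  define \<rho> where "\<rho> x = enn2real (min (f x) R)" for x
  show ?thesis
  proof (rule that[of \<rho>])
    show "\<rho> \<in> borel_measurable borel" unfolding \<rho>_def by measurable
    show "0 \<le> \<rho> x" for x by (simp add: \<rho>_def)
    show "\<rho> x \<le> R" for x
      using R unfolding \<rho>_def by (intro enn2real_leI) auto
    have "AE x in lborel. f x = ennreal (\<rho> x)"
      using AE
    proof eventually_elim
      case (elim x)
      then have "f x < top" by (simp add: le_less_trans)
      with elim show ?case by (simp add: \<rho>_def min_absorb1)
    qed
    then show "\<mu> = density lborel (\<lambda>x. ennreal (\<rho> x))"
      unfolding f\<mu>[symmetric] by (intro density_cong) (auto simp: \<rho>_def)
  qed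
qed

lemma density_bounded_integral_le:
  assumes \<mu>: "density_bounded R \<mu>" and g: "integrable lborel g" "\<And>x. 0 \<le> g x"
  shows "(\<integral>x. g x \<partial>\<mu>) \<le> R * (\<integral>x. g x \<partial>lborel)"
proof -
  obtain \<rho> where \<rho>[measurable]: "\<rho> \<in> borel_measurable borel" and b: "\<And>x. 0 \<le> \<rho> x" "\<And>x. \<rho> x \<le> R"
    and eq: "\<mu> = density lborel (\<lambda>x. ennreal (\<rho> x))"
    using density_bounded_imp_density[OF \<mu>] by blast
  have [measurable]: "g \<in> borel_measurable borel" using borel_measurable_integrable[OF g(1)] by simp
  have "(\<integral>x. g x \<partial>\<mu>) = (\<integral>x. \<rho> x * g x \<partial>lborel)"
    unfolding eq using b by (subst integral_density) auto
  also have "\<dots> \<le> (\<integral>x. R * g x \<partial>lborel)"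
  proof (rule integral_mono)
    show "integrable lborel (\<lambda>x. \<rho> x * g x)"
      by (rule Bochner_Integration.integrable_bound[of _ "\<lambda>x. R * g x"])
        (use g b order_trans[OF b(1) b(2)] in \<open>auto simp: abs_mult intro!: mult_mono\<close>)
  qed (use g b in \<open>auto intro: mult_right_mono\<close>)
  finally show ?thesis by simp
qed

section \<open>Stochastic order up to a shift\<close>

text \<open>If mass is transported from \<open>\<nu>\<close> to \<open>\<mu>\<close> by moves of length at most \<open>e\<close>, then both measures are
related in this way, in both directions. Comparing tails instead of exhibiting a transport plan is what makes
the relation accessible to test functions.\<close>

definition shifted_le :: "real \<Rightarrow> real measure \<Rightarrow> real measure \<Rightarrow> bool" where
  "shifted_le e \<nu> \<mu> \<longleftrightarrow> (\<forall>a. measure \<nu> {a<..} \<le> measure \<mu> {a - e<..})"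

lemma up_closed_cases:
  fixes U :: "real set"
  assumes up: "\<And>x y. x \<in> U \<Longrightarrow> x \<le> y \<Longrightarrow> y \<in> U"
  obtains "U = {}" | "U = UNIV" | a where "U = {a<..}" | a where "U = {a..}"
proof (cases "U = {} \<or> U = UNIV")
  case False
  then obtain l where l: "l \<notin> U" by blast
  then have lb: "l \<le> x" if "x \<in> U" for x using up[OF that, of l] by linarith
  then have bdd: "bdd_below U" by (rule bdd_belowI)
  have "{Inf U<..} \<subseteq> U"
  proof
    fix x assume "x \<in> {Inf U<..}"
    then obtain y where "y \<in> U" "y < x" using False cInf_lessD[of U x] by auto
    then show "x \<in> U" using up by force
  qed
  moreover have "U \<subseteq> {Inf U..}" using cInf_lower[OF _ bdd] by auto
  moreover have "{Inf U..} = insert (Inf U) {Inf U<..}" by auto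
  moreover have "B \<subseteq> U \<Longrightarrow> U \<subseteq> insert a B \<Longrightarrow> U = insert a B \<or> U = B" for a B
    by blast
  ultimately have "U = {Inf U..} \<or> U = {Inf U<..}" by metis
  then show ?thesis using that(3)[of "Inf U"] that(4)[of "Inf U"] by blast
qed (use that in blast)

text \<open>Open half-lines determine the comparison on all up-closed sets: a closed half-line is a decreasing
limit and the whole line an increasing limit of open ones. In particular the masses agree if the relation holds
in both directions.\<close>

lemma shifted_le_up_closed:
  assumes \<nu>: "sets \<nu> = sets borel" "finite_measure \<nu>" and \<mu>: "sets \<mu> = sets borel" "finite_measure \<mu>"
    and le: "shifted_le e \<nu> \<mu>"
    and up: "\<And>x y. x \<in> U \<Longrightarrow> x \<le> y \<Longrightarrow> y \<in> U"
  shows "measure \<nu> U \<le> measure \<mu> {y. y + e \<in> U}"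
proof -
  interpret \<nu>: finite_measure \<nu> by fact
  interpret \<mu>: finite_measure \<mu> by fact
  have le': "measure \<nu> {a<..} \<le> measure \<mu> {a - e<..}" for a
    using le by (simp add: shifted_le_def)
  consider "U = {}" | "U = UNIV" | a where "U = {a<..}" | a where "U = {a..}"
    using up by (rule up_closed_cases)
  then show ?thesis
  proof cases
    assume U: "U = UNIV"
    have "(\<lambda>n. measure \<nu> {- real n<..}) \<longlonglongrightarrow> measure \<nu> (\<Union>n. {- real n<..})"
    proof (rule \<nu>.finite_Lim_measure_incseq)
      have "{- real n<..} \<in> sets \<nu>" for n unfolding \<nu>(1) by simp
      then show "range (\<lambda>n. {- real n<..}) \<subseteq> sets \<nu>" by (rule image_subsetI)
      show "incseq (\<lambda>n. {- real n<..})" unfolding incseq_def by simp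
    qed
    moreover have "(\<Union>n. {- real n<..}) = UNIV"
    proof -
      have "\<exists>n. - real n < x" for x using reals_Archimedean2[of "- x"] by (auto simp: minus_less_iff)
      then show ?thesis by auto
    qed
    moreover have "measure \<nu> {- real n<..} \<le> measure \<mu> UNIV" for n
      using le'[of "- real n"] \<mu>.finite_measure_mono[of "{- real n - e<..}" UNIV] \<mu>(1) by simp
    ultimately show ?thesis unfolding U by (simp add: LIMSEQ_le_const2)
  next
    fix a assume "U = {a<..}"
    moreover have "{y. y + e \<in> {a<..}} = {a - e<..}" by auto
    ultimately show ?thesis using le'[of a] by simp
  next
    fix a assume U: "U = {a..}"
    define c where "c n = inverse (real (Suc n))" for n
    have c_pos: "0 < c n" for n by (simp add: c_def)
    have c_anti: "c n \<le> c m" if "m \<le> n" for m n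
      unfolding c_def using that by (intro le_imp_inverse_le) auto
    have "(\<lambda>n. measure \<mu> {a - c n - e<..}) \<longlonglongrightarrow> measure \<mu> (\<Inter>n. {a - c n - e<..})"
    proof (intro \<mu>.finite_Lim_measure_decseq)
      show "decseq (\<lambda>n. {a - c n - e<..})"
        unfolding decseq_def using c_anti by simp
      have "{a - c n - e<..} \<in> sets \<mu>" for n unfolding \<mu>(1) by simp
      then show "range (\<lambda>n. {a - c n - e<..}) \<subseteq> sets \<mu>" by (rule image_subsetI)
    qed
    moreover have "(\<Inter>n. {a - c n - e<..}) = {a - e..}"
    proof (intro set_eqI iffI)
      fix x assume x: "x \<in> (\<Inter>n. {a - c n - e<..})"
      have "x \<ge> a - e"
      proof (rule ccontr)
        assume "\<not> x \<ge> a - e"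
        then obtain n where "c n < a - e - x"
          using reals_Archimedean[of "a - e - x"] unfolding c_def by auto
        moreover have "x > a - c n - e" using x by blast
        ultimately show False by linarith
      qed
      then show "x \<in> {a - e..}" by simp
    next
      fix x assume "x \<in> {a - e..}"
      then have "a - c n - e < x" for n using c_pos[of n] unfolding atLeast_iff by linarith
      then show "x \<in> (\<Inter>n. {a - c n - e<..})" by simp
    qed
    moreover have "measure \<nu> {a..} \<le> measure \<mu> {a - c n - e<..}" for n
    proof -
      have "{a..} \<subseteq> {a - c n<..}" using c_pos[of n] by (intro subsetI) simp
      then have "measure \<nu> {a..} \<le> measure \<nu> {a - c n<..}"
        using \<nu>(1) by (intro \<nu>.finite_measure_mono) auto
      also have "\<dots> \<le> measure \<mu> {a - c n - e<..}" by (rule le')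
      finally show ?thesis .
    qed
    ultimately have "measure \<nu> {a..} \<le> measure \<mu> {a - e..}"
      by (simp add: LIMSEQ_le_const)
    moreover have "{y. y + e \<in> {a..}} = {a - e..}" by auto
    ultimately show ?thesis using U by simp
  qed simp
qed

lemma nn_integral_layer_cake:
  fixes g :: "real \<Rightarrow> real"
  assumes "sets \<nu> = sets borel" "finite_measure \<nu>" and g: "g \<in> borel_measurable borel" "\<And>x. 0 \<le> g x"
  shows "(\<integral>\<^sup>+y. ennreal (g y) \<partial>\<nu>) = (\<integral>\<^sup>+s. emeasure \<nu> {y. s < g y} * indicator {0..} s \<partial>lborel)"
proof -
  interpret finite_measure \<nu> by fact
  interpret pair_sigma_finite lborel \<nu> ..
  have s[measurable_cong]: "sets \<nu> = sets borel" by fact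
  note [measurable] = g(1)
  have sp: "space \<nu> = UNIV" using sets_eq_imp_space_eq[OF s] by simp
  have "(\<integral>\<^sup>+y. ennreal (g y) \<partial>\<nu>) = (\<integral>\<^sup>+y. (\<integral>\<^sup>+s. indicator {0..<g y} s \<partial>lborel) \<partial>\<nu>)"
    using g by (intro nn_integral_cong) auto
  also have "\<dots> = (\<integral>\<^sup>+y. (\<integral>\<^sup>+s. indicator {p. 0 \<le> fst p \<and> fst p < g (snd p)} (s, y) \<partial>lborel) \<partial>\<nu>)"
    by (intro nn_integral_cong) (auto simp: indicator_def)
  also have "\<dots> = (\<integral>\<^sup>+s. (\<integral>\<^sup>+y. indicator {p. 0 \<le> fst p \<and> fst p < g (snd p)} (s, y) \<partial>\<nu>) \<partial>lborel)"
  proof (rule Fubini')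
    have "{p :: real \<times> real. 0 \<le> fst p \<and> fst p < g (snd p)} = {p \<in> space (lborel \<Otimes>\<^sub>M \<nu>). 0 \<le> fst p \<and> fst p < g (snd p)}"
      by (auto simp: space_pair_measure sp)
    also have "\<dots> \<in> sets (lborel \<Otimes>\<^sub>M \<nu>)" by measurable
    finally show "case_prod (\<lambda>s y. indicator {p. 0 \<le> fst p \<and> fst p < g (snd p)} (s, y) :: ennreal)
        \<in> borel_measurable (lborel \<Otimes>\<^sub>M \<nu>)" by simp
  qed
  also have "\<dots> = (\<integral>\<^sup>+s. emeasure \<nu> {y. s < g y} * indicator {0..} s \<partial>lborel)"
  proof (intro nn_integral_cong)
    fix s :: real
    have "{y. s < g y} \<in> sets \<nu>"
      unfolding s by measurable
    moreover have "(\<integral>\<^sup>+y. indicator {p. 0 \<le> fst p \<and> fst p < g (snd p)} (s, y) \<partial>\<nu>) =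
        (\<integral>\<^sup>+y. indicator {y. s < g y} y * indicator {0..} s \<partial>\<nu>)"
      by (intro nn_integral_cong) (auto simp: indicator_def)
    ultimately show "(\<integral>\<^sup>+y. indicator {p. 0 \<le> fst p \<and> fst p < g (snd p)} (s, y) \<partial>\<nu>) =
        emeasure \<nu> {y. s < g y} * indicator {0..} s"
      by (simp add: nn_integral_multc)
  qed
  finally show ?thesis .
qed

text \<open>By the layer-cake formula the integral of a nonnegative nondecreasing function is an average of
the masses of up-closed sets.\<close>

lemma shifted_le_integral:
  fixes g :: "real \<Rightarrow> real"
  assumes \<nu>: "sets \<nu> = sets borel" "finite_measure \<nu>" and \<mu>: "sets \<mu> = sets borel" "finite_measure \<mu>"
    and le: "shifted_le e \<nu> \<mu>" and g: "mono g" "\<And>x. 0 \<le> g x" "\<And>x. g x \<le> B"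
  shows "(\<integral>y. g y \<partial>\<nu>) \<le> (\<integral>y. g (y + e) \<partial>\<mu>)"
proof -
  interpret \<nu>: finite_measure \<nu> by fact
  interpret \<mu>: finite_measure \<mu> by fact
  have [measurable]: "g \<in> borel_measurable borel" using g(1) by (rule borel_measurable_mono)
  have [measurable]: "g \<in> borel_measurable \<nu>" "(\<lambda>y. g (y + e)) \<in> borel_measurable \<mu>"
    using \<nu>(1) \<mu>(1) by (auto cong: measurable_cong_sets)
  have "(\<integral>\<^sup>+y. ennreal (g y) \<partial>\<nu>) = (\<integral>\<^sup>+s. emeasure \<nu> {y. s < g y} * indicator {0..} s \<partial>lborel)"
    using \<nu> g by (intro nn_integral_layer_cake) auto
  also have "\<dots> \<le> (\<integral>\<^sup>+s. emeasure \<mu> {y. s < g (y + e)} * indicator {0..} s \<partial>lborel)"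
  proof (intro nn_integral_mono mult_right_mono)
    fix s
    have "measure \<nu> {y. s < g y} \<le> measure \<mu> {y. y + e \<in> {y. s < g y}}"
      using g(1) by (intro shifted_le_up_closed[OF \<nu> \<mu> le]) (auto simp: mono_def intro: less_le_trans)
    then show "emeasure \<nu> {y. s < g y} \<le> emeasure \<mu> {y. s < g (y + e)}"
      by (simp add: \<nu>.emeasure_eq_measure \<mu>.emeasure_eq_measure)
  qed simp
  also have "\<dots> = (\<integral>\<^sup>+y. ennreal (g (y + e)) \<partial>\<mu>)"
    using \<mu> g by (intro nn_integral_layer_cake[symmetric]) auto
  finally have *: "(\<integral>\<^sup>+y. ennreal (g y) \<partial>\<nu>) \<le> (\<integral>\<^sup>+y. ennreal (g (y + e)) \<partial>\<mu>)" .
  have "integrable \<nu> g" "integrable \<mu> (\<lambda>y. g (y + e))"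
    using g by (auto intro!: \<nu>.integrable_const_bound[of _ B] \<mu>.integrable_const_bound[of _ B])
  with * g show ?thesis
    by (simp add: nn_integral_eq_integral)
qed

section \<open>The downstream interaction\<close>

lemma density_bounded_Ici_shift:
  assumes \<mu>: "density_bounded R \<mu>" and "0 \<le> e"
  shows "measure \<mu> {x - e..} \<le> measure \<mu> {x..} + R * e"
proof -
  interpret finite_measure \<mu> using \<mu> by (simp add: density_bounded_def)
  have s: "sets \<mu> = sets borel" using \<mu> by (simp add: density_bounded_def)
  have "measure \<mu> {x - e..} \<le> measure \<mu> ({x - e..x} \<union> {x..})"
    by (rule finite_measure_mono) (use s in auto)
  also have "\<dots> \<le> measure \<mu> {x - e..x} + measure \<mu> {x..}"
    by (rule measure_Un_le) (use s in auto)
  also have "measure \<mu> {x - e..x} \<le> R * (x - (x - e))"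
    using assms by (intro density_bounded_Icc) auto
  finally show ?thesis by simp
qed

text \<open>The kernel \<open>k\<close> is the weight function on \<open>[0, \<eta>]\<close>, extended by zero to the line. It may jump up at \<open>0\<close>
and down at \<open>\<eta>\<close>; between the jumps it is Lipschitz with constant \<open>\<Lambda>\<close>.\<close>

locale interaction_kernel =
  fixes \<eta> :: real and k :: "real \<Rightarrow> real" and \<Lambda> :: real
  assumes \<eta>_pos: "\<eta> > 0"
    and k_outside: "\<And>u. u \<notin> {0..\<eta>} \<Longrightarrow> k u = 0"
    and k_nonneg: "\<And>u. 0 \<le> k u"
    and k_antimono: "\<And>u u'. 0 \<le> u \<Longrightarrow> u \<le> u' \<Longrightarrow> k u' \<le> k u"
    and k_lipschitz: "\<And>u u'. u \<in> {0..\<eta>} \<Longrightarrow> u' \<in> {0..\<eta>} \<Longrightarrow> \<bar>k u - k u'\<bar> \<le> \<Lambda> * \<bar>u - u'\<bar>"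
begin

lemma \<Lambda>_nonneg: "0 \<le> \<Lambda>"
proof -
  have "0 \<le> \<Lambda> * \<bar>0 - \<eta>\<bar>" using order_trans[OF abs_ge_zero k_lipschitz[of 0 \<eta>]] \<eta>_pos by simp
  then show ?thesis using \<eta>_pos by (simp add: zero_le_mult_iff)
qed

lemma k_le: "k u \<le> k 0"
  using k_antimono[of 0 u] k_outside[of u] k_nonneg[of 0] by fastforce

text \<open>Since \<open>k\<close> does not increase on the right half-line, it is \<open>k 0\<close> times the indicator of that half-line minus
a nondecreasing function. Both parts are monotone, so the stochastic order applies to them.\<close>

definition k_deficit :: "real \<Rightarrow> real" where
  "k_deficit u = (if u < 0 then 0 else k 0 - k u)"

lemma k_eq: "k u = k 0 * indicator {0..} u - k_deficit u"
  using k_outside[of u] by (auto simp: k_deficit_def)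

lemma mono_k_deficit: "mono k_deficit"
  unfolding mono_def k_deficit_def using k_antimono k_le by (auto simp: le_diff_eq)

lemma k_deficit_bounds: "0 \<le> k_deficit u" "k_deficit u \<le> k 0"
  using k_le[of u] k_nonneg by (auto simp: k_deficit_def)

lemma k_deficit_shift:
  assumes "0 \<le> e"
  shows "k_deficit (u + e) \<le> k_deficit u + \<Lambda> * e + k 0 * indicator {\<eta> - e..\<eta>} u"
proof -
  consider "u + e < 0" | "u < 0" "0 \<le> u + e" "u + e \<le> \<eta>" | "0 \<le> u" "u + e \<le> \<eta>" | "u \<le> \<eta>" "u + e > \<eta>" | "u > \<eta>"
    by atomize_elim auto
  then show ?thesis
  proof cases
    case 1
    then show ?thesis using assms \<Lambda>_nonneg k_nonneg[of 0] by (auto simp: k_deficit_def)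
  next
    case 2
    have "k 0 - k (u + e) \<le> \<Lambda> * \<bar>0 - (u + e)\<bar>" using k_lipschitz[of 0 "u + e"] 2 \<eta>_pos by auto
    also have "\<dots> \<le> \<Lambda> * e" using 2 \<Lambda>_nonneg by (intro mult_left_mono) auto
    finally show ?thesis using 2 k_nonneg[of 0] by (auto simp: k_deficit_def indicator_def)
  next
    case 3
    have "k u - k (u + e) \<le> \<Lambda> * \<bar>u - (u + e)\<bar>" using k_lipschitz[of u "u + e"] 3 assms by auto
    then show ?thesis using 3 assms k_nonneg[of 0] by (auto simp: k_deficit_def indicator_def)
  next
    case 4
    then show ?thesis
      using k_deficit_bounds[of u] k_deficit_bounds(2)[of "u + e"] mult_nonneg_nonneg[OF \<Lambda>_nonneg assms] by auto
  next
    case 5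
    then show ?thesis
      using assms \<eta>_pos mult_nonneg_nonneg[OF \<Lambda>_nonneg assms] k_nonneg[of 0] k_outside[of u] k_outside[of "u + e"]
      by (auto simp: k_deficit_def indicator_def)
  qed
qed

lemma k_deficit_borel[measurable]: "k_deficit \<in> borel_measurable borel"
  by (rule borel_measurable_mono[OF mono_k_deficit])

lemma k_borel[measurable]: "k \<in> borel_measurable borel"
proof -
  have "(\<lambda>u. k 0 * indicator {0..} u - k_deficit u) \<in> borel_measurable borel" by measurable
  then show ?thesis by (simp flip: k_eq)
qed

definition downstream :: "real measure \<Rightarrow> real \<Rightarrow> real" where
  "downstream \<mu> x = (\<integral>y. k (y - x) \<partial>\<mu>)"

lemma downstream_eq:
  assumes "sets \<mu> = sets borel" "finite_measure \<mu>"
  shows "downstream \<mu> x = k 0 * measure \<mu> {x..} - (\<integral>y. k_deficit (y - x) \<partial>\<mu>)"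
proof -
  interpret finite_measure \<mu> by fact
  have s[measurable_cong]: "sets \<mu> = sets borel" by fact
  have "integrable \<mu> (\<lambda>y. k_deficit (y - x))"
    using k_deficit_bounds by (intro integrable_const_bound[of _ "k 0"]) auto
  moreover have "integrable \<mu> (\<lambda>y. k 0 * indicator {x..} y)"
    by (intro integrable_mult_right integrable_real_indicator) (auto simp: s emeasure_eq_measure)
  moreover have "k (y - x) = k 0 * indicator {x..} y - k_deficit (y - x)" for y
    using k_eq[of "y - x"] by (auto simp: indicator_def)
  ultimately show ?thesis unfolding downstream_def using s
    by (simp add: sets_eq_imp_space_eq)
qed

lemma downstream_nonneg: "0 \<le> downstream \<mu> x"
  unfolding downstream_def using k_nonneg by (simp add: integral_nonneg_AE)

text \<open>The jumps of the kernel make the downstream integral discontinuous in the measure: mass may enter or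
leave the window \<open>[x, x + \<eta>]\<close>. If one of the two measures has density at most \<open>R\<close>, then the mass close to an
end of the window is of order \<open>R e\<close>. The other measure may well have atoms; this
asymmetry is what allows uniqueness in the class of all measure-valued solutions.\<close>

lemma downstream_close:
  assumes \<nu>: "sets \<nu> = sets borel" "finite_measure \<nu>" and \<mu>: "density_bounded R \<mu>"
    and le: "shifted_le e \<nu> \<mu>" "shifted_le e \<mu> \<nu>" and "0 \<le> e"
  shows "\<bar>downstream \<nu> x - downstream \<mu> x\<bar> \<le> (\<Lambda> * measure \<mu> UNIV + 2 * k 0 * R) * e"
proof -
  have s\<mu>: "sets \<mu> = sets borel" "finite_measure \<mu>" using \<mu> by (auto simp: density_bounded_def)
  interpret \<nu>: finite_measure \<nu> by fact
  interpret \<mu>: finite_measure \<mu> by fact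
  have [measurable_cong]: "sets \<nu> = sets borel" "sets \<mu> = sets borel" by fact+
  have R: "R \<ge> 0" using \<mu> by (simp add: density_bounded_def)
  let ?g = k_deficit
  have mono: "mono (\<lambda>y. ?g (y - c))" for c using mono_k_deficit by (auto simp: mono_def)
  have int: "integrable \<mu> (\<lambda>y. ?g (y - c))" "integrable \<nu> (\<lambda>y. ?g (y - c))" for c
    using k_deficit_bounds by (auto intro!: \<mu>.integrable_const_bound[of _ "k 0"] \<nu>.integrable_const_bound[of _ "k 0"])
  have shift: "(\<integral>y. ?g (y + e - c) \<partial>\<mu>) \<le> (\<integral>y. ?g (y - c) \<partial>\<mu>) + \<Lambda> * e * measure \<mu> UNIV + k 0 * (R * e)" for c
  proof -
    have "(\<integral>y. ?g (y - (c - e)) \<partial>\<mu>) \<le>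
        (\<integral>y. ?g (y - c) + (\<Lambda> * e + k 0 * indicator {c + \<eta> - e..c + \<eta>} y) \<partial>\<mu>)"
    proof (rule integral_mono)
      show "integrable \<mu> (\<lambda>y. ?g (y - c) + (\<Lambda> * e + k 0 * indicator {c + \<eta> - e..c + \<eta>} y))"
        using int by (intro Bochner_Integration.integrable_add integrable_mult_right integrable_real_indicator)
            (auto simp: \<mu>.emeasure_eq_measure)
      show "?g (y - (c - e)) \<le> ?g (y - c) + (\<Lambda> * e + k 0 * indicator {c + \<eta> - e..c + \<eta>} y)" for y
        using k_deficit_shift[OF \<open>0 \<le> e\<close>, of "y - c"] by (auto simp: indicator_def algebra_simps)
    qed (use int in auto)
    also have "\<dots> = (\<integral>y. ?g (y - c) \<partial>\<mu>) + (\<Lambda> * e * measure \<mu> UNIV + k 0 * measure \<mu> {c + \<eta> - e..c + \<eta>})"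
    proof -
      have i: "integrable \<mu> (\<lambda>y. k 0 * indicator {c + \<eta> - e..c + \<eta>} y)"
        by (intro integrable_mult_right integrable_real_indicator) (auto simp: \<mu>.emeasure_eq_measure)
      have "space \<mu> = UNIV" using s\<mu> by (simp add: sets_eq_imp_space_eq)
      then show ?thesis using int i by (simp add: Bochner_Integration.integral_add)
    qed
    also have "measure \<mu> {c + \<eta> - e..c + \<eta>} \<le> R * ((c + \<eta>) - (c + \<eta> - e))"
      using \<mu> \<open>0 \<le> e\<close> by (intro density_bounded_Icc) auto
    finally have *: "(\<integral>y. ?g (y - (c - e)) \<partial>\<mu>) \<le> (\<integral>y. ?g (y - c) \<partial>\<mu>) +
        (\<Lambda> * e * measure \<mu> UNIV + k 0 * (R * ((c + \<eta>) - (c + \<eta> - e))))"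
      using k_nonneg[of 0] by (simp add: mult_left_mono)
    then show ?thesis by (simp add: algebra_simps)
  qed
  have g1: "(\<integral>y. ?g (y - x) \<partial>\<nu>) \<le> (\<integral>y. ?g (y - x) \<partial>\<mu>) + \<Lambda> * e * measure \<mu> UNIV + k 0 * (R * e)"
    using shifted_le_integral[OF \<nu> s\<mu> le(1) mono[of x], of "k 0"] k_deficit_bounds shift[of x] by simp
  have g2: "(\<integral>y. ?g (y - x) \<partial>\<mu>) \<le> (\<integral>y. ?g (y - x) \<partial>\<nu>) + \<Lambda> * e * measure \<mu> UNIV + k 0 * (R * e)"
    using shifted_le_integral[OF s\<mu> \<nu> le(2) mono[of "x + e"], of "k 0"] k_deficit_bounds shift[of "x + e"]
    by simp
  have "measure \<nu> {x..} \<le> measure \<mu> {y. y + e \<in> {x..}}"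
    by (rule shifted_le_up_closed[OF \<nu> s\<mu> le(1)]) auto
  moreover have "{y. y + e \<in> {x..}} = {x - e..}" by auto
  ultimately have m1: "measure \<nu> {x..} \<le> measure \<mu> {x..} + R * e"
    using density_bounded_Ici_shift[OF \<mu> \<open>0 \<le> e\<close>, of x] by simp
  have "measure \<mu> {x + e..} \<le> measure \<nu> {y. y + e \<in> {x + e..}}"
    by (rule shifted_le_up_closed[OF s\<mu> \<nu> le(2)]) auto
  moreover have "{y. y + e \<in> {x + e..}} = {x..}" by auto
  ultimately have m2: "measure \<mu> {x..} \<le> measure \<nu> {x..} + R * e"
    using density_bounded_Ici_shift[OF \<mu> \<open>0 \<le> e\<close>, of "x + e"] by simp
  have "k 0 * measure \<nu> {x..} \<le> k 0 * (measure \<mu> {x..} + R * e)"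
       "k 0 * measure \<mu> {x..} \<le> k 0 * (measure \<nu> {x..} + R * e)"
    using m1 m2 k_nonneg[of 0] by (auto intro: mult_left_mono)
  then show ?thesis
    using g1 g2 unfolding downstream_eq[OF \<nu>] downstream_eq[OF s\<mu>] abs_le_iff
    by (simp add: algebra_simps)
qed

text \<open>Moving the observer by \<open>x - x'\<close> is the same as moving the measure.\<close>

lemma downstream_lipschitz:
  assumes \<mu>: "density_bounded R \<mu>"
  shows "\<bar>downstream \<mu> x - downstream \<mu> x'\<bar> \<le> (\<Lambda> * measure \<mu> UNIV + 2 * k 0 * R) * \<bar>x - x'\<bar>"
proof -
  have s\<mu>[measurable_cong]: "sets \<mu> = sets borel" "finite_measure \<mu>" using \<mu> by (auto simp: density_bounded_def)
  interpret finite_measure \<mu> by fact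
  define \<nu> where "\<nu> = distr \<mu> borel (\<lambda>y. y + (x - x'))"
  have \<nu>: "sets \<nu> = sets borel" "finite_measure \<nu>"
    unfolding \<nu>_def by (auto intro: finite_measure_distr)
  have "downstream \<nu> x = downstream \<mu> x'"
    unfolding downstream_def \<nu>_def by (subst integral_distr) (auto simp: algebra_simps)
  moreover have tail: "measure \<nu> {a<..} = measure \<mu> {a - (x - x')<..}" for a
  proof -
    have "(\<lambda>y. y + (x - x')) -` {a<..} = {a - (x - x')<..}" by auto
    then show ?thesis unfolding \<nu>_def by (subst measure_distr) (auto simp: sets_eq_imp_space_eq[OF s\<mu>(1)])
  qed
  have le: "shifted_le \<bar>x - x'\<bar> \<nu> \<mu>" "shifted_le \<bar>x - x'\<bar> \<mu> \<nu>"
    unfolding shifted_le_def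
  proof safe
    fix a
    have "{a - (x - x')<..} \<subseteq> {a - \<bar>x - x'\<bar><..}" by (simp add: abs_real_def)
    then show "measure \<nu> {a<..} \<le> measure \<mu> {a - \<bar>x - x'\<bar><..}"
      unfolding tail using s\<mu>(1) by (intro finite_measure_mono) simp_all
    have "{a<..} \<subseteq> {a - \<bar>x - x'\<bar> - (x - x')<..}" by (simp add: abs_real_def)
    then show "measure \<mu> {a<..} \<le> measure \<nu> {a - \<bar>x - x'\<bar><..}"
      unfolding tail using s\<mu>(1) by (intro finite_measure_mono) simp_all
  qed
  ultimately show ?thesis
    using downstream_close[OF \<nu> \<mu> le, of x] by simp
qed

text \<open>This inequality is the maximum principle in infinitesimal form. If the interval between two observers
carried the largest possible mass \<open>R (x2 - x1)\<close>, the observer in front would feel no more traffic than the one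
behind, and the gap could not shrink. In general the defect of the front observer is paid for by the mass that is
missing between them. The reason is that the function \<open>q\<close> below is nonnegative by monotonicity of the kernel, so
that its integral against the measure is at most \<open>R\<close> times its Lebesgue integral, in which the two translates
of \<open>k\<close> cancel.\<close>

lemma downstream_slope:
  assumes \<mu>: "density_bounded R \<mu>" and "x1 \<le> x2"
  shows "downstream \<mu> x2 - downstream \<mu> x1 \<le> k 0 * (R * (x2 - x1) - measure \<mu> {x1..<x2})"
proof -
  have s\<mu>[measurable_cong]: "sets \<mu> = sets borel" "finite_measure \<mu>" using \<mu> by (auto simp: density_bounded_def)
  interpret finite_measure \<mu> by fact
  have int: "integrable \<mu> (\<lambda>y. k (y - c))" for c
    using k_le k_nonneg by (intro integrable_const_bound[of _ "k 0"]) auto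
  have kint: "integrable lborel k"
  proof (rule Bochner_Integration.integrable_bound[of _ "\<lambda>u. k 0 * indicator {0..\<eta>} u"])
    show "integrable lborel (\<lambda>u. k 0 * indicator {0..\<eta>} u)"
      by (intro integrable_mult_right integrable_real_indicator) (auto simp: emeasure_lborel_Icc_eq)
  qed (use k_le k_nonneg k_outside in \<open>auto simp: indicator_def\<close>)
  have kintc: "integrable lborel (\<lambda>y. k (y - c))" "(\<integral>y. k (y - c) \<partial>lborel) = (\<integral>y. k y \<partial>lborel)" for c
    using lborel_integrable_real_affine[OF kint, of 1 "- c"] lborel_integral_real_affine[of 1 k "- c"] by simp_all
  \<comment> \<open>the kernel of the front observer, minus that of the rear one, made nonnegative between them\<close>
  let ?q = "\<lambda>y. k (y - x2) - k (y - x1) + k 0 * indicator {x1..<x2} y"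
  have ii: "integrable \<mu> (\<lambda>y. k 0 * indicator {x1..<x2} y)" "integrable lborel (\<lambda>y. k 0 * indicator {x1..<x2} y)"
    using \<open>x1 \<le> x2\<close> by (auto intro!: integrable_mult_right integrable_real_indicator simp: emeasure_eq_measure)
  have "(\<integral>y. ?q y \<partial>\<mu>) \<le> R * (\<integral>y. ?q y \<partial>lborel)"
  proof (rule density_bounded_integral_le[OF \<mu>])
    show "integrable lborel ?q" using kintc ii by auto
    show "0 \<le> ?q y" for y
    proof (cases "y < x2")
      case True
      then show ?thesis
        using k_outside[of "y - x2"] k_le[of "y - x1"] k_outside[of "y - x1"] by (auto simp: indicator_def)
    next
      case False
      then show ?thesis using k_antimono[of "y - x2" "y - x1"] \<open>x1 \<le> x2\<close> by (auto simp: indicator_def)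
    qed
  qed
  also have "(\<integral>y. ?q y \<partial>lborel) = k 0 * (x2 - x1)"
    using kintc ii \<open>x1 \<le> x2\<close> by simp
  also have "(\<integral>y. ?q y \<partial>\<mu>) = downstream \<mu> x2 - downstream \<mu> x1 + k 0 * measure \<mu> {x1..<x2}"
    using int ii sets_eq_imp_space_eq[OF s\<mu>(1)] by (simp add: downstream_def)
  finally show ?thesis by (simp add: algebra_simps)
qed

end

section \<open>Relaxation towards a driving signal\<close>

lemma deriv_within_nonneg_imp_le:
  fixes f :: "real \<Rightarrow> real"
  assumes "a \<le> b" and d: "\<And>t. t \<in> {a..b} \<Longrightarrow> (f has_real_derivative f' t) (at t within {a..b})"
    and nn: "\<And>t. t \<in> {a..b} \<Longrightarrow> 0 \<le> f' t"
  shows "f a \<le> f b"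
proof -
  have "(f' has_integral (f b - f a)) {a..b}"
    using assms by (intro fundamental_theorem_of_calculus)
      (auto simp: has_real_derivative_iff_has_vector_derivative[symmetric])
  then have "0 \<le> f b - f a" using nn by (rule has_integral_nonneg)
  then show ?thesis by simp
qed

lemma lipschitz_imp_continuous_on:
  fixes f :: "real \<Rightarrow> real"
  assumes "\<And>s t. s \<in> S \<Longrightarrow> t \<in> S \<Longrightarrow> \<bar>f s - f t\<bar> \<le> B * \<bar>s - t\<bar>"
  shows "continuous_on S f"
proof (rule lipschitz_on_continuous_on)
  show "(max B 0)-lipschitz_on S f"
  proof (rule lipschitz_onI)
    fix s t assume "s \<in> S" "t \<in> S"
    then have "\<bar>f s - f t\<bar> \<le> B * \<bar>s - t\<bar>" by (rule assms)
    also have "\<dots> \<le> max B 0 * \<bar>s - t\<bar>" by (intro mult_right_mono) auto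
    finally show "dist (f s) (f t) \<le> max B 0 * dist s t" by (simp add: dist_real_def)
  qed simp
qed

lemma deriv_within_bounded_imp_lipschitz:
  fixes f :: "real \<Rightarrow> real"
  assumes d: "\<And>t. t \<in> {0..T} \<Longrightarrow> (f has_real_derivative f' t) (at t within {0..T})"
    and b: "\<And>t. t \<in> {0..T} \<Longrightarrow> \<bar>f' t\<bar> \<le> B" and "s \<in> {0..T}" "t \<in> {0..T}"
  shows "\<bar>f s - f t\<bar> \<le> B * \<bar>s - t\<bar>"
  using field_differentiable_bound[of "{0..T}" f f' B s t] assms by simp

text \<open>The solution of \<open>y' = r (u - y)\<close> with \<open>y 0 = x\<close>. Its value at time \<open>t\<close> is a weighted average of \<open>x\<close> and
of the values of \<open>u\<close> on \<open>[0, t]\<close>, so every convex constraint satisfied by these is inherited.\<close>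

definition relax :: "real \<Rightarrow> (real \<Rightarrow> real) \<Rightarrow> real \<Rightarrow> real \<Rightarrow> real" where
  "relax r u x t = exp (- r * t) * (x + r * integral {0..t} (\<lambda>s. exp (r * s) * u s))"

lemma relax_0 [simp]: "relax r u x 0 = x"
  by (simp add: relax_def)

lemma relax_has_derivative:
  assumes u: "continuous_on {0..T} u" and t: "t \<in> {0..T}"
  shows "(relax r u x has_real_derivative r * (u t - relax r u x t)) (at t within {0..T})"
proof -
  have "((\<lambda>t. integral {0..t} (\<lambda>s. exp (r * s) * u s)) has_real_derivative exp (r * t) * u t)
      (at t within {0..T})"
    by (intro integral_has_real_derivative continuous_intros u t)
  then show ?thesis
    unfolding relax_def
    by (auto intro!: derivative_eq_intros simp: algebra_simps exp_minus)
qed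

text \<open>Comparison with a supersolution. All estimates of the Picard iterates below are instances, for
suitable explicit \<open>y\<close>.\<close>

lemma relax_le:
  assumes "0 < r" "0 \<le> t" and u: "continuous_on {0..t} u"
    and y: "\<And>s. s \<in> {0..t} \<Longrightarrow> (y has_real_derivative y' s) (at s within {0..t})"
    and le: "\<And>s. s \<in> {0..t} \<Longrightarrow> u s \<le> y s + y' s / r" and "x \<le> y 0"
  shows "relax r u x t \<le> y t"
proof -
  let ?f = "\<lambda>s. exp (r * s) * (y s - relax r u x s)"
  let ?f' = "\<lambda>s. exp (r * s) * (r * (y s + y' s / r - u s))"
  have "?f 0 \<le> ?f t"
  proof (rule deriv_within_nonneg_imp_le[OF \<open>0 \<le> t\<close>])
    fix s assume s: "s \<in> {0..t}"
    show "(?f has_real_derivative ?f' s) (at s within {0..t})"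
      by (rule derivative_eq_intros relax_has_derivative[OF u s] y[OF s] refl)+
        (use \<open>0 < r\<close> in \<open>simp add: field_simps\<close>)
    show "0 \<le> ?f' s" using le[OF s] \<open>0 < r\<close> by simp
  qed
  then have "0 \<le> exp (r * t) * (y t - relax r u x t)" using \<open>x \<le> y 0\<close> by simp
  then show ?thesis by (simp add: zero_le_mult_iff)
qed

lemma relax_diff:
  assumes "continuous_on {0..t} u" "continuous_on {0..t} u'"
  shows "relax r u x t - relax r u' x' t = relax r (\<lambda>s. u s - u' s) (x - x') t"
proof -
  have "integral {0..t} (\<lambda>s. exp (r * s) * (u s - u' s)) =
      integral {0..t} (\<lambda>s. exp (r * s) * u s) - integral {0..t} (\<lambda>s. exp (r * s) * u' s)"
    unfolding right_diff_distrib
    by (intro integral_diff integrable_continuous_real continuous_intros assms)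
  then show ?thesis unfolding relax_def by (simp only:) (simp add: algebra_simps)
qed

lemma relax_minus: "relax r (\<lambda>s. - u s) (- x) t = - relax r u x t"
  by (simp add: relax_def algebra_simps)

lemma relax_ge_const:
  assumes "0 < r" "0 \<le> t" "continuous_on {0..t} u" "\<And>s. s \<in> {0..t} \<Longrightarrow> c \<le> u s" "c \<le> x"
  shows "c \<le> relax r u x t"
proof -
  have "relax r (\<lambda>s. - u s) (- x) t \<le> (\<lambda>_. - c) t"
    using assms by (intro relax_le[where y' = "\<lambda>_. 0"]) (auto intro: continuous_intros)
  then show ?thesis by (simp add: relax_minus)
qed

section \<open>Admissible configurations and the maximum principle\<close>

text \<open>Here \<open>m0\<close> is the initial mass, which also labels the particles: the particle with label \<open>z\<close> starts
at \<open>z\<close>. The velocity law \<open>vel\<close> is defined on the whole line.\<close>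

locale nonlocal_flow = interaction_kernel +
  fixes vel :: "real \<Rightarrow> real" and V Lv :: real and m0 :: "real measure" and R :: real
  assumes vel_antimono: "\<And>s s'. s \<le> s' \<Longrightarrow> vel s' \<le> vel s"
    and vel_lipschitz: "\<And>s s'. \<bar>vel s - vel s'\<bar> \<le> Lv * \<bar>s - s'\<bar>"
    and vel_bounds: "\<And>s. 0 \<le> vel s" "\<And>s. vel s \<le> V"
    and m0: "density_bounded R m0"
begin

lemma m0_sets [measurable_cong, simp]: "sets m0 = sets borel"
  and m0_finite: "finite_measure m0" and R_nonneg: "0 \<le> R"
  using m0 by (auto simp: density_bounded_def)

lemma m0_space [simp]: "space m0 = UNIV"
  using sets_eq_imp_space_eq[OF m0_sets] by simp

sublocale m0: finite_measure m0 by (rule m0_finite)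

lemma V_nonneg: "0 \<le> V" using order_trans[OF vel_bounds(1) vel_bounds(2)] .

lemma Lv_nonneg: "0 \<le> Lv"
  using order_trans[OF abs_ge_zero vel_lipschitz[of 0 1]] by simp

text \<open>The Lipschitz constant of the downstream integral at a measure with the mass of \<open>m0\<close> and density at
most \<open>R\<close>.\<close>

definition K :: real where "K = \<Lambda> * measure m0 UNIV + 2 * k 0 * R"

lemma K_nonneg: "0 \<le> K"
  unfolding K_def using \<Lambda>_nonneg k_nonneg R_nonneg by simp

text \<open>A configuration \<open>X\<close> places the particle with label \<open>z\<close> at \<open>X z\<close>. The second condition says, in
Lagrangian terms, that the transported mass has density at most \<open>R\<close>. It is linear in \<open>X\<close>, so it survives
averaging and pointwise limits.\<close>

definition admissible :: "(real \<Rightarrow> real) \<Rightarrow> bool" where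
  "admissible X \<longleftrightarrow>
     (\<forall>z1 z2. z1 \<le> z2 \<longrightarrow> X z1 \<le> X z2 \<and> measure m0 {z1<..z2} \<le> R * (X z2 - X z1)) \<and>
     (\<exists>B. \<forall>z. \<bar>X z - z\<bar> \<le> B)"

lemma admissible_mono: "admissible X \<Longrightarrow> z1 \<le> z2 \<Longrightarrow> X z1 \<le> X z2"
  and admissible_mass: "admissible X \<Longrightarrow> z1 \<le> z2 \<Longrightarrow> measure m0 {z1<..z2} \<le> R * (X z2 - X z1)"
  by (auto simp: admissible_def)

lemma admissible_borel [measurable_dest]: "admissible X \<Longrightarrow> X \<in> borel_measurable borel"
  by (rule borel_measurable_mono) (auto simp: mono_def admissible_mono)

definition push :: "(real \<Rightarrow> real) \<Rightarrow> real measure" where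
  "push X = distr m0 borel X"

lemma push_sets [simp]: "sets (push X) = sets borel"
  by (simp add: push_def)

lemma push_space [simp]: "space (push X) = UNIV"
  by (simp add: push_def)

lemma push_measure:
  assumes "X \<in> borel_measurable borel" "A \<in> sets borel"
  shows "measure (push X) A = measure m0 {z. X z \<in> A}"
proof -
  have "X -` A = {z. X z \<in> A}" by auto
  then show ?thesis using assms unfolding push_def by (subst measure_distr) auto
qed

lemma push_finite: "X \<in> borel_measurable borel \<Longrightarrow> finite_measure (push X)"
  unfolding push_def by (rule m0.finite_measure_distr) simp

text \<open>The labels of the particles inside an interval form an interval. Its end points need not be attained,
so labels close to the infimum and the supremum are used; the remaining labels carry little mass.\<close>

lemma push_density_bounded:
  assumes X: "admissible X"
  shows "density_bounded R (push X)"
  unfolding density_bounded_def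
proof (intro conjI allI impI)
  note [measurable] = admissible_borel[OF X]
  show "sets (push X) = sets borel" "0 \<le> R" by (simp_all add: R_nonneg)
  show "finite_measure (push X)" by (rule push_finite) simp
  fix a b :: real assume "a \<le> b"
  define J where "J = {z. a < X z \<and> X z < b}"
  have J: "measure (push X) {a<..<b} = measure m0 J"
    unfolding J_def by (subst push_measure) auto
  have [measurable]: "J \<in> sets borel" unfolding J_def by measurable
  show "measure (push X) {a<..<b} \<le> R * (b - a)"
  proof (cases "J = {}")
    case True
    then show ?thesis unfolding J using \<open>a \<le> b\<close> R_nonneg by simp
  next
    case False
    obtain B where B: "\<And>z. \<bar>X z - z\<bar> \<le> B" using X unfolding admissible_def by blast
    have JB: "a - B \<le> z \<and> z \<le> b + B" if "z \<in> J" for z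
      using that B[of z] unfolding J_def by (auto simp: abs_le_iff)
    then have bdd: "bdd_below J" "bdd_above J" by (auto intro!: bdd_belowI bdd_aboveI)
    define p q where "p = Inf J" and "q = Sup J"
    have Jpq: "J \<subseteq> {p..q}" unfolding p_def q_def using bdd by (auto intro: cInf_lower cSup_upper)
    show ?thesis
    proof (rule field_le_epsilon)
      fix e :: real assume "e > 0"
      define d where "d = e / (2 * R + 1)"
      have d: "d > 0" "2 * R * d \<le> e" using R_nonneg \<open>e > 0\<close> by (auto simp: d_def field_simps)
      obtain z1 where z1: "z1 \<in> J" "z1 < p + d" using cInf_lessD[OF False, of "p + d"] d unfolding p_def by auto
      obtain z2 where z2: "z2 \<in> J" "q - d < z2" using less_cSupD[OF False, of "q - d"] d unfolding q_def by auto
      have pz: "p \<le> z1" "z2 \<le> q" using Jpq z1 z2 by auto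
      have mid: "measure m0 {z1<..z2} \<le> R * (b - a)"
      proof (cases "z1 \<le> z2")
        case True
        have "measure m0 {z1<..z2} \<le> R * (X z2 - X z1)" by (rule admissible_mass[OF X True])
        also have "\<dots> \<le> R * (b - a)"
          using z1(1) z2(1) R_nonneg unfolding J_def by (intro mult_left_mono) auto
        finally show ?thesis .
      qed (use R_nonneg \<open>a \<le> b\<close> in simp)
      have "measure m0 J \<le> measure m0 ({p..z1} \<union> {z1<..z2} \<union> {z2..q})"
        using Jpq by (intro m0.finite_measure_mono) (auto simp: not_le not_less)
      also have "\<dots> \<le> measure m0 ({p..z1} \<union> {z1<..z2}) + measure m0 {z2..q}"
        by (rule measure_Un_le) auto
      also have "measure m0 ({p..z1} \<union> {z1<..z2}) \<le> measure m0 {p..z1} + measure m0 {z1<..z2}"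
        by (rule measure_Un_le) auto
      also have "measure m0 {p..z1} \<le> R * d"
        using density_bounded_Icc[OF m0 pz(1)] z1(2) R_nonneg mult_left_mono[of "z1 - p" d R] by simp
      also have "measure m0 {z2..q} \<le> R * d"
        using density_bounded_Icc[OF m0 pz(2)] z2(2) R_nonneg mult_left_mono[of "q - z2" d R] by simp
      finally show "measure (push X) {a<..<b} \<le> R * (b - a) + e"
        unfolding J using mid d by (simp add: algebra_simps)
    qed
  qed
qed

lemma push_UNIV: "X \<in> borel_measurable borel \<Longrightarrow> measure (push X) UNIV = measure m0 UNIV"
  by (simp add: push_measure)

lemma push_shifted_le:
  assumes [measurable]: "X \<in> borel_measurable borel" "Y \<in> borel_measurable borel"
    and "\<And>z. \<bar>X z - Y z\<bar> \<le> e"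
  shows "shifted_le e (push X) (push Y)"
  unfolding shifted_le_def
proof
  fix a
  have "{z. X z \<in> {a<..}} \<subseteq> {z. Y z \<in> {a - e<..}}"
  proof safe
    fix z assume "a < X z"
    then show "a - e < Y z" using assms(3)[of z] by linarith
  qed
  moreover have "{z. Y z \<in> {a - e<..}} \<in> sets m0" by simp
  ultimately show "measure (push X) {a<..} \<le> measure (push Y) {a - e<..}"
    by (simp only: push_measure[OF assms(1)] push_measure[OF assms(2)] borel_open open_greaterThan)
      (rule m0.finite_measure_mono)
qed

definition velocity :: "real measure \<Rightarrow> real \<Rightarrow> real" where
  "velocity \<mu> x = vel (downstream \<mu> x)"

lemma velocity_bounds: "0 \<le> velocity \<mu> x" "velocity \<mu> x \<le> V"
  by (simp_all add: velocity_def vel_bounds)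

lemma transport_rate_bound:
  assumes "\<bar>a\<bar> \<le> B" "\<bar>b\<bar> \<le> B"
  shows "\<bar>a + b * velocity \<mu> x\<bar> \<le> B + B * V"
proof -
  have "\<bar>a + b * velocity \<mu> x\<bar> \<le> \<bar>a\<bar> + \<bar>b\<bar> * \<bar>velocity \<mu> x\<bar>"
    unfolding abs_mult[symmetric] by (rule abs_triangle_ineq)
  also have "\<dots> \<le> B + B * V"
    using assms velocity_bounds by (intro add_mono mult_mono) (auto simp: abs_of_nonneg)
  finally show ?thesis .
qed

lemma velocity_lipschitz:
  assumes "density_bounded R \<mu>" "measure \<mu> UNIV = measure m0 UNIV"
  shows "\<bar>velocity \<mu> x - velocity \<mu> x'\<bar> \<le> Lv * K * \<bar>x - x'\<bar>"
proof -
  have "\<bar>velocity \<mu> x - velocity \<mu> x'\<bar> \<le> Lv * \<bar>downstream \<mu> x - downstream \<mu> x'\<bar>"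
    unfolding velocity_def by (rule vel_lipschitz)
  also have "\<dots> \<le> Lv * (K * \<bar>x - x'\<bar>)"
    using downstream_lipschitz[OF assms(1)] Lv_nonneg unfolding K_def assms(2)
    by (intro mult_left_mono) auto
  finally show ?thesis by (simp add: mult.assoc)
qed

lemma velocity_close:
  assumes "sets \<nu> = sets borel" "finite_measure \<nu>"
    and "density_bounded R \<mu>" "measure \<mu> UNIV = measure m0 UNIV"
    and "shifted_le e \<nu> \<mu>" "shifted_le e \<mu> \<nu>" "0 \<le> e"
  shows "\<bar>velocity \<nu> x - velocity \<mu> x\<bar> \<le> Lv * K * e"
proof -
  have "\<bar>velocity \<nu> x - velocity \<mu> x\<bar> \<le> Lv * \<bar>downstream \<nu> x - downstream \<mu> x\<bar>"
    unfolding velocity_def by (rule vel_lipschitz)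
  also have "\<dots> \<le> Lv * (K * e)"
    using downstream_close[OF assms(1-3) assms(5-7)] Lv_nonneg unfolding K_def assms(4)
    by (intro mult_left_mono) auto
  finally show ?thesis by (simp add: mult.assoc)
qed

definition speed :: "(real \<Rightarrow> real) \<Rightarrow> real \<Rightarrow> real" where
  "speed X z = velocity (push X) (X z)"

text \<open>The Lipschitz constant of the speeds with respect to the largest displacement of a particle: one half is due
to the change of the measure, the other half to the change of the position of the observer.\<close>

definition C :: real where "C = 2 * Lv * K"

lemma C_nonneg: "0 \<le> C" unfolding C_def using Lv_nonneg K_nonneg by simp

lemma speed_bounds: "0 \<le> speed X z" "speed X z \<le> V"
  by (simp_all add: speed_def velocity_bounds)

lemma speed_close:
  assumes X: "admissible X" and Y: "admissible Y" and e: "\<And>z. \<bar>X z - Y z\<bar> \<le> e"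
  shows "\<bar>speed X z - speed Y z\<bar> \<le> C * e"
proof -
  note b = admissible_borel[OF X] admissible_borel[OF Y]
  have "\<bar>Y z - X z\<bar> \<le> e" for z using e[of z] by (simp add: abs_minus_commute)
  then have "\<bar>velocity (push X) (X z) - velocity (push Y) (X z)\<bar> \<le> Lv * K * e"
    using e order_trans[OF abs_ge_zero e] X Y b
    by (intro velocity_close push_shifted_le push_finite push_density_bounded push_UNIV push_sets)
  moreover have "\<bar>velocity (push Y) (X z) - velocity (push Y) (Y z)\<bar> \<le> Lv * K * \<bar>X z - Y z\<bar>"
    using Y b by (intro velocity_lipschitz push_density_bounded push_UNIV)
  moreover have "Lv * K * \<bar>X z - Y z\<bar> \<le> Lv * K * e"
    using e Lv_nonneg K_nonneg by (intro mult_left_mono) auto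
  ultimately show ?thesis unfolding speed_def C_def by linarith
qed

text \<open>The inverse of an Euler time step that is short enough to keep configurations admissible; the
summand \<open>1\<close> only ensures positivity.\<close>

definition rate :: real where "rate = Lv * k 0 * R + 1"

lemma rate_pos: "0 < rate"
  unfolding rate_def using Lv_nonneg k_nonneg[of 0] R_nonneg by (simp add: add_nonneg_pos)

text \<open>The transported measure has no atoms, so it does not matter that the interval of labels and the interval
of positions are closed at different ends.\<close>

lemma push_Ico_ge:
  assumes X: "admissible X" and z: "z1 \<le> z2"
  shows "measure m0 {z1<..z2} \<le> measure (push X) {X z1..<X z2}"
proof -
  note [measurable] = admissible_borel[OF X]
  interpret \<mu>: finite_measure "push X" by (rule push_finite) simp
  have "measure m0 {z1<..z2} \<le> measure m0 {z. X z \<in> {X z1..X z2}}"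
    by (rule m0.finite_measure_mono) (auto intro: admissible_mono[OF X])
  also have "\<dots> = measure (push X) {X z1..X z2}" by (simp add: push_measure)
  also have "\<dots> \<le> measure (push X) ({X z1..<X z2} \<union> {X z2..X z2})"
    by (rule \<mu>.finite_measure_mono) auto
  also have "\<dots> \<le> measure (push X) {X z1..<X z2} + measure (push X) {X z2..X z2}"
    by (rule measure_Un_le) auto
  also have "measure (push X) {X z2..X z2} \<le> 0"
    using density_bounded_Icc[OF push_density_bounded[OF X], of "X z2" "X z2"] by simp
  finally show ?thesis by simp
qed

text \<open>The maximum principle for one explicit Euler step. With \<open>d\<close> the distance of two particles and \<open>h\<close> the mass
between them, admissibility is \<open>h \<le> R d\<close>, and the slope estimate of the downstream integral shows that one
step of length \<open>1 / rate\<close> decreases \<open>d\<close> by at most \<open>\<theta> (R d - h)\<close> with \<open>\<theta> R \<le> 1\<close>. Hence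
\<open>R d - h\<close> stays nonnegative.\<close>

lemma euler_step_admissible:
  assumes X: "admissible X" and z: "z1 \<le> z2"
  shows "X z1 + speed X z1 / rate \<le> X z2 + speed X z2 / rate"
    and "measure m0 {z1<..z2} \<le> R * ((X z2 + speed X z2 / rate) - (X z1 + speed X z1 / rate))"
proof -
  define h where "h = measure m0 {z1<..z2}"
  define d where "d = X z2 - X z1"
  define s where "s = (speed X z2 - speed X z1) / rate"
  have d: "0 \<le> d" "h \<le> R * d" "0 \<le> h"
    using admissible_mono[OF X z] admissible_mass[OF X z] by (auto simp: d_def h_def)
  define \<theta> where "\<theta> = Lv * k 0 / rate"
  have \<theta>: "0 \<le> \<theta>" "\<theta> * R \<le> 1"
    unfolding \<theta>_def rate_def using Lv_nonneg k_nonneg[of 0] R_nonneg by (auto simp: divide_simps add_nonneg_pos)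
  have "- s \<le> \<theta> * (R * d - h)"
  proof (cases "downstream (push X) (X z2) \<le> downstream (push X) (X z1)")
    case True
    then have "0 \<le> s" unfolding s_def speed_def velocity_def using vel_antimono[OF True] rate_pos by simp
    moreover have "0 \<le> \<theta> * (R * d - h)" using \<theta> d by simp
    ultimately show ?thesis by linarith
  next
    case False
    have "speed X z1 - speed X z2 \<le> Lv * \<bar>downstream (push X) (X z1) - downstream (push X) (X z2)\<bar>"
      unfolding speed_def velocity_def using vel_lipschitz abs_le_D1 by blast
    also have "\<dots> = Lv * (downstream (push X) (X z2) - downstream (push X) (X z1))"
      using False by simp
    also have "\<dots> \<le> Lv * (k 0 * (R * (X z2 - X z1) - measure (push X) {X z1..<X z2}))"
      by (intro mult_left_mono downstream_slope push_density_bounded X admissible_mono[OF X z] Lv_nonneg)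
    also have "\<dots> \<le> Lv * (k 0 * (R * d - h))"
      using push_Ico_ge[OF X z] Lv_nonneg k_nonneg[of 0] unfolding d_def h_def
      by (intro mult_left_mono) auto
    finally have "(speed X z1 - speed X z2) / rate \<le> Lv * (k 0 * (R * d - h)) / rate"
      using rate_pos by (intro divide_right_mono) auto
    moreover have "- s = (speed X z1 - speed X z2) / rate"
      by (simp add: s_def diff_divide_distrib)
    ultimately show ?thesis by (simp add: \<theta>_def)
  qed
  moreover have "\<theta> * (R * d - h) \<le> d"
  proof -
    have "\<theta> * R * d \<le> 1 * d" using \<theta> d by (intro mult_right_mono) auto
    moreover have "0 \<le> \<theta> * h" using \<theta> d by simp
    ultimately show ?thesis by (simp add: algebra_simps)
  qed
  ultimately show "X z1 + speed X z1 / rate \<le> X z2 + speed X z2 / rate"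
    unfolding s_def d_def by (simp add: diff_divide_distrib)
  have "R * - s \<le> R * (\<theta> * (R * d - h))" using R_nonneg \<open>- s \<le> _\<close> by (intro mult_left_mono)
  also have "\<dots> = (\<theta> * R) * (R * d - h)" by (simp add: mult_ac)
  also have "\<dots> \<le> 1 * (R * d - h)" using \<theta> d by (intro mult_right_mono) auto
  finally show "measure m0 {z1<..z2} \<le> R * ((X z2 + speed X z2 / rate) - (X z1 + speed X z1 / rate))"
    unfolding s_def d_def h_def by (simp add: diff_divide_distrib algebra_simps)
qed

section \<open>Construction of the flow\<close>

text \<open>The bounds that all Picard iterates share. The last one, equicontinuity in time, makes the speeds continuous
in time; its constant depends on the time horizon because the iterates follow the relaxed equation.\<close>

definition trajectories :: "(real \<Rightarrow> real \<Rightarrow> real) \<Rightarrow> bool" where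
  "trajectories X \<longleftrightarrow>
     (\<forall>t\<ge>0. \<forall>z1 z2. z1 \<le> z2 \<longrightarrow> X t z1 \<le> X t z2 \<and> measure m0 {z1<..z2} \<le> R * (X t z2 - X t z1)) \<and>
     (\<forall>t\<ge>0. \<forall>z. z \<le> X t z \<and> X t z \<le> z + V * t) \<and>
     (\<forall>T. \<forall>s\<in>{0..T}. \<forall>t\<in>{0..T}. \<forall>z. \<bar>X s z - X t z\<bar> \<le> V * (1 + rate * T) * \<bar>s - t\<bar>)"

lemma trajectories_admissible:
  assumes "trajectories X" "0 \<le> t"
  shows "admissible (X t)"
  unfolding admissible_def
proof
  show "\<exists>B. \<forall>z. \<bar>X t z - z\<bar> \<le> B"
    using assms unfolding trajectories_def by (intro exI[of _ "V * t"]) (auto simp: abs_le_iff algebra_simps)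
qed (use assms in \<open>auto simp: trajectories_def\<close>)

lemma trajectories_bounds: "trajectories X \<Longrightarrow> 0 \<le> t \<Longrightarrow> z \<le> X t z" "trajectories X \<Longrightarrow> 0 \<le> t \<Longrightarrow> X t z \<le> z + V * t"
  by (auto simp: trajectories_def)

text \<open>The equation \<open>X' = speed X\<close> is the same as \<open>X' = rate (drive X - X)\<close>, where \<open>drive X\<close> is the
configuration after an Euler step. Iterating on the second form keeps all iterates admissible, which iterating on the
first one would not.\<close>

definition drive :: "(real \<Rightarrow> real \<Rightarrow> real) \<Rightarrow> real \<Rightarrow> real \<Rightarrow> real" where
  "drive X z s = X s z + speed (X s) z / rate"

lemma trajectories_continuous:
  assumes X: "trajectories X"
  shows "continuous_on {0..T} (\<lambda>s. X s z)" "continuous_on {0..T} (\<lambda>s. speed (X s) z)"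
    "continuous_on {0..T} (drive X z)"
proof -
  have l: "\<bar>X s z - X t z\<bar> \<le> V * (1 + rate * T) * \<bar>s - t\<bar>" if "s \<in> {0..T}" "t \<in> {0..T}" for s t z
    using X that unfolding trajectories_def by blast
  then show 1: "continuous_on {0..T} (\<lambda>s. X s z)" by (rule lipschitz_imp_continuous_on)
  show 2: "continuous_on {0..T} (\<lambda>s. speed (X s) z)"
  proof (rule lipschitz_imp_continuous_on)
    fix s t assume st: "s \<in> {0..T}" "t \<in> {0..T}"
    then have "\<bar>speed (X s) z - speed (X t) z\<bar> \<le> C * (V * (1 + rate * T) * \<bar>s - t\<bar>)"
      by (intro speed_close trajectories_admissible[OF X] l) auto
    then show "\<bar>speed (X s) z - speed (X t) z\<bar> \<le> C * (V * (1 + rate * T)) * \<bar>s - t\<bar>"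
      by (simp add: mult.assoc)
  qed
  show "continuous_on {0..T} (drive X z)"
    unfolding drive_def using rate_pos by (intro continuous_intros 1 2) auto
qed

lemma trajectories_relax:
  assumes X: "trajectories X"
  shows "trajectories (\<lambda>t z. relax rate (drive X z) z t)" (is "trajectories ?Y")
proof -
  note cont = trajectories_continuous(3)[OF X]
  have low: "z \<le> ?Y t z" if "0 \<le> t" for t z
  proof (rule relax_ge_const[OF rate_pos that cont])
    fix s assume "s \<in> {0..t}"
    then show "z \<le> drive X z s"
      using trajectories_bounds(1)[OF X, of s z] divide_nonneg_pos[OF speed_bounds(1)[of "X s" z] rate_pos]
      by (simp add: drive_def)
  qed simp
  have up: "?Y t z \<le> z + V * t" if "0 \<le> t" for t z
  proof (rule relax_le[OF rate_pos that cont, where y' = "\<lambda>_. V"])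
    fix s assume "s \<in> {0..t}"
    then show "drive X z s \<le> z + V * s + V / rate"
      using trajectories_bounds(2)[OF X, of s z] divide_right_mono[OF speed_bounds(2)[of "X s" z], of rate] rate_pos
      by (simp add: drive_def)
    show "((\<lambda>s. z + V * s) has_real_derivative V) (at s within {0..t})"
      by (auto intro!: derivative_eq_intros)
  qed simp
  have lip: "\<bar>?Y s z - ?Y t z\<bar> \<le> V * (1 + rate * T) * \<bar>s - t\<bar>" if "s \<in> {0..T}" "t \<in> {0..T}" for s t T z
  proof (rule deriv_within_bounded_imp_lipschitz[OF relax_has_derivative[OF cont] _ that])
    fix s assume s: "s \<in> {0..T}"
    have "\<bar>rate * (X s z - ?Y s z)\<bar> \<le> rate * (V * s)"
      unfolding abs_mult using rate_pos s low[of s z] up[of s z] trajectories_bounds[OF X, of s z]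
      by (intro mult_mono) (auto simp: abs_le_iff)
    also have "\<dots> \<le> rate * (V * T)"
      using rate_pos V_nonneg s by (intro mult_left_mono) auto
    finally have "\<bar>rate * (X s z - ?Y s z)\<bar> \<le> rate * (V * T)" .
    moreover have "rate * (drive X z s - ?Y s z) = rate * (X s z - ?Y s z) + speed (X s) z"
      using rate_pos by (simp add: drive_def field_simps)
    ultimately show "\<bar>rate * (drive X z s - ?Y s z)\<bar> \<le> V * (1 + rate * T)"
      using speed_bounds[of "X s" z] by (simp add: algebra_simps)
  qed
  have ord: "?Y t z1 \<le> ?Y t z2 \<and> measure m0 {z1<..z2} \<le> R * (?Y t z2 - ?Y t z1)"
    if "0 \<le> t" "z1 \<le> z2" for t z1 z2
  proof -
    let ?u = "\<lambda>s. drive X z2 s - drive X z1 s"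
    have u: "continuous_on {0..t} ?u" by (intro continuous_intros cont)
    have diff: "?Y t z2 - ?Y t z1 = relax rate ?u (z2 - z1) t" by (rule relax_diff[OF cont cont])
    have e1: "0 \<le> ?u s" and e2: "measure m0 {z1<..z2} \<le> R * ?u s" if "s \<in> {0..t}" for s
      using euler_step_admissible[OF trajectories_admissible[OF X] \<open>z1 \<le> z2\<close>, of s] that
      by (auto simp: drive_def)
    have "0 \<le> relax rate ?u (z2 - z1) t"
      using that e1 by (intro relax_ge_const rate_pos u) auto
    moreover have "measure m0 {z1<..z2} \<le> R * relax rate ?u (z2 - z1) t"
    \<comment> \<open>for \<open>R = 0\<close> the constraint does not involve the positions and cannot be divided by \<open>R\<close>\<close>
    proof (cases "R = 0")
      case True
      then show ?thesis using e2[of t] that by simp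
    next
      case False
      then have R: "0 < R" using R_nonneg by simp
      have "measure m0 {z1<..z2} / R \<le> relax rate ?u (z2 - z1) t"
      proof (intro relax_ge_const rate_pos u that)
        have "measure m0 {z1<..z2} \<le> measure m0 {z1..z2}" by (rule m0.finite_measure_mono) auto
        also have "\<dots> \<le> R * (z2 - z1)" using density_bounded_Icc[OF m0 that(2)] .
        finally show "measure m0 {z1<..z2} / R \<le> z2 - z1" using R by (simp add: field_simps)
      qed (use e2 R in \<open>simp add: field_simps\<close>)
      then show ?thesis using R by (simp add: field_simps)
    qed
    ultimately show ?thesis unfolding diff by (simp flip: diff)
  qed
  show ?thesis unfolding trajectories_def using low up lip ord by blast
qed

text \<open>The weight \<open>exp (\<kappa> t)\<close> in time makes the Picard map a contraction with factor one half.\<close>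

definition \<kappa> :: real where "\<kappa> = rate + 2 * C"

lemma \<kappa>_pos: "0 < \<kappa>" unfolding \<kappa>_def using rate_pos C_nonneg by simp

lemma relax_contraction:
  assumes X: "trajectories X" and Y: "trajectories Y"
    and close: "\<And>t z. 0 \<le> t \<Longrightarrow> \<bar>X t z - Y t z\<bar> \<le> A * exp (\<kappa> * t)" and "0 \<le> t"
  shows "\<bar>relax rate (drive X z) z t - relax rate (drive Y z) z t\<bar> \<le> A / 2 * exp (\<kappa> * t)"
proof -
  have half: "relax rate (drive X z) z t - relax rate (drive Y z) z t \<le> A / 2 * exp (\<kappa> * t)"
    if X: "trajectories X" and Y: "trajectories Y"
    and close: "\<And>t z. 0 \<le> t \<Longrightarrow> \<bar>X t z - Y t z\<bar> \<le> A * exp (\<kappa> * t)" for X Y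
  proof -
    note cX = trajectories_continuous(3)[OF X] and cY = trajectories_continuous(3)[OF Y]
    have "relax rate (\<lambda>s. drive X z s - drive Y z s) (z - z) t \<le> A / 2 * exp (\<kappa> * t)"
    proof (rule relax_le[OF rate_pos \<open>0 \<le> t\<close>, where y' = "\<lambda>s. A / 2 * (exp (\<kappa> * s) * \<kappa>)"])
      show "continuous_on {0..t} (\<lambda>s. drive X z s - drive Y z s)" by (intro continuous_intros cX cY)
      show "((\<lambda>s. A / 2 * exp (\<kappa> * s)) has_real_derivative A / 2 * (exp (\<kappa> * s) * \<kappa>)) (at s within {0..t})" for s
        by (auto intro!: derivative_eq_intros)
      show "z - z \<le> A / 2 * exp (\<kappa> * 0)" using order_trans[OF abs_ge_zero close[of 0 0]] by simp
      fix s assume "s \<in> {0..t}"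
      then have s: "0 \<le> s" by simp
      have "speed (X s) z - speed (Y s) z \<le> C * (A * exp (\<kappa> * s))"
        using speed_close[OF trajectories_admissible[OF X s] trajectories_admissible[OF Y s] close[OF s], of z]
        by linarith
      then have "(speed (X s) z - speed (Y s) z) / rate \<le> C * (A * exp (\<kappa> * s)) / rate"
        using rate_pos by (intro divide_right_mono) auto
      moreover have "X s z - Y s z \<le> A * exp (\<kappa> * s)" using close[OF s, of z] by linarith
      ultimately have "drive X z s - drive Y z s \<le> A * exp (\<kappa> * s) + C * (A * exp (\<kappa> * s)) / rate"
        unfolding drive_def by (simp add: diff_divide_distrib)
      also have "\<dots> = A / 2 * exp (\<kappa> * s) + A / 2 * (exp (\<kappa> * s) * \<kappa>) / rate"
        unfolding \<kappa>_def using rate_pos by (simp add: field_simps)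
      finally show "drive X z s - drive Y z s \<le> A / 2 * exp (\<kappa> * s) + A / 2 * (exp (\<kappa> * s) * \<kappa>) / rate" .
    qed
    then show ?thesis by (simp add: relax_diff[OF cX cY])
  qed
  have "\<bar>Y t z - X t z\<bar> \<le> A * exp (\<kappa> * t)" if "0 \<le> t" for t z
    using close[OF that] by (simp add: abs_minus_commute)
  then have "relax rate (drive Y z) z t - relax rate (drive X z) z t \<le> A / 2 * exp (\<kappa> * t)"
    by (rule half[OF Y X])
  moreover have "relax rate (drive X z) z t - relax rate (drive Y z) z t \<le> A / 2 * exp (\<kappa> * t)"
    by (rule half[OF X Y close])
  ultimately show ?thesis by linarith
qed

primrec picard :: "nat \<Rightarrow> real \<Rightarrow> real \<Rightarrow> real" where
  "picard 0 = (\<lambda>t z. z)"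
| "picard (Suc n) = (\<lambda>t z. relax rate (drive (picard n) z) z t)"

lemma picard_trajectories: "trajectories (picard n)"
proof (induction n)
  case 0
  have "measure m0 {z1<..z2} \<le> R * (z2 - z1)" if "z1 \<le> z2" for z1 z2
    using density_bounded_Icc[OF m0 that] m0.finite_measure_mono[of "{z1<..z2}" "{z1..z2}"] by force
  moreover have "0 \<le> V * (1 + rate * T) * \<bar>s - t\<bar>" if "s \<in> {0..T}" for s t T
    using that V_nonneg rate_pos by simp
  ultimately show ?case using V_nonneg by (auto simp: trajectories_def)
next
  case (Suc n)
  then show ?case using trajectories_relax by simp
qed

lemma picard_step:
  assumes "0 \<le> t"
  shows "\<bar>picard (Suc n) t z - picard n t z\<bar> \<le> V / \<kappa> * (1 / 2) ^ n * exp (\<kappa> * t)"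
  using assms
proof (induction n arbitrary: t z)
  case 0
  have "\<bar>picard (Suc 0) t z - picard 0 t z\<bar> \<le> V * t"
    using trajectories_bounds[OF picard_trajectories[of "Suc 0"] 0, of z] by (simp add: abs_le_iff)
  also have "\<dots> = V / \<kappa> * (\<kappa> * t)" using \<kappa>_pos by simp
  also have "\<dots> \<le> V / \<kappa> * exp (\<kappa> * t)"
  proof (intro mult_left_mono)
    show "\<kappa> * t \<le> exp (\<kappa> * t)" using exp_ge_add_one_self[of "\<kappa> * t"] by linarith
  qed (use V_nonneg \<kappa>_pos in simp)
  finally show ?case by simp
next
  case (Suc n)
  have "\<bar>picard (Suc (Suc n)) t z - picard (Suc n) t z\<bar> \<le> (V / \<kappa> * (1 / 2) ^ n) / 2 * exp (\<kappa> * t)"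
    using relax_contraction[OF picard_trajectories[of "Suc n"] picard_trajectories[of n] Suc.IH Suc.prems]
    by (simp only: picard.simps(2))
  then show ?case by simp
qed

lemma picard_cauchy:
  assumes "0 \<le> t"
  shows "\<bar>picard (n + m) t z - picard n t z\<bar> \<le> V / \<kappa> * exp (\<kappa> * t) * (2 * (1 / 2) ^ n - 2 * (1 / 2) ^ (n + m))"
proof (induction m)
  case (Suc m)
  have "\<bar>picard (n + Suc m) t z - picard n t z\<bar> \<le>
      \<bar>picard (Suc (n + m)) t z - picard (n + m) t z\<bar> + \<bar>picard (n + m) t z - picard n t z\<bar>" by simp
  also have "\<dots> \<le> V / \<kappa> * (1 / 2) ^ (n + m) * exp (\<kappa> * t) +
      V / \<kappa> * exp (\<kappa> * t) * (2 * (1 / 2) ^ n - 2 * (1 / 2) ^ (n + m))"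
    by (intro add_mono picard_step Suc assms)
  also have "\<dots> = V / \<kappa> * exp (\<kappa> * t) * (2 * (1 / 2) ^ n - 2 * (1 / 2) ^ (n + Suc m))"
    by (simp add: algebra_simps)
  finally show ?case .
qed simp

definition flow :: "real \<Rightarrow> real \<Rightarrow> real" where
  "flow t z = lim (\<lambda>n. picard n t z)"

lemma picard_tendsto:
  assumes "0 \<le> t"
  shows "(\<lambda>n. picard n t z) \<longlonglongrightarrow> flow t z"
proof -
  have "summable (\<lambda>n. picard (Suc n) t z - picard n t z)"
  proof (rule summable_comparison_test')
    show "summable (\<lambda>n. V / \<kappa> * (1 / 2) ^ n * exp (\<kappa> * t))"
      by (intro summable_mult summable_mult2 summable_geometric) simp
    show "norm (picard (Suc n) t z - picard n t z) \<le> V / \<kappa> * (1 / 2) ^ n * exp (\<kappa> * t)" for n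
      unfolding real_norm_def by (rule picard_step[OF assms])
  qed
  then have "convergent (\<lambda>n. \<Sum>i<n. picard (Suc i) t z - picard i t z)"
    by (simp only: summable_iff_convergent)
  then have "convergent (\<lambda>n. picard n t z - picard 0 t z)"
    by (simp only: sum_lessThan_telescope[of "\<lambda>n. picard n t z"])
  then have "convergent (\<lambda>n. (picard n t z - picard 0 t z) + picard 0 t z)"
    by (intro convergent_add convergent_const)
  then show ?thesis unfolding flow_def by (simp add: convergent_LIMSEQ_iff)
qed

text \<open>The distance to the limit is at most the sum of all later steps, a geometric series.\<close>

lemma flow_picard_close:
  assumes "0 \<le> t"
  shows "\<bar>flow t z - picard n t z\<bar> \<le> 2 * (V / \<kappa>) * (1 / 2) ^ n * exp (\<kappa> * t)"
proof (rule LIMSEQ_le_const2)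
  show "(\<lambda>m. \<bar>picard m t z - picard n t z\<bar>) \<longlonglongrightarrow> \<bar>flow t z - picard n t z\<bar>"
    by (intro tendsto_intros picard_tendsto assms)
  have "\<bar>picard m t z - picard n t z\<bar> \<le> 2 * (V / \<kappa>) * (1 / 2) ^ n * exp (\<kappa> * t)" if "n \<le> m" for m
  proof -
    have "\<bar>picard (n + (m - n)) t z - picard n t z\<bar> \<le>
        V / \<kappa> * exp (\<kappa> * t) * (2 * (1 / 2) ^ n - 2 * (1 / 2) ^ (n + (m - n)))"
      by (rule picard_cauchy[OF assms])
    also have "\<dots> \<le> V / \<kappa> * exp (\<kappa> * t) * (2 * (1 / 2) ^ n)"
      using V_nonneg \<kappa>_pos by (intro mult_left_mono) auto
    finally show ?thesis using that by (simp add: mult_ac)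
  qed
  then show "\<exists>N. \<forall>m\<ge>N. \<bar>picard m t z - picard n t z\<bar> \<le> 2 * (V / \<kappa>) * (1 / 2) ^ n * exp (\<kappa> * t)" by blast
qed

lemma flow_trajectories: "trajectories flow"
proof -
  note P = picard_trajectories[unfolded trajectories_def]
  show ?thesis
    unfolding trajectories_def
  proof (intro conjI allI impI ballI)
    fix t z1 z2 :: real assume "0 \<le> t" "z1 \<le> z2"
    then show "flow t z1 \<le> flow t z2"
      using P by (intro LIMSEQ_le[OF picard_tendsto picard_tendsto]) blast+
    have "(\<lambda>n. R * (picard n t z2 - picard n t z1)) \<longlonglongrightarrow> R * (flow t z2 - flow t z1)"
      by (intro tendsto_intros picard_tendsto \<open>0 \<le> t\<close>)
    then show "measure m0 {z1<..z2} \<le> R * (flow t z2 - flow t z1)"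
      using P \<open>0 \<le> t\<close> \<open>z1 \<le> z2\<close> by (intro LIMSEQ_le_const) blast+
  next
    fix t z :: real assume "0 \<le> t"
    then show "z \<le> flow t z" "flow t z \<le> z + V * t"
      using P by (blast intro: LIMSEQ_le_const[OF picard_tendsto] LIMSEQ_le_const2[OF picard_tendsto])+
  next
    fix T s t z :: real assume st: "s \<in> {0..T}" "t \<in> {0..T}"
    then have "(\<lambda>n. \<bar>picard n s z - picard n t z\<bar>) \<longlonglongrightarrow> \<bar>flow s z - flow t z\<bar>"
      by (intro tendsto_intros picard_tendsto) auto
    then show "\<bar>flow s z - flow t z\<bar> \<le> V * (1 + rate * T) * \<bar>s - t\<bar>"
      using P st by (intro LIMSEQ_le_const2) blast+
  qed
qed

lemma flow_fixed_point:
  assumes "0 \<le> t"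
  shows "flow t z = relax rate (drive flow z) z t"
proof (rule LIMSEQ_unique)
  show "(\<lambda>n. picard (Suc n) t z) \<longlonglongrightarrow> flow t z"
    using picard_tendsto[OF assms] by (rule LIMSEQ_Suc)
  have "(\<lambda>n. relax rate (drive flow z) z t - picard (Suc n) t z) \<longlonglongrightarrow> 0"
  proof (rule Lim_null_comparison)
    show "\<forall>\<^sub>F n in sequentially. norm (relax rate (drive flow z) z t - picard (Suc n) t z)
        \<le> 2 * (V / \<kappa>) * (1 / 2) ^ n / 2 * exp (\<kappa> * t)"
      unfolding real_norm_def picard.simps
      by (intro always_eventually allI relax_contraction flow_trajectories picard_trajectories
          flow_picard_close assms)
    have "(\<lambda>n. 2 * (V / \<kappa>) * (1 / 2) ^ n / 2 * exp (\<kappa> * t)) \<longlonglongrightarrow> 2 * (V / \<kappa>) * 0 / 2 * exp (\<kappa> * t)"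
      by (intro tendsto_intros LIMSEQ_power_zero) simp_all
    then show "(\<lambda>n. 2 * (V / \<kappa>) * (1 / 2) ^ n / 2 * exp (\<kappa> * t)) \<longlonglongrightarrow> 0" by simp
  qed
  then have "(\<lambda>n. relax rate (drive flow z) z t - (relax rate (drive flow z) z t - picard (Suc n) t z))
      \<longlonglongrightarrow> relax rate (drive flow z) z t - 0"
    by (intro tendsto_intros)
  then show "(\<lambda>n. picard (Suc n) t z) \<longlonglongrightarrow> relax rate (drive flow z) z t" by simp
qed

lemma flow_0 [simp]: "flow 0 z = z"
  using flow_fixed_point[of 0 z] by simp

lemma flow_admissible: "0 \<le> t \<Longrightarrow> admissible (flow t)"
  by (rule trajectories_admissible[OF flow_trajectories])

lemmas flow_bounds = trajectories_bounds[OF flow_trajectories]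

lemma flow_has_derivative:
  assumes "t \<in> {0..T}"
  shows "((\<lambda>s. flow s z) has_real_derivative speed (flow t) z) (at t within {0..T})"
proof -
  have "((\<lambda>s. flow s z) has_real_derivative rate * (drive flow z t - relax rate (drive flow z) z t))
      (at t within {0..T})"
    by (rule has_field_derivative_transform_within[of "relax rate (drive flow z) z" _ _ _ 1])
      (use assms relax_has_derivative[OF trajectories_continuous(3)[OF flow_trajectories] assms]
        flow_fixed_point in auto)
  moreover have "rate * (drive flow z t - relax rate (drive flow z) z t) = speed (flow t) z"
    using flow_fixed_point[of t z] assms rate_pos by (simp add: drive_def)
  ultimately show ?thesis by simp
qed

lemma flow_lipschitz_time:
  assumes "0 \<le> s" "0 \<le> t"
  shows "\<bar>flow s z - flow t z\<bar> \<le> V * \<bar>s - t\<bar>"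
  using assms speed_bounds
  by (intro deriv_within_bounded_imp_lipschitz[of "max s t", OF flow_has_derivative]) auto

text \<open>Gronwall's inequality for the distance of two particles, whose speeds differ by at most \<open>Lv * K\<close> times that
distance.\<close>

lemma flow_lipschitz_space:
  assumes "0 \<le> t"
  shows "\<bar>flow t z1 - flow t z2\<bar> \<le> exp (Lv * K * t) * \<bar>z1 - z2\<bar>"
proof -
  have le: "flow t z2 - flow t z1 \<le> exp (Lv * K * t) * (z2 - z1)" if "z1 \<le> z2" for z1 z2
  proof -
    let ?c = "Lv * K"
    let ?f = "\<lambda>s. - (exp (- ?c * s) * (flow s z2 - flow s z1))"
    have "?f 0 \<le> ?f t"
    proof (rule deriv_within_nonneg_imp_le[OF assms])
      fix s assume s: "s \<in> {0..t}"
      show "(?f has_real_derivative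
          exp (- ?c * s) * (?c * (flow s z2 - flow s z1) - (speed (flow s) z2 - speed (flow s) z1))) (at s within {0..t})"
        by (rule derivative_eq_intros flow_has_derivative[OF s] refl)+ (simp add: algebra_simps)
      have "\<bar>speed (flow s) z2 - speed (flow s) z1\<bar> \<le> ?c * \<bar>flow s z2 - flow s z1\<bar>"
        unfolding speed_def using s flow_admissible[of s]
        by (intro velocity_lipschitz push_density_bounded push_UNIV admissible_borel) auto
      moreover have "flow s z1 \<le> flow s z2" using admissible_mono[OF flow_admissible that] s by simp
      ultimately show "0 \<le> exp (- ?c * s) * (?c * (flow s z2 - flow s z1) - (speed (flow s) z2 - speed (flow s) z1))"
        by (intro mult_nonneg_nonneg) (simp, auto simp: abs_le_iff)
    qed
    then show ?thesis by (simp add: exp_minus field_simps)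
  qed
  show ?thesis
  proof (cases "z1 \<le> z2")
    case True
    then show ?thesis using le[OF True] admissible_mono[OF flow_admissible[OF assms] True] by simp
  next
    case False
    then show ?thesis using le[of z2 z1] admissible_mono[OF flow_admissible[OF assms], of z2 z1] by simp
  qed
qed

text \<open>Particles never stop covering the line: the label of a particle found at \<open>x\<close> lies in
\<open>[x - V t, x]\<close>.\<close>

lemma flow_surj:
  assumes "0 \<le> t"
  obtains z where "flow t z = x"
proof -
  have "continuous_on {x - V * t..x} (flow t)"
    using flow_lipschitz_space[OF assms] by (rule lipschitz_imp_continuous_on)
  moreover have "flow t (x - V * t) \<le> x" "x \<le> flow t x" using flow_bounds[OF assms] by (smt (verit))+
  moreover have "x - V * t \<le> x" using V_nonneg assms by simp
  ultimately obtain z where "flow t z = x" using IVT'[of "flow t" "x - V * t" x x] by blast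
  then show ?thesis by (rule that)
qed

end

section \<open>The flow carries a weak solution\<close>

lemma separately_lipschitz_imp_continuous_on:
  fixes f :: "real \<times> real \<Rightarrow> real"
  assumes t: "\<And>s t z. s \<in> S \<Longrightarrow> t \<in> S \<Longrightarrow> \<bar>f (s, z) - f (t, z)\<bar> \<le> A * \<bar>s - t\<bar>"
    and z: "\<And>t z z'. t \<in> S \<Longrightarrow> \<bar>f (t, z) - f (t, z')\<bar> \<le> B * \<bar>z - z'\<bar>"
    and "0 \<le> A" "0 \<le> B"
  shows "continuous_on (S \<times> UNIV) f"
proof (rule lipschitz_on_continuous_on)
  show "(A + B)-lipschitz_on (S \<times> UNIV) f"
  proof (rule lipschitz_onI)
    fix p q :: "real \<times> real" assume pq: "p \<in> S \<times> UNIV" "q \<in> S \<times> UNIV"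
    have "\<bar>f p - f q\<bar> \<le> \<bar>f (fst p, snd p) - f (fst q, snd p)\<bar> + \<bar>f (fst q, snd p) - f (fst q, snd q)\<bar>"
      by simp
    also have "\<dots> \<le> A * dist (fst p) (fst q) + B * dist (snd p) (snd q)"
      unfolding dist_real_def using pq by (intro add_mono t z) auto
    also have "\<dots> \<le> A * dist p q + B * dist p q"
      using assms(3,4) by (intro add_mono mult_left_mono dist_fst_le dist_snd_le)
    finally show "dist (f p) (f q) \<le> (A + B) * dist p q"
      by (simp add: dist_real_def algebra_simps)
  qed (use assms in simp)
qed

lemma compact_support_derivatives_bounded:
  fixes \<phi> :: "real \<times> real \<Rightarrow> real"
  assumes "compact_support \<phi>" and partials: "has_partials \<phi> \<phi>t \<phi>x"
  obtains B where "0 \<le> B" "\<And>p. \<bar>\<phi>t p\<bar> \<le> B" "\<And>p. \<bar>\<phi>x p\<bar> \<le> B"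
proof -
  obtain K where K: "compact K" and zero: "\<And>p. p \<notin> K \<Longrightarrow> \<phi> p = 0"
  proof
    show "compact (closure {p. \<phi> p \<noteq> 0})" using assms(1) by (simp add: compact_support_def)
    show "\<phi> p = 0" if "p \<notin> closure {p. \<phi> p \<noteq> 0}" for p
      using that closure_subset[of "{p. \<phi> p \<noteq> 0}"] by blast
  qed
  have op: "open (- K)" using compact_imp_closed[OF K] by (simp add: open_Compl)
  have zt: "\<phi>t (t, x) = 0" if tx: "(t, x) \<notin> K" for t x
  proof -
    have "open ((\<lambda>s. (s, x)) -` (- K))" by (intro open_vimage op continuous_intros)
    moreover have "t \<in> (\<lambda>s. (s, x)) -` (- K)" using tx by simp
    ultimately have "((\<lambda>s. 0) has_real_derivative \<phi>t (t, x)) (at t)"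
      by (rule has_field_derivative_transform_within_open[OF has_partialsD(3)[OF partials]]) (simp add: zero)
    from DERIV_unique[OF this DERIV_const] show ?thesis .
  qed
  have zx: "\<phi>x (t, x) = 0" if tx: "(t, x) \<notin> K" for t x
  proof -
    have "open ((\<lambda>y. (t, y)) -` (- K))" by (intro open_vimage op continuous_intros)
    moreover have "x \<in> (\<lambda>y. (t, y)) -` (- K)" using tx by simp
    ultimately have "((\<lambda>s. 0) has_real_derivative \<phi>x (t, x)) (at x)"
      by (rule has_field_derivative_transform_within_open[OF has_partialsD(4)[OF partials]]) (simp add: zero)
    from DERIV_unique[OF this DERIV_const] show ?thesis .
  qed
  have "bounded (\<phi>t ` K)" "bounded (\<phi>x ` K)"
    by (intro compact_imp_bounded compact_continuous_image K
        continuous_on_subset[OF has_partialsD(1)[OF partials]]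
        continuous_on_subset[OF has_partialsD(2)[OF partials]] subset_UNIV)+
  then obtain Bt Bx where b: "\<And>p. p \<in> K \<Longrightarrow> \<bar>\<phi>t p\<bar> \<le> Bt" "\<And>p. p \<in> K \<Longrightarrow> \<bar>\<phi>x p\<bar> \<le> Bx"
    unfolding bounded_iff by (metis imageI real_norm_def)
  have "\<bar>\<phi>t p\<bar> \<le> max 0 (max Bt Bx) \<and> \<bar>\<phi>x p\<bar> \<le> max 0 (max Bt Bx)" for p
  proof (cases "p \<in> K")
    case True
    then show ?thesis using b[of p] by (simp add: le_max_iff_disj)
  next
    case False
    then show ?thesis using zt[of "fst p" "snd p"] zx[of "fst p" "snd p"] by simp
  qed
  then show ?thesis using that[of "max 0 (max Bt Bx)"] by simp
qed

text \<open>The link between the data \<open>w\<close>, \<open>v\<close>, \<open>\<rho>\<^sub>0\<close> of the Cauchy problem and their extensions. The velocity law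
has to agree with \<open>v\<close> on the right half-line only, since downstream integrals are nonnegative.\<close>

locale traffic = nonlocal_flow +
  fixes w v \<rho>\<^sub>0 :: "real \<Rightarrow> real"
  assumes k_w: "\<And>u. u \<in> {0..\<eta>} \<Longrightarrow> k u = w u"
    and vel_v: "\<And>s. 0 \<le> s \<Longrightarrow> extend_velocity v s = vel s"
    and m0_eq: "m0 = density lborel (\<lambda>x. ennreal (\<rho>\<^sub>0 x))"
begin

lemma nonlocal_velocity_eq_velocity: "nonlocal_velocity \<eta> w v \<mu> x = velocity \<mu> x"
proof -
  have "indicator {x..x + \<eta>} y *\<^sub>R w (y - x) = k (y - x)" for y
    using k_w[of "y - x"] k_outside[of "y - x"] by (auto simp: indicator_def)
  then have "set_lebesgue_integral \<mu> {x..x + \<eta>} (\<lambda>y. w (y - x)) = downstream \<mu> x"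
    by (simp add: set_lebesgue_integral_def downstream_def)
  then show ?thesis
    unfolding nonlocal_velocity_def velocity_def by (simp add: vel_v downstream_nonneg)
qed

definition \<mu> :: "real \<Rightarrow> real measure" where "\<mu> t = push (flow t)"

lemma flow_borel [measurable]: "0 \<le> t \<Longrightarrow> flow t \<in> borel_measurable borel"
  by (rule admissible_borel[OF flow_admissible])

lemma \<mu>_density_bounded: "0 \<le> t \<Longrightarrow> density_bounded R (\<mu> t)"
  unfolding \<mu>_def by (rule push_density_bounded[OF flow_admissible])

lemma \<mu>_mass: "0 \<le> t \<Longrightarrow> measure (\<mu> t) UNIV = measure m0 UNIV"
  unfolding \<mu>_def by (rule push_UNIV) simp

lemma \<mu>_0: "\<mu> 0 = m0"
proof -
  have "distr m0 borel (flow 0) = distr m0 m0 (\<lambda>z. z)" by (intro distr_cong) auto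
  then show ?thesis by (simp add: \<mu>_def push_def distr_id2)
qed

text \<open>Following each particle from time \<open>s\<close> to time \<open>t\<close> is a coupling.\<close>

lemma W_infty_flow_le:
  assumes "0 \<le> s" "0 \<le> t"
  shows "W_infty (\<mu> t) (\<mu> s) \<le> ennreal (V * \<bar>t - s\<bar>)"
proof -
  let ?\<pi> = "distr m0 borel (\<lambda>z. (flow t z, flow s z))"
  have [measurable]: "flow t \<in> borel_measurable borel" "flow s \<in> borel_measurable borel" using assms by auto
  have m: "(\<lambda>z. (flow t z, flow s z)) \<in> m0 \<rightarrow>\<^sub>M borel" by (intro borel_measurable_Pair) auto
  have fs: "(fst :: real \<times> real \<Rightarrow> real) \<in> borel_measurable borel" "(snd :: real \<times> real \<Rightarrow> real) \<in> borel_measurable borel"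
    by (auto intro!: borel_measurable_continuous_onI continuous_intros)
  have "?\<pi> \<in> couplings (\<mu> t) (\<mu> s)"
    unfolding couplings_def \<mu>_def push_def by (simp add: distr_distr[OF fs(1) m] distr_distr[OF fs(2) m] o_def)
  moreover have "esssup ?\<pi> (\<lambda>(x, y). ennreal \<bar>x - y\<bar>) \<le> ennreal (V * \<bar>t - s\<bar>)"
  proof (rule esssup_I)
    have "(\<lambda>p :: real \<times> real. ennreal \<bar>fst p - snd p\<bar>) \<in> borel_measurable borel"
      by (intro measurable_compose[OF _ measurable_ennreal] borel_measurable_continuous_onI continuous_intros)
    then show meas: "(\<lambda>(x, y). ennreal \<bar>x - y\<bar>) \<in> borel_measurable ?\<pi>"
      by (simp add: case_prod_unfold)
    show "AE p in ?\<pi>. (case p of (x, y) \<Rightarrow> ennreal \<bar>x - y\<bar>) \<le> ennreal (V * \<bar>t - s\<bar>)"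
    proof (subst AE_distr_iff[OF m])
      show "{p \<in> space borel. (case p of (x, y) \<Rightarrow> ennreal \<bar>x - y\<bar>) \<le> ennreal (V * \<bar>t - s\<bar>)} \<in> sets borel"
        using meas by (intro borel_measurable_le) auto
      show "AE z in m0. (case (flow t z, flow s z) of (x, y) \<Rightarrow> ennreal \<bar>x - y\<bar>) \<le> ennreal (V * \<bar>t - s\<bar>)"
        using flow_lipschitz_time[OF assms(2,1)] by (auto intro!: AE_I2 ennreal_leI)
    qed
  qed
  ultimately show ?thesis unfolding W_infty_def by (rule INF_lower2)
qed

lemma \<mu>_W_infty_continuous: "W_infty_continuous_on {0..T} \<mu>"
  unfolding W_infty_continuous_on_def
proof
  fix s assume s: "s \<in> {0..T}"
  show "((\<lambda>t. W_infty (\<mu> t) (\<mu> s)) \<longlongrightarrow> 0) (at s within {0..T})"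
  proof (rule tendsto_sandwich[of "\<lambda>_. 0" _ _ "\<lambda>t. ennreal (V * \<bar>t - s\<bar>)"])
    have "((\<lambda>t. ennreal (V * \<bar>t - s\<bar>)) \<longlongrightarrow> ennreal (V * \<bar>s - s\<bar>)) (at s within {0..T})"
      by (intro tendsto_intros)
    then show "((\<lambda>t. ennreal (V * \<bar>t - s\<bar>)) \<longlongrightarrow> 0) (at s within {0..T})" by simp
    show "\<forall>\<^sub>F t in at s within {0..T}. W_infty (\<mu> t) (\<mu> s) \<le> ennreal (V * \<bar>t - s\<bar>)"
      unfolding eventually_at using s by (intro exI[of _ 1]) (auto intro: W_infty_flow_le)
  qed auto
qed

lemma speed_lipschitz_space:
  assumes "0 \<le> t"
  shows "\<bar>speed (flow t) z - speed (flow t) z'\<bar> \<le> Lv * K * \<bar>flow t z - flow t z'\<bar>"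
  unfolding speed_def using \<mu>_density_bounded[OF assms] \<mu>_mass[OF assms] unfolding \<mu>_def
  by (rule velocity_lipschitz)

lemma speed_lipschitz_time:
  assumes "0 \<le> s" "0 \<le> t"
  shows "\<bar>speed (flow s) z - speed (flow t) z\<bar> \<le> C * V * \<bar>s - t\<bar>"
  using speed_close[OF flow_admissible flow_admissible flow_lipschitz_time, OF assms assms]
  by (simp add: mult.assoc)

lemma flow_continuous_on: "continuous_on ({0..T} \<times> UNIV) (\<lambda>p. flow (fst p) (snd p))"
proof (rule separately_lipschitz_imp_continuous_on[where A = V and B = "exp (Lv * K * T)"])
  fix t z z' assume t: "t \<in> {0..T}"
  have "\<bar>flow t z - flow t z'\<bar> \<le> exp (Lv * K * t) * \<bar>z - z'\<bar>"
    using t by (intro flow_lipschitz_space) auto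
  also have "\<dots> \<le> exp (Lv * K * T) * \<bar>z - z'\<bar>"
    using t Lv_nonneg K_nonneg by (intro mult_right_mono) (auto intro!: mult_left_mono)
  finally show "\<bar>flow (fst (t, z)) (snd (t, z)) - flow (fst (t, z')) (snd (t, z'))\<bar> \<le> exp (Lv * K * T) * \<bar>z - z'\<bar>"
    by simp
qed (use flow_lipschitz_time V_nonneg in auto)

lemma speed_continuous_on: "continuous_on ({0..T} \<times> UNIV) (\<lambda>p. speed (flow (fst p)) (snd p))"
proof (rule separately_lipschitz_imp_continuous_on[where A = "C * V" and B = "Lv * K * exp (Lv * K * T)"])
  fix t z z' assume t: "t \<in> {0..T}"
  have "\<bar>speed (flow t) z - speed (flow t) z'\<bar> \<le> Lv * K * \<bar>flow t z - flow t z'\<bar>"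
    using t by (intro speed_lipschitz_space) auto
  also have "\<dots> \<le> Lv * K * (exp (Lv * K * t) * \<bar>z - z'\<bar>)"
    using t Lv_nonneg K_nonneg by (intro mult_left_mono flow_lipschitz_space) auto
  also have "\<dots> \<le> Lv * K * (exp (Lv * K * T) * \<bar>z - z'\<bar>)"
    using t Lv_nonneg K_nonneg by (intro mult_left_mono mult_right_mono) (auto intro!: mult_left_mono)
  finally show "\<bar>speed (flow (fst (t, z))) (snd (t, z)) - speed (flow (fst (t, z'))) (snd (t, z'))\<bar>
      \<le> Lv * K * exp (Lv * K * T) * \<bar>z - z'\<bar>"
    by (simp add: mult.assoc)
qed (use speed_lipschitz_time V_nonneg C_nonneg Lv_nonneg K_nonneg in auto)

text \<open>In Lagrangian variables the integrand is the time derivative of \<open>\<phi> (t, flow t z)\<close>. Exchanging the integrals,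
each particle contributes the difference of two boundary values, and both vanish.\<close>

lemma \<mu>_weak_equation:
  assumes "0 < T" and \<phi>: "\<phi> \<in> test_functions ({0<..<T} \<times> UNIV)"
  shows "set_lebesgue_integral lborel {0..T} (\<lambda>t. \<integral>x.
          (deriv (\<lambda>s. \<phi> (s, x)) t + deriv (\<lambda>y. \<phi> (t, y)) x * nonlocal_velocity \<eta> w v (\<mu> t) x)
          \<partial>(\<mu> t)) = 0"
proof -
  have sm: "smooth \<phi>" and cs: "compact_support \<phi>" and supp: "closure {x. \<phi> x \<noteq> 0} \<subseteq> {0<..<T} \<times> UNIV"
    using \<phi> by (auto simp: test_functions_def)
  obtain \<phi>t \<phi>x where partials: "has_partials \<phi> \<phi>t \<phi>x"
    and D: "\<And>t x. (\<phi> has_derivative (\<lambda>h. fst h * \<phi>t (t, x) + snd h * \<phi>x (t, x))) (at (t, x))"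
    using smooth_partial_derivatives[OF sm] by blast
  obtain B where B: "0 \<le> B" "\<And>p. \<bar>\<phi>t p\<bar> \<le> B" "\<And>p. \<bar>\<phi>x p\<bar> \<le> B"
    using compact_support_derivatives_bounded[OF cs partials] by blast
  note c = has_partialsD(1,2)[OF partials]
  define g where "g t z = \<phi>t (t, flow t z) + \<phi>x (t, flow t z) * speed (flow t) z" for t z
  have inner: "(\<integral>x. (deriv (\<lambda>s. \<phi> (s, x)) t + deriv (\<lambda>y. \<phi> (t, y)) x * nonlocal_velocity \<eta> w v (\<mu> t) x)
          \<partial>(\<mu> t)) = (\<integral>z. g t z \<partial>m0)" if t: "0 \<le> t" for t
  proof -
    have "continuous_on UNIV (velocity (\<mu> t))"
      by (rule lipschitz_imp_continuous_on) (rule velocity_lipschitz[OF \<mu>_density_bounded[OF t] \<mu>_mass[OF t]])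
    then have "continuous_on UNIV (\<lambda>x. \<phi>t (t, x) + \<phi>x (t, x) * velocity (\<mu> t) x)"
      by (intro continuous_intros continuous_on_compose2[OF c(1)] continuous_on_compose2[OF c(2)]) auto
    then have "(\<lambda>x. \<phi>t (t, x) + \<phi>x (t, x) * velocity (\<mu> t) x) \<in> borel_measurable borel"
      by (rule borel_measurable_continuous_onI)
    then have "(\<integral>x. (\<phi>t (t, x) + \<phi>x (t, x) * velocity (\<mu> t) x) \<partial>distr m0 borel (flow t)) = (\<integral>z. g t z \<partial>m0)"
      using t by (subst integral_distr) (auto simp: g_def[abs_def] speed_def \<mu>_def)
    then show ?thesis
      by (simp add: has_partialsD(3,4)[OF partials, THEN DERIV_imp_deriv] nonlocal_velocity_eq_velocity \<mu>_def push_def)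
  qed
  have cg: "continuous_on ({0..T} \<times> UNIV) (\<lambda>p. g (fst p) (snd p))"
    unfolding g_def
    by (intro continuous_intros continuous_on_compose2[OF c(1)] continuous_on_compose2[OF c(2)]
        flow_continuous_on speed_continuous_on) auto
  interpret P: pair_sigma_finite lborel m0 ..
  define h where "h t z = indicator {0..T} t *\<^sub>R g t z" for t z
  have "integrable (lborel \<Otimes>\<^sub>M m0) (case_prod h)"
  proof (rule Bochner_Integration.integrable_bound)
    show "integrable (lborel \<Otimes>\<^sub>M m0) (\<lambda>p. indicator ({0..T} \<times> UNIV) p * (B + B * V))"
      by (intro integrable_mult_left integrable_real_indicator)
        (auto simp: m0.emeasure_pair_measure_Times m0.emeasure_eq_measure ennreal_mult_less_top \<open>0 < T\<close> less_imp_le)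
    have "(\<lambda>p. indicator ({0..T} \<times> UNIV) p *\<^sub>R g (fst p) (snd p)) \<in> borel_measurable borel"
      by (intro borel_measurable_continuous_on_indicator cg borel_closed closed_Times) auto
    moreover have "indicator ({0..T} \<times> UNIV) p *\<^sub>R g (fst p) (snd p) = case_prod h p" for p
      by (cases p) (auto simp: h_def indicator_def)
    moreover have "sets (lborel \<Otimes>\<^sub>M m0) = sets (borel :: (real \<times> real) measure)"
      unfolding borel_prod[symmetric] by (intro sets_pair_measure_cong) auto
    ultimately show "case_prod h \<in> borel_measurable (lborel \<Otimes>\<^sub>M m0)"
      by (simp cong: measurable_cong_sets)
    have "\<bar>g t z\<bar> \<le> B + B * V" for t z
      unfolding g_def speed_def by (rule transport_rate_bound[OF B(2,3)])
    then show "AE p in lborel \<Otimes>\<^sub>M m0. norm (case_prod h p) \<le> norm (indicator ({0..T} \<times> UNIV) p * (B + B * V))"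
      by (intro AE_I2) (auto simp: h_def indicator_def intro: order_trans[OF _ abs_ge_self])
  qed
  note Fub = P.Fubini_integral[OF this]
  have FTC: "(\<integral>t. h t z \<partial>lborel) = 0" for z
  proof -
    have der: "((\<lambda>t. \<phi> (t, flow t z)) has_vector_derivative g t z) (at t within {0..T})" if t: "t \<in> {0..T}" for t
    proof -
      have "((\<lambda>t. (t, flow t z)) has_derivative (\<lambda>h. (h, speed (flow t) z * h))) (at t within {0..T})"
        using flow_has_derivative[OF t, of z]
        by (auto intro!: derivative_eq_intros simp: has_field_derivative_def)
      from has_derivative_compose[OF this D] show ?thesis
        by (simp add: has_vector_derivative_def g_def algebra_simps)
    qed
    have "continuous_on {0..T} (\<lambda>t. g (fst (t, z)) (snd (t, z)))"
      by (rule continuous_on_compose2[OF cg]) (auto intro!: continuous_intros)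
    then have "(\<integral>t. indicator {0..T} t *\<^sub>R g t z \<partial>lborel) = \<phi> (T, flow T z) - \<phi> (0, flow 0 z)"
      using \<open>0 < T\<close> by (intro integral_FTC_atLeastAtMost der) auto
    moreover have "\<phi> (T, flow T z) = 0" "\<phi> (0, flow 0 z) = 0"
      using supp closure_subset[of "{x. \<phi> x \<noteq> 0}"] by force+
    ultimately show ?thesis by (simp add: h_def)
  qed
  have "(\<integral>t. indicator {0..T} t *\<^sub>R (\<integral>x. (deriv (\<lambda>s. \<phi> (s, x)) t +
        deriv (\<lambda>y. \<phi> (t, y)) x * nonlocal_velocity \<eta> w v (\<mu> t) x) \<partial>(\<mu> t)) \<partial>lborel) =
      (\<integral>t. (\<integral>z. h t z \<partial>m0) \<partial>lborel)"
    by (intro Bochner_Integration.integral_cong refl) (auto simp: h_def indicator_def inner)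
  also have "\<dots> = 0" by (subst Fub[symmetric]) (simp add: FTC)
  finally show ?thesis by (simp add: set_lebesgue_integral_def)
qed

lemma \<mu>_weak_solution:
  assumes "0 < T"
  shows "weak_solution \<eta> w v \<rho>\<^sub>0 T \<mu>"
  unfolding weak_solution_def
proof (intro conjI ballI)
  show "\<mu> t \<in> finite_borel_measures" if "t \<in> {0..T}" for t
    using \<mu>_density_bounded[of t] that by (auto simp: finite_borel_measures_def density_bounded_def)
  show "\<mu> 0 = density lborel (\<lambda>x. ennreal (\<rho>\<^sub>0 x))" by (rule trans[OF \<mu>_0 m0_eq])
qed (rule \<mu>_W_infty_continuous, rule \<mu>_weak_equation[OF assms])

end

section \<open>Couplings at small distance\<close>

lemma W_infty_less_coupling:
  assumes "W_infty \<mu> \<nu> < ennreal e"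
  obtains \<pi> where "\<pi> \<in> couplings \<mu> \<nu>" "AE p in \<pi>. \<bar>fst p - snd p\<bar> \<le> e"
proof -
  obtain \<pi> where \<pi>: "\<pi> \<in> couplings \<mu> \<nu>" "esssup \<pi> (\<lambda>(x, y). ennreal \<bar>x - y\<bar>) < ennreal e"
    using assms unfolding W_infty_def INF_less_iff by blast
  have "AE p in \<pi>. (case p of (x, y) \<Rightarrow> ennreal \<bar>x - y\<bar>) \<le> esssup \<pi> (\<lambda>(x, y). ennreal \<bar>x - y\<bar>)"
    by (rule esssup_AE)
  then have "AE p in \<pi>. \<bar>fst p - snd p\<bar> \<le> e"
  proof eventually_elim
    case (elim p)
    then have "ennreal \<bar>fst p - snd p\<bar> < ennreal e" using \<pi>(2) by (auto simp: case_prod_unfold)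
    then show ?case by (simp add: ennreal_less_iff)
  qed
  with \<pi>(1) show ?thesis by (rule that)
qed

lemma coupling_emeasure:
  assumes "\<pi> \<in> couplings \<mu> \<nu>" "A \<in> sets borel"
  shows "emeasure \<mu> A = emeasure \<pi> {p. fst p \<in> A}" "emeasure \<nu> A = emeasure \<pi> {p. snd p \<in> A}"
    and "{p. fst p \<in> A} \<in> sets \<pi>" "{p. snd p \<in> A} \<in> sets \<pi>"
proof -
  have s: "sets \<pi> = sets borel" and d: "\<mu> = distr \<pi> borel fst" "\<nu> = distr \<pi> borel snd"
    using assms(1) by (auto simp: couplings_def)
  have sp: "space \<pi> = UNIV" using sets_eq_imp_space_eq[OF s] by simp
  have m: "fst \<in> \<pi> \<rightarrow>\<^sub>M borel" "snd \<in> \<pi> \<rightarrow>\<^sub>M borel"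
    by (auto simp: measurable_cong_sets[OF s refl] intro!: borel_measurable_continuous_onI continuous_intros)
  have v: "fst -` A \<inter> space \<pi> = {p. fst p \<in> A}" "snd -` A \<inter> space \<pi> = {p. snd p \<in> A}"
    using sp by auto
  show "emeasure \<mu> A = emeasure \<pi> {p. fst p \<in> A}" "emeasure \<nu> A = emeasure \<pi> {p. snd p \<in> A}"
    unfolding d using assms(2) by (simp_all add: emeasure_distr m v)
  show "{p. fst p \<in> A} \<in> sets \<pi>" "{p. snd p \<in> A} \<in> sets \<pi>"
    using measurable_sets[OF m(1) assms(2)] measurable_sets[OF m(2) assms(2)] unfolding v by auto
qed

lemma coupling_atMost_le:
  assumes \<pi>: "\<pi> \<in> couplings \<mu> \<nu>" and e: "AE p in \<pi>. \<bar>fst p - snd p\<bar> \<le> e"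
  shows "emeasure \<mu> {..x} \<le> emeasure \<nu> {..x + e}"
proof -
  have "emeasure \<pi> {p. fst p \<in> {..x}} \<le> emeasure \<pi> {p. snd p \<in> {..x + e}}"
  proof (rule emeasure_mono_AE)
    show "AE p in \<pi>. p \<in> {p. fst p \<in> {..x}} \<longrightarrow> p \<in> {p. snd p \<in> {..x + e}}"
      using e by eventually_elim auto
    show "{p. snd p \<in> {..x + e}} \<in> sets \<pi>" by (rule coupling_emeasure(4)[OF \<pi>]) simp
  qed
  then show ?thesis using coupling_emeasure(1,2)[OF \<pi>] by simp
qed

lemma coupling_integral_diff:
  fixes f g :: "real \<Rightarrow> real"
  assumes \<pi>: "\<pi> \<in> couplings \<mu> \<nu>" and e: "AE p in \<pi>. \<bar>fst p - snd p\<bar> \<le> e"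
    and fin: "finite_measure \<mu>"
    and f: "continuous_on UNIV f" "\<And>x. \<bar>f x\<bar> \<le> B" and g: "continuous_on UNIV g" "\<And>x. \<bar>g x\<bar> \<le> B"
    and d: "\<And>x y. \<bar>x - y\<bar> \<le> e \<Longrightarrow> \<bar>f x - g y\<bar> \<le> d"
  shows "\<bar>(\<integral>x. f x \<partial>\<mu>) - (\<integral>y. g y \<partial>\<nu>)\<bar> \<le> d * measure \<mu> UNIV"
proof -
  have s: "sets \<pi> = sets borel" and di: "\<mu> = distr \<pi> borel fst" "\<nu> = distr \<pi> borel snd"
    using \<pi> by (auto simp: couplings_def)
  have m: "fst \<in> \<pi> \<rightarrow>\<^sub>M borel" "snd \<in> \<pi> \<rightarrow>\<^sub>M borel"
    by (auto simp: measurable_cong_sets[OF s refl] intro!: borel_measurable_continuous_onI continuous_intros)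
  have sp: "space \<pi> = UNIV" using sets_eq_imp_space_eq[OF s] by simp
  have mass: "emeasure \<pi> UNIV = emeasure \<mu> UNIV" using coupling_emeasure(1)[OF \<pi>, of UNIV] by simp
  interpret \<mu>: finite_measure \<mu> by fact
  interpret finite_measure \<pi>
    by standard (simp add: sp mass \<mu>.emeasure_eq_measure)
  have fb: "f \<in> borel_measurable borel" "g \<in> borel_measurable borel"
    using f g by (auto intro: borel_measurable_continuous_onI)
  have i: "integrable \<pi> (\<lambda>p. f (fst p))" "integrable \<pi> (\<lambda>p. g (snd p))"
    using f(2) g(2) by (auto intro!: integrable_const_bound[of _ B] measurable_compose[OF m(1) fb(1)]
        measurable_compose[OF m(2) fb(2)])
  have "(\<integral>x. f x \<partial>\<mu>) - (\<integral>y. g y \<partial>\<nu>) = (\<integral>p. f (fst p) - g (snd p) \<partial>\<pi>)"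
    unfolding di using i by (simp add: integral_distr[OF m(1) fb(1)] integral_distr[OF m(2) fb(2)])
  moreover have "\<bar>\<integral>p. f (fst p) - g (snd p) \<partial>\<pi>\<bar> \<le> (\<integral>p. \<bar>f (fst p) - g (snd p)\<bar> \<partial>\<pi>)"
    by (rule integral_abs_bound)
  moreover have "(\<integral>p. \<bar>f (fst p) - g (snd p)\<bar> \<partial>\<pi>) \<le> (\<integral>p. d \<partial>\<pi>)"
  proof (rule integral_mono_AE)
    show "AE p in \<pi>. \<bar>f (fst p) - g (snd p)\<bar> \<le> d" using e by eventually_elim (rule d)
  qed (use i in auto)
  moreover have "(\<integral>p. d \<partial>\<pi>) = d * measure \<mu> UNIV"
    by (simp add: sp mass measure_def)
  ultimately show ?thesis by linarith
qed

section \<open>A weak solution as a kernel in time\<close>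

text \<open>From here on \<open>\<nu>\<close> is an arbitrary weak solution on \<open>[0, T]\<close>. No bound on its density is known.\<close>

locale weak_traffic = traffic +
  fixes T :: real and \<nu> :: "real \<Rightarrow> real measure"
  assumes T: "0 < T" and weak: "weak_solution \<eta> w v \<rho>\<^sub>0 T \<nu>"
begin

lemma \<nu>_sets: "t \<in> {0..T} \<Longrightarrow> sets (\<nu> t) = sets borel"
  and \<nu>_finite: "t \<in> {0..T} \<Longrightarrow> finite_measure (\<nu> t)"
  using weak by (auto simp: weak_solution_def finite_borel_measures_def)

lemma \<nu>_space: "t \<in> {0..T} \<Longrightarrow> space (\<nu> t) = UNIV"
  using sets_eq_imp_space_eq[OF \<nu>_sets] by simp

lemma \<nu>_0: "\<nu> 0 = m0"
  using weak by (simp add: weak_solution_def m0_eq)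

lemma \<nu>_couplings_eventually:
  assumes s: "s \<in> {0..T}" and e: "0 < e"
  shows "\<forall>\<^sub>F t in at s within {0..T}. \<exists>\<pi>\<in>couplings (\<nu> t) (\<nu> s). AE p in \<pi>. \<bar>fst p - snd p\<bar> \<le> e"
proof -
  have "((\<lambda>t. W_infty (\<nu> t) (\<nu> s)) \<longlongrightarrow> 0) (at s within {0..T})"
    using weak s by (auto simp: weak_solution_def W_infty_continuous_on_def)
  then have "\<forall>\<^sub>F t in at s within {0..T}. W_infty (\<nu> t) (\<nu> s) < ennreal e"
    using e by (intro order_tendstoD) auto
  then show ?thesis
    by eventually_elim (metis W_infty_less_coupling)
qed

text \<open>Measures at finite distance have the same mass, so the mass is locally constant on an interval.\<close>

lemma \<nu>_mass:
  assumes "t \<in> {0..T}"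
  shows "measure (\<nu> t) UNIV = measure m0 UNIV"
proof -
  have "measure (\<nu> t) UNIV = measure (\<nu> 0) UNIV"
  proof (rule connected_local_const[of "{0..T}" t 0 "\<lambda>t. measure (\<nu> t) UNIV"])
    show "\<forall>s\<in>{0..T}. \<forall>\<^sub>F t in at s within {0..T}. measure (\<nu> s) UNIV = measure (\<nu> t) UNIV"
    proof
      fix s assume "s \<in> {0..T}"
      from \<nu>_couplings_eventually[OF this zero_less_one]
      show "\<forall>\<^sub>F t in at s within {0..T}. measure (\<nu> s) UNIV = measure (\<nu> t) UNIV"
      proof eventually_elim
        case (elim t)
        then obtain \<pi> where \<pi>: "\<pi> \<in> couplings (\<nu> t) (\<nu> s)" by blast
        show ?case using coupling_emeasure(1,2)[OF \<pi>, of UNIV] by (simp add: measure_def)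
      qed
    qed
  qed (use assms T in auto)
  then show ?thesis by (simp add: \<nu>_0)
qed

text \<open>Outside \<open>[0, T]\<close> the values of \<open>\<nu>\<close> are arbitrary. Clamping the time removes them without
restricting the measurable space of times.\<close>

definition clamp_time :: "real \<Rightarrow> real" where "clamp_time t = max 0 (min T t)"

lemma clamp_time_in: "clamp_time t \<in> {0..T}"
  using T by (auto simp: clamp_time_def)

lemma clamp_time_id: "t \<in> {0..T} \<Longrightarrow> clamp_time t = t"
  by (auto simp: clamp_time_def)

lemma clamp_time_dist: "\<bar>clamp_time s - clamp_time t\<bar> \<le> \<bar>s - t\<bar>"
  by (auto simp: clamp_time_def max_def min_def)

text \<open>At a nearby time no particle has moved by more than \<open>e\<close>, so the mass of \<open>{..x}\<close> is at most the
present mass of \<open>{..x + e}\<close>, which is close to that of \<open>{..x}\<close>.\<close>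

lemma \<nu>_atMost_upper_semicontinuous:
  "open {t. measure (\<nu> (clamp_time t)) {..x} < c}"
  unfolding open_dist
proof
  fix s assume s: "s \<in> {t. measure (\<nu> (clamp_time t)) {..x} < c}"
  let ?s = "clamp_time s"
  interpret N: finite_measure "\<nu> ?s" by (rule \<nu>_finite[OF clamp_time_in])
  have fb: "finite_borel_measure (\<nu> ?s)"
    by standard (simp add: \<nu>_sets[OF clamp_time_in])
  have "\<forall>\<^sub>F y in at_right x. measure (\<nu> ?s) {..y} < c"
    using finite_borel_measure.cdf_is_right_cont[OF fb, of x] s
    by (intro order_tendstoD(2)[where y = "measure (\<nu> ?s) {..x}"])
      (auto simp: continuous_within cdf_def[abs_def])
  then obtain b where b: "x < b" "\<And>y. x < y \<Longrightarrow> y < b \<Longrightarrow> measure (\<nu> ?s) {..y} < c"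
    unfolding eventually_at_right_field by blast
  define e where "e = (b - x) / 2"
  have e: "0 < e" "measure (\<nu> ?s) {..x + e} < c" using b(1) b(2)[of "x + e"] by (auto simp: e_def field_simps)
  obtain d where d: "0 < d" "\<And>t. t \<in> {0..T} \<Longrightarrow> t \<noteq> ?s \<Longrightarrow> dist t ?s < d \<Longrightarrow>
      \<exists>\<pi>\<in>couplings (\<nu> t) (\<nu> ?s). AE p in \<pi>. \<bar>fst p - snd p\<bar> \<le> e"
    using \<nu>_couplings_eventually[OF clamp_time_in[of s] e(1)] unfolding eventually_at by blast
  show "\<exists>d>0. \<forall>t. dist t s < d \<longrightarrow> t \<in> {t. measure (\<nu> (clamp_time t)) {..x} < c}"
  proof (intro exI[of _ d] conjI allI impI d(1))
    fix t assume t: "dist t s < d"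
    show "t \<in> {t. measure (\<nu> (clamp_time t)) {..x} < c}"
    proof (cases "clamp_time t = ?s")
      case True
      then show ?thesis using s by simp
    next
      case False
      have "dist (clamp_time t) ?s < d"
        using t clamp_time_dist[of t s] by (simp add: dist_real_def)
      then obtain \<pi> where "\<pi> \<in> couplings (\<nu> (clamp_time t)) (\<nu> ?s)" "AE p in \<pi>. \<bar>fst p - snd p\<bar> \<le> e"
        using d(2)[OF clamp_time_in False] by blast
      then have "emeasure (\<nu> (clamp_time t)) {..x} \<le> emeasure (\<nu> ?s) {..x + e}"
        by (rule coupling_atMost_le)
      then have "measure (\<nu> (clamp_time t)) {..x} \<le> measure (\<nu> ?s) {..x + e}"
        unfolding measure_def by (rule enn2real_mono) (simp add: N.emeasure_eq_measure)
      then show ?thesis using e(2) by simp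
    qed
  qed
qed

text \<open>Scaling by a constant yields measures of mass at most one, to which the theory of sub-probability kernels applies.
The summand \<open>1\<close> avoids division by zero for the zero solution.\<close>

definition normalized :: "real \<Rightarrow> real measure" where
  "normalized t = density (\<nu> (clamp_time t)) (\<lambda>_. ennreal (1 / (measure m0 UNIV + 1)))"

lemma nn_integral_normalized:
  assumes "f \<in> borel_measurable borel"
  shows "(\<integral>\<^sup>+x. f x \<partial>normalized t) = ennreal (1 / (measure m0 UNIV + 1)) * (\<integral>\<^sup>+x. f x \<partial>\<nu> (clamp_time t))"
  using assms measurable_cong_sets[OF \<nu>_sets[OF clamp_time_in[of t]] refl]
  unfolding normalized_def by (subst nn_integral_density) (auto simp: nn_integral_cmult)

lemma normalized_emeasure:
  assumes "A \<in> sets borel"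
  shows "emeasure (normalized t) A = ennreal (1 / (measure m0 UNIV + 1) * measure (\<nu> (clamp_time t)) A)"
proof -
  interpret N: finite_measure "\<nu> (clamp_time t)" by (rule \<nu>_finite[OF clamp_time_in])
  have "emeasure (normalized t) A = ennreal (1 / (measure m0 UNIV + 1)) * emeasure (\<nu> (clamp_time t)) A"
    using assms \<nu>_sets[OF clamp_time_in[of t]] unfolding normalized_def
    by (subst emeasure_density) (auto simp: nn_integral_cmult_indicator)
  then show ?thesis
    by (simp only: N.emeasure_eq_measure) (rule ennreal_mult[symmetric], simp_all)
qed

lemma normalized_kernel: "normalized \<in> borel \<rightarrow>\<^sub>M subprob_algebra borel"
proof (rule measurable_subprob_algebra_generated[where \<Omega> = UNIV and G = "range (\<lambda>x. {..x})"])
  show "sets borel = sigma_sets UNIV (range (\<lambda>x::real. {..x}))"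
    unfolding borel_eq_atMost by simp
  show "Int_stable (range (\<lambda>x::real. {..x}))"
    by (auto simp: Int_stable_def Int_atMost)
  have sets: "sets (normalized t) = sets borel" for t
    using \<nu>_sets[OF clamp_time_in[of t]] by (simp add: normalized_def)
  then show "sets (normalized t) = sets borel" for t .
  have sp: "space (normalized t) = UNIV" for t using sets_eq_imp_space_eq[OF sets] by simp
  show "subprob_space (normalized t)" for t
  proof
    show "emeasure (normalized t) (space (normalized t)) \<le> 1"
      unfolding sp by (subst normalized_emeasure) (auto simp: \<nu>_mass[OF clamp_time_in] divide_simps add_nonneg_pos)
    show "space (normalized t) \<noteq> {}" by (simp add: sp)
  qed
  have "(\<lambda>t. measure (\<nu> (clamp_time t)) {..x}) \<in> borel_measurable borel" for x
    using \<nu>_atMost_upper_semicontinuous by (intro borel_measurableI_less) auto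
  then show "(\<lambda>t. emeasure (normalized t) A) \<in> borel_measurable borel" if "A \<in> range (\<lambda>x. {..x})" for A
    using that by (auto simp: normalized_emeasure)
  show "(\<lambda>t. emeasure (normalized t) UNIV) \<in> borel_measurable borel"
    by (simp add: normalized_emeasure \<nu>_mass[OF clamp_time_in])
qed auto

text \<open>The time is given as a function \<open>\<tau>\<close> of a general parameter so that the lemma covers both the velocity,
as a function of time and position, and integrals of the velocity, as functions of time.\<close>

lemma \<nu>_integral_measurable:
  fixes f :: "'b \<Rightarrow> real \<Rightarrow> real"
  assumes \<tau>: "\<tau> \<in> N \<rightarrow>\<^sub>M borel" and f: "(\<lambda>(a, x). f a x) \<in> borel_measurable (N \<Otimes>\<^sub>M borel)"
    and B: "\<And>a x. \<bar>f a x\<bar> \<le> B"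
  shows "(\<lambda>a. \<integral>x. f a x \<partial>\<nu> (clamp_time (\<tau> a))) \<in> borel_measurable N"
proof -
  let ?c = "1 / (measure m0 UNIV + 1)"
  have c: "0 < ?c" by (simp add: add_nonneg_pos)
  have \<kappa>: "(\<lambda>a. normalized (\<tau> a)) \<in> N \<rightarrow>\<^sub>M subprob_algebra borel"
    using \<tau> normalized_kernel by (rule measurable_compose)
  have meas: "(\<lambda>a. \<integral>\<^sup>+x. ennreal (g a x) \<partial>\<nu> (clamp_time (\<tau> a))) \<in> borel_measurable N"
    if g: "(\<lambda>(a, x). g a x) \<in> borel_measurable (N \<Otimes>\<^sub>M borel)" for g :: "'b \<Rightarrow> real \<Rightarrow> real"
  proof -
    have "(\<lambda>(a, x). ennreal (g a x)) \<in> borel_measurable (N \<Otimes>\<^sub>M borel)"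
      using g by (simp add: case_prod_unfold)
    then have "(\<lambda>a. \<integral>\<^sup>+x. ennreal (g a x) \<partial>normalized (\<tau> a)) \<in> borel_measurable N"
      by (rule nn_integral_measurable_subprob_algebra2[OF _ \<kappa>])
    then have m: "(\<lambda>a. ennreal (1 / ?c) * (\<integral>\<^sup>+x. ennreal (g a x) \<partial>normalized (\<tau> a))) \<in> borel_measurable N"
      by (rule borel_measurable_times_ennreal[OF borel_measurable_const])
    show ?thesis
    proof (rule measurable_cong[THEN iffD1, OF _ m])
      fix a assume "a \<in> space N"
      then have ga: "g a \<in> borel_measurable borel"
        using measurable_Pair2[OF g, of a] by simp
      have "ennreal (1 / ?c) * ennreal ?c = ennreal (1 / ?c * ?c)"
        by (rule ennreal_mult[symmetric]) simp_all
      also have "1 / ?c * ?c = 1" using c by simp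
      finally have "ennreal (1 / ?c) * (ennreal ?c * X) = X" for X
        by (simp only: mult.assoc[symmetric] ennreal_1 mult_1_left)
      then show "ennreal (1 / ?c) * (\<integral>\<^sup>+x. ennreal (g a x) \<partial>normalized (\<tau> a)) =
          (\<integral>\<^sup>+x. ennreal (g a x) \<partial>\<nu> (clamp_time (\<tau> a)))"
        using ga by (subst nn_integral_normalized) auto
    qed
  qed
  have f': "(\<lambda>(a, x). - f a x) \<in> borel_measurable (N \<Otimes>\<^sub>M borel)"
    using f by (simp add: case_prod_unfold)
  have m: "(\<lambda>a. enn2real (\<integral>\<^sup>+x. ennreal (f a x) \<partial>\<nu> (clamp_time (\<tau> a))) -
      enn2real (\<integral>\<^sup>+x. ennreal (- f a x) \<partial>\<nu> (clamp_time (\<tau> a)))) \<in> borel_measurable N"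
    by (intro borel_measurable_diff borel_measurable_enn2real meas f f')
  show ?thesis
  proof (rule measurable_cong[THEN iffD1, OF _ m])
    fix a assume "a \<in> space N"
    then have fa: "f a \<in> borel_measurable borel"
      using measurable_Pair2[OF f, of a] by simp
    interpret F: finite_measure "\<nu> (clamp_time (\<tau> a))" by (rule \<nu>_finite[OF clamp_time_in])
    have "integrable (\<nu> (clamp_time (\<tau> a))) (f a)"
      using fa B measurable_cong_sets[OF \<nu>_sets[OF clamp_time_in[of "\<tau> a"]] refl]
      by (intro F.integrable_const_bound[of _ B]) auto
    then show "enn2real (\<integral>\<^sup>+x. ennreal (f a x) \<partial>\<nu> (clamp_time (\<tau> a))) -
      enn2real (\<integral>\<^sup>+x. ennreal (- f a x) \<partial>\<nu> (clamp_time (\<tau> a))) = (\<integral>x. f a x \<partial>\<nu> (clamp_time (\<tau> a)))"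
      by (rule real_lebesgue_integral_def[symmetric])
  qed
qed

lemma vel_borel [measurable]: "vel \<in> borel_measurable borel"
  by (rule borel_measurable_continuous_onI) (rule lipschitz_imp_continuous_on[OF vel_lipschitz])

lemma \<nu>_velocity_measurable:
  "(\<lambda>(t, x). velocity (\<nu> (clamp_time t)) x) \<in> borel_measurable (borel \<Otimes>\<^sub>M borel)"
proof -
  have "(\<lambda>p. \<integral>y. k (y - snd p) \<partial>\<nu> (clamp_time (fst p))) \<in> borel_measurable (borel \<Otimes>\<^sub>M borel)"
    by (rule \<nu>_integral_measurable[where B = "k 0"]) (use k_le k_nonneg in auto)
  then have "(\<lambda>p. vel (\<integral>y. k (y - snd p) \<partial>\<nu> (clamp_time (fst p)))) \<in> borel_measurable (borel \<Otimes>\<^sub>M borel)"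
    by (rule measurable_compose[OF _ vel_borel])
  then show ?thesis by (simp add: velocity_def downstream_def case_prod_unfold)
qed

lemma \<nu>_velocity_borel:
  assumes "t \<in> {0..T}"
  shows "velocity (\<nu> t) \<in> borel_measurable borel"
  using measurable_Pair2[OF \<nu>_velocity_measurable, of t] by (simp add: clamp_time_id[OF assms])

end

section \<open>Integrals that a weak solution increases\<close>

context weak_traffic
begin

lemma \<nu>_integral_test_continuous:
  fixes \<phi> :: "real \<times> real \<Rightarrow> real"
  assumes \<phi>: "continuous_on UNIV \<phi>" and supp: "\<And>t x. t \<in> {0..T} \<Longrightarrow> \<phi> (t, x) \<noteq> 0 \<Longrightarrow> \<bar>x\<bar> \<le> N"
  shows "continuous_on {0..T} (\<lambda>t. \<integral>x. \<phi> (t, x) \<partial>\<nu> t)"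
proof -
  let ?M = "measure m0 UNIV"
  let ?Q = "{0..T} \<times> {- N - 1..N + 1}"
  have Q: "compact ?Q" by (intro compact_Times compact_Icc)
  have "bounded (\<phi> ` ?Q)"
    by (intro compact_imp_bounded compact_continuous_image Q continuous_on_subset[OF \<phi>]) auto
  then obtain B where B: "\<And>p. p \<in> ?Q \<Longrightarrow> \<bar>\<phi> p\<bar> \<le> B" unfolding bounded_iff by auto
  have B': "\<bar>\<phi> (t, x)\<bar> \<le> max B 0" if "t \<in> {0..T}" for t x
  proof (cases "\<phi> (t, x) = 0")
    case False
    then have "(t, x) \<in> ?Q" using supp[OF that False] that by (auto simp: abs_le_iff)
    then show ?thesis using B[of "(t, x)"] by (simp add: le_max_iff_disj)
  qed simp
  have cx: "continuous_on UNIV (\<lambda>x. \<phi> (t, x))" for t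
    by (rule continuous_on_compose2[OF \<phi>]) (auto intro!: continuous_intros)
  show ?thesis
    unfolding continuous_on_def
  proof
    fix s assume s: "s \<in> {0..T}"
    show "((\<lambda>t. \<integral>x. \<phi> (t, x) \<partial>\<nu> t) \<longlongrightarrow> (\<integral>x. \<phi> (s, x) \<partial>\<nu> s)) (at s within {0..T})"
    proof (rule tendstoI)
      fix e :: real assume "0 < e"
      define e' where "e' = e / (?M + 1)"
      have "?M + 1 > 0" by (simp add: add_nonneg_pos)
      then have e': "0 < e'" "e' * ?M < e" using \<open>0 < e\<close> by (auto simp: e'_def field_simps)
      obtain d where d: "0 < d" "\<And>p q. p \<in> ?Q \<Longrightarrow> q \<in> ?Q \<Longrightarrow> dist q p < d \<Longrightarrow> dist (\<phi> q) (\<phi> p) < e'"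
      proof -
        have "uniformly_continuous_on ?Q \<phi>"
          by (rule compact_uniformly_continuous[OF continuous_on_subset[OF \<phi>] Q]) simp
        then show ?thesis
          using that uniformly_continuous_onE[of ?Q \<phi> e'] e'(1) by metis
      qed
      define r where "r = min 1 (d / 3)"
      have r: "0 < r" "r \<le> 1" "r \<le> d / 3" using d(1) by (auto simp: r_def)
      have near: "\<bar>\<phi> (t, x) - \<phi> (s, y)\<bar> \<le> e'" if t: "t \<in> {0..T}" "\<bar>t - s\<bar> < r" and xy: "\<bar>x - y\<bar> \<le> r" for t x y
      proof (cases "\<phi> (t, x) = 0 \<and> \<phi> (s, y) = 0")
        case False
        then have "\<bar>x\<bar> \<le> N \<or> \<bar>y\<bar> \<le> N" using supp s t by blast
        then have "(t, x) \<in> ?Q" "(s, y) \<in> ?Q" using xy r s t by auto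
        moreover have "dist (t, x) (s, y) \<le> \<bar>t - s\<bar> + \<bar>x - y\<bar>"
          unfolding dist_prod_def dist_real_def by (simp add: sqrt_sum_squares_le_sum_abs[THEN order_trans])
        then have "dist (t, x) (s, y) < d" using t xy r d(1) by linarith
        ultimately show ?thesis using d(2)[of "(s, y)" "(t, x)"] by (simp add: dist_real_def)
      qed (use e' in simp)
      have "\<forall>\<^sub>F t in at s within {0..T}. \<bar>t - s\<bar> < r \<and> t \<in> {0..T}"
        unfolding eventually_at using r(1) by (intro exI[of _ r]) (auto simp: dist_real_def)
      with \<nu>_couplings_eventually[OF s r(1)]
      show "\<forall>\<^sub>F t in at s within {0..T}. dist (\<integral>x. \<phi> (t, x) \<partial>\<nu> t) (\<integral>x. \<phi> (s, x) \<partial>\<nu> s) < e"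
      proof eventually_elim
        case (elim t)
        then obtain \<pi> where \<pi>: "\<pi> \<in> couplings (\<nu> t) (\<nu> s)" "AE p in \<pi>. \<bar>fst p - snd p\<bar> \<le> r" by blast
        have "\<bar>(\<integral>x. \<phi> (t, x) \<partial>\<nu> t) - (\<integral>x. \<phi> (s, x) \<partial>\<nu> s)\<bar> \<le> e' * measure (\<nu> t) UNIV"
          using elim B' s by (intro coupling_integral_diff[OF \<pi>] \<nu>_finite cx near) auto
        then show ?case using e'(2) elim by (simp add: \<nu>_mass dist_real_def)
      qed
    qed
  qed
qed

lemma \<nu>_test_equation:
  assumes "smooth \<Phi>" "compact_support \<Phi>" "closure {p. \<Phi> p \<noteq> 0} \<subseteq> {0<..<T} \<times> UNIV"
    and partials: "has_partials \<Phi> \<Phi>t \<Phi>x"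
  shows "(\<integral>t. indicator {0..T} t * (\<integral>x. \<Phi>t (t, x) + \<Phi>x (t, x) * velocity (\<nu> t) x \<partial>\<nu> t) \<partial>lborel) = 0"
proof -
  have "\<Phi> \<in> test_functions ({0<..<T} \<times> UNIV)" using assms by (simp add: test_functions_def)
  then have "set_lebesgue_integral lborel {0..T} (\<lambda>t. \<integral>x.
          (deriv (\<lambda>s. \<Phi> (s, x)) t + deriv (\<lambda>y. \<Phi> (t, y)) x * nonlocal_velocity \<eta> w v (\<nu> t) x)
          \<partial>(\<nu> t)) = 0"
    using weak by (auto simp: weak_solution_def)
  then show ?thesis
    by (simp add: has_partialsD(3,4)[OF partials, THEN DERIV_imp_deriv] nonlocal_velocity_eq_velocity
        set_lebesgue_integral_def)
qed

text \<open>The weak equation says that an integral over time vanishes; it carries information only because the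
integrand is integrable.\<close>

lemma \<nu>_test_rate_integrable:
  assumes partials: "has_partials \<Phi> \<Phi>t \<Phi>x" and B: "\<And>p. \<bar>\<Phi>t p\<bar> \<le> B" "\<And>p. \<bar>\<Phi>x p\<bar> \<le> B"
  shows "integrable lborel (\<lambda>t. indicator {0..T} t * (\<integral>x. \<Phi>t (t, x) + \<Phi>x (t, x) * velocity (\<nu> t) x \<partial>\<nu> t))"
proof -
  note c = has_partialsD(1,2)[OF partials]
  let ?q = "\<lambda>t x. \<Phi>t (clamp_time t, x) + \<Phi>x (clamp_time t, x) * velocity (\<nu> (clamp_time t)) x"
  have bound: "\<bar>?q t x\<bar> \<le> B + B * V" for t x
    by (rule transport_rate_bound[OF B])
  have "continuous_on UNIV clamp_time" unfolding clamp_time_def by (intro continuous_intros)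
  then have "continuous_on UNIV (\<lambda>p. clamp_time (fst p))" by (rule continuous_on_compose2) (auto intro!: continuous_intros)
  then have c': "continuous_on UNIV (\<lambda>p. (clamp_time (fst p), snd p))" by (intro continuous_intros)
  have "(\<lambda>p. \<Phi>t (clamp_time (fst p), snd p)) \<in> borel_measurable (borel \<Otimes>\<^sub>M borel)"
       "(\<lambda>p. \<Phi>x (clamp_time (fst p), snd p)) \<in> borel_measurable (borel \<Otimes>\<^sub>M borel)"
    unfolding borel_prod using c
    by (auto intro!: borel_measurable_continuous_onI continuous_on_compose2[OF _ c'])
  then have mq: "(\<lambda>(t, x). ?q t x) \<in> borel_measurable (borel \<Otimes>\<^sub>M borel)"
    using \<nu>_velocity_measurable unfolding case_prod_unfold by (intro borel_measurable_add borel_measurable_times)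
  from mq have "(\<lambda>t. \<integral>x. ?q t x \<partial>\<nu> (clamp_time t)) \<in> borel_measurable borel"
    by (rule \<nu>_integral_measurable[of "\<lambda>t. t" borel ?q, OF measurable_ident_sets[OF refl] _ bound])
  then have "(\<lambda>t. indicator {0..T} t * (\<integral>x. ?q t x \<partial>\<nu> (clamp_time t))) \<in> borel_measurable borel"
    by measurable
  moreover have "indicator {0..T} t * (\<integral>x. ?q t x \<partial>\<nu> (clamp_time t)) =
      indicator {0..T} t * (\<integral>x. \<Phi>t (t, x) + \<Phi>x (t, x) * velocity (\<nu> t) x \<partial>\<nu> t)" for t
    by (cases "t \<in> {0..T}") (auto simp: clamp_time_id)
  ultimately have meas: "(\<lambda>t. indicator {0..T} t * (\<integral>x. \<Phi>t (t, x) + \<Phi>x (t, x) * velocity (\<nu> t) x \<partial>\<nu> t)) \<in> borel_measurable borel"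
    by simp
  have "\<bar>\<integral>x. \<Phi>t (t, x) + \<Phi>x (t, x) * velocity (\<nu> t) x \<partial>\<nu> t\<bar> \<le> (B + B * V) * measure m0 UNIV" if t: "t \<in> {0..T}" for t
  proof -
    interpret N: finite_measure "\<nu> t" by (rule \<nu>_finite[OF t])
    have "\<bar>\<integral>x. ?q t x \<partial>\<nu> t\<bar> \<le> (\<integral>x. B + B * V \<partial>\<nu> t)"
    proof (rule integral_abs_bound[THEN order_trans], rule integral_mono_AE)
      have "(\<lambda>x. ?q t x) \<in> borel_measurable borel"
        using measurable_Pair2[OF mq, of t] by simp
      then have "(\<lambda>x. ?q t x) \<in> borel_measurable (\<nu> t)"
        using measurable_cong_sets[OF \<nu>_sets[OF t] refl] by auto
      then show "integrable (\<nu> t) (\<lambda>x. \<bar>?q t x\<bar>)"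
        using bound by (intro integrable_abs N.integrable_const_bound[of _ "B + B * V"]) auto
    qed (use bound in auto)
    then show ?thesis by (simp add: clamp_time_id[OF t] \<nu>_space[OF t] \<nu>_mass[OF t] mult.commute)
  qed
  then have le: "norm (indicator {0..T} t * (\<integral>x. \<Phi>t (t, x) + \<Phi>x (t, x) * velocity (\<nu> t) x \<partial>\<nu> t))
      \<le> norm (indicator {0..T} t * ((B + B * V) * measure m0 UNIV))" for t
    by (cases "t \<in> {0..T}") (simp_all add: order_trans[OF _ abs_ge_self])
  show ?thesis
  proof (rule Bochner_Integration.integrable_bound)
    show "integrable lborel (\<lambda>t. indicator {0..T} t * ((B + B * V) * measure m0 UNIV))"
      using T by (intro integrable_mult_left integrable_real_indicator) auto
  qed (use meas le in auto)
qed

end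

lemma continuous_antiderivative_exists:
  fixes f :: "real \<Rightarrow> real"
  assumes "continuous_on UNIV f"
  obtains F where "\<And>x. (F has_real_derivative f x) (at x)"
proof -
  have "\<exists>F. \<forall>x :: real. - \<infinity> < ereal x \<longrightarrow> ereal x < \<infinity> \<longrightarrow> (F has_vector_derivative f x) (at x)"
    using assms by (intro einterval_antiderivative) (auto simp: continuous_on_eq_continuous_at)
  then show ?thesis using that by (auto simp: has_real_derivative_iff_has_vector_derivative)
qed

lemma smooth_scaled_shift:
  fixes f :: "real \<Rightarrow> real"
  assumes "smooth f"
  shows "smooth (\<lambda>s. f (a * s + b))"
  using smooth_comp[OF assms, of "\<lambda>s. a * s + b"] smooth_add[OF smooth_mult[OF smooth_const smooth_linear[OF bounded_linear_ident]] smooth_const]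
  by simp

text \<open>A smooth time cutoff whose derivative is a positive bump on \<open>[a, a + h]\<close> followed by the same bump, negated,
on \<open>[b, b + h]\<close>.\<close>

lemma smooth_time_window:
  fixes a b h :: real
  assumes "0 < h" "a \<le> b"
  obtains \<alpha> \<alpha>' where "smooth \<alpha>" "\<And>t. (\<alpha> has_real_derivative \<alpha>' t) (at t)" "continuous_on UNIV \<alpha>'"
    "\<And>t. 0 \<le> \<alpha> t" "\<And>t. \<alpha> t \<noteq> 0 \<Longrightarrow> a \<le> t \<and> t \<le> b + h"
    "\<And>t. 0 < \<alpha>' t \<Longrightarrow> a < t \<and> t < a + h" "\<And>t. \<alpha>' t < 0 \<Longrightarrow> b < t \<and> t < b + h"
    "a + h \<le> b \<Longrightarrow> 0 < \<alpha>' (a + h / 2)"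
proof -
  define \<beta> where "\<beta> s = ramp s * ramp (- 1 * s + h)" for s
  have sb: "smooth \<beta>"
    unfolding \<beta>_def by (rule smooth_mult[OF smooth_ramp smooth_scaled_shift[OF smooth_ramp]])
  have b0: "0 \<le> \<beta> s" for s by (simp add: \<beta>_def ramp_bounds)
  have bpos: "\<beta> s \<noteq> 0 \<longleftrightarrow> 0 < s \<and> s < h" for s by (auto simp: \<beta>_def ramp_bounds(3))
  obtain G where G: "\<And>s. (G has_real_derivative \<beta> s) (at s)"
    using continuous_antiderivative_exists[OF smooth_continuous[OF sb]] by blast
  have sG: "smooth G" by (rule smooth_antiderivative[OF sb G])
  have Gmono: "G s \<le> G t" if "s \<le> t" for s t
    by (rule DERIV_nonneg_imp_nondecreasing[OF that]) (use G b0 in blast)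
  have G0: "G s = G 0" if "s \<le> 0" for s
  proof (rule antisym[OF Gmono[OF that]])
    show "G 0 \<le> G s"
    proof (rule DERIV_nonpos_imp_nonincreasing[OF that])
      show "\<exists>y. (G has_real_derivative y) (at x) \<and> y \<le> 0" if "s \<le> x" "x \<le> 0" for x
        using G[of x] bpos[of x] that by (intro exI[of _ "\<beta> x"]) auto
    qed
  qed
  have Gh: "G s = G h" if "h \<le> s" for s
  proof (rule antisym[OF _ Gmono[OF that]])
    show "G s \<le> G h"
    proof (rule DERIV_nonpos_imp_nonincreasing[OF that])
      show "\<exists>y. (G has_real_derivative y) (at x) \<and> y \<le> 0" if "h \<le> x" "x \<le> s" for x
        using G[of x] bpos[of x] that by (intro exI[of _ "\<beta> x"]) auto
    qed
  qed
  define \<alpha> where "\<alpha> t = G (1 * t + (- a)) - G (1 * t + (- b))" for t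
  define \<alpha>' where "\<alpha>' t = \<beta> (t - a) - \<beta> (t - b)" for t
  show ?thesis
  proof (rule that[of \<alpha> \<alpha>'])
    show "smooth \<alpha>" unfolding \<alpha>_def by (intro smooth_diff smooth_scaled_shift sG)
    show "(\<alpha> has_real_derivative \<alpha>' t) (at t)" for t
      unfolding \<alpha>_def \<alpha>'_def
      by (auto intro!: derivative_eq_intros DERIV_chain2[OF G])
    show "continuous_on UNIV \<alpha>'"
      unfolding \<alpha>'_def
      by (intro continuous_intros continuous_on_compose2[OF smooth_continuous[OF sb]]) auto
    show "0 \<le> \<alpha> t" for t
      unfolding \<alpha>_def using Gmono[of "1 * t + - b" "1 * t + - a"] \<open>a \<le> b\<close> by simp
    show "a \<le> t \<and> t \<le> b + h" if "\<alpha> t \<noteq> 0" for t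
    proof (rule ccontr)
      assume "\<not> (a \<le> t \<and> t \<le> b + h)"
      then consider "t \<le> a" | "b + h \<le> t" by linarith
      then have "\<alpha> t = 0"
      proof cases
        case 1
        then show ?thesis using G0[of "t - a"] G0[of "t - b"] \<open>a \<le> b\<close> by (simp add: \<alpha>_def)
      next
        case 2
        then show ?thesis using Gh[of "t - a"] Gh[of "t - b"] \<open>a \<le> b\<close> by (simp add: \<alpha>_def)
      qed
      then show False using that by simp
    qed
    show "a < t \<and> t < a + h" if "0 < \<alpha>' t" for t
      using that b0[of "t - b"] bpos[of "t - a"] by (auto simp: \<alpha>'_def)
    show "b < t \<and> t < b + h" if "\<alpha>' t < 0" for t
      using that b0[of "t - a"] bpos[of "t - b"] by (auto simp: \<alpha>'_def)
    show "0 < \<alpha>' (a + h / 2)" if "a + h \<le> b"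
    proof -
      have "\<beta> (a + h / 2 - b) = 0" using that \<open>0 < h\<close> bpos[of "a + h / 2 - b"] by auto
      moreover have "\<beta> (h / 2) \<noteq> 0" using \<open>0 < h\<close> bpos[of "h / 2"] by simp
      ultimately show ?thesis using b0[of "h / 2"] by (simp add: \<alpha>'_def)
    qed
  qed
qed

context weak_traffic
begin

text \<open>If \<open>\<phi>\<close> does not decrease along the velocity of \<open>\<nu>\<close>, its integral does not decrease in time. Suppose that
the integral \<open>P\<close> is larger than \<open>m\<close> near \<open>t1\<close> and smaller than \<open>m\<close> near \<open>t2\<close>. Testing the equation with
\<open>\<alpha> (t) \<phi> (t, x)\<close>, where the derivative of \<open>\<alpha>\<close> is positive near \<open>t1\<close>, negative near \<open>t2\<close> and has
integral zero, gives \<open>0 \<ge> \<integral> \<alpha>' P = \<integral> \<alpha>' (P - m) > 0\<close>. The support of \<open>\<phi>\<close> is bounded in space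
only; \<open>\<alpha>\<close> bounds it in time.\<close>

lemma \<nu>_test_monotone:
  fixes \<phi> \<phi>t \<phi>x :: "real \<times> real \<Rightarrow> real"
  assumes \<phi>: "smooth \<phi>" and supp: "\<And>t x. t \<in> {0..T} \<Longrightarrow> \<phi> (t, x) \<noteq> 0 \<Longrightarrow> \<bar>x\<bar> \<le> N"
    and partials: "has_partials \<phi> \<phi>t \<phi>x"
    and ineq: "\<And>t x. t \<in> {0..T} \<Longrightarrow> 0 \<le> \<phi>t (t, x) + \<phi>x (t, x) * velocity (\<nu> t) x"
    and t12: "t1 \<in> {0..T}" "t2 \<in> {0..T}" "t1 \<le> t2"
  shows "(\<integral>x. \<phi> (t1, x) \<partial>\<nu> t1) \<le> (\<integral>x. \<phi> (t2, x) \<partial>\<nu> t2)"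
proof (rule ccontr)
  define P where "P t = (\<integral>x. \<phi> (t, x) \<partial>\<nu> t)" for t
  assume "\<not> (\<integral>x. \<phi> (t1, x) \<partial>\<nu> t1) \<le> (\<integral>x. \<phi> (t2, x) \<partial>\<nu> t2)"
  then have P12: "P t2 < P t1" by (simp add: P_def)
  then have "t1 < t2" using \<open>t1 \<le> t2\<close> by (cases "t1 = t2") auto
  have Pc: "continuous_on {0..T} P"
    unfolding P_def by (rule \<nu>_integral_test_continuous[OF smooth_continuous[OF \<phi>] supp])
  define m where "m = (P t1 + P t2) / 2"
  have m: "P t2 < m" "m < P t1" using P12 by (auto simp: m_def)
  have near: "\<exists>d>0. \<forall>t\<in>{0..T}. \<bar>t - s\<bar> < d \<longrightarrow> \<bar>P t - P s\<bar> < e" if "s \<in> {0..T}" "0 < e" for s e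
    using Pc that unfolding continuous_on_iff dist_real_def by blast
  obtain d1 where d1: "0 < d1" "\<And>t. t \<in> {0..T} \<Longrightarrow> \<bar>t - t1\<bar> < d1 \<Longrightarrow> m < P t"
    using near[OF t12(1), of "P t1 - m"] m by (smt (verit))
  obtain d2 where d2: "0 < d2" "\<And>t. t \<in> {0..T} \<Longrightarrow> \<bar>t - t2\<bar> < d2 \<Longrightarrow> P t < m"
    using near[OF t12(2), of "m - P t2"] m by (smt (verit))
  \<comment> \<open>bumps of width \<open>h\<close> at distance \<open>h\<close> from \<open>t1\<close> and \<open>t2\<close> are disjoint, lie inside \<open>(0, T)\<close> and see \<open>P\<close> on the right side of \<open>m\<close>\<close>
  define h where "h = min (min d1 d2) (t2 - t1) / 4"
  have h: "0 < h" "4 * h \<le> d1" "4 * h \<le> d2" "4 * h \<le> t2 - t1"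
    using d1(1) d2(1) \<open>t1 < t2\<close> by (auto simp: h_def)
  define a b where "a = t1 + h" and "b = t2 - 2 * h"
  have ab: "a \<le> b" "a + h \<le> b" "0 < a" "b + h < T" using h t12 by (auto simp: a_def b_def)
  obtain \<alpha> \<alpha>' where \<alpha>: "smooth \<alpha>" "\<And>t. (\<alpha> has_real_derivative \<alpha>' t) (at t)" "continuous_on UNIV \<alpha>'"
    "\<And>t. 0 \<le> \<alpha> t" "\<And>t. \<alpha> t \<noteq> 0 \<Longrightarrow> a \<le> t \<and> t \<le> b + h"
    "\<And>t. 0 < \<alpha>' t \<Longrightarrow> a < t \<and> t < a + h" "\<And>t. \<alpha>' t < 0 \<Longrightarrow> b < t \<and> t < b + h"
    "0 < \<alpha>' (a + h / 2)"
    using smooth_time_window[OF h(1) ab(1)] ab(2) by metis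
  define \<Phi> \<Phi>t \<Phi>x where "\<Phi> p = \<alpha> (fst p) * \<phi> p"
    and "\<Phi>t p = \<alpha>' (fst p) * \<phi> p + \<alpha> (fst p) * \<phi>t p" and "\<Phi>x p = \<alpha> (fst p) * \<phi>x p" for p :: "real \<times> real"
  have s\<Phi>: "smooth \<Phi>" unfolding \<Phi>_def by (intro smooth_mult smooth_comp[OF \<alpha>(1)] smooth_fst \<phi>)
  have partials\<Phi>: "has_partials \<Phi> \<Phi>t \<Phi>x"
    unfolding has_partials_def
  proof (intro conjI allI)
    show "continuous_on UNIV \<Phi>t" "continuous_on UNIV \<Phi>x"
      unfolding \<Phi>t_def \<Phi>x_def
      by (intro continuous_intros has_partialsD(1,2)[OF partials] smooth_continuous[OF \<phi>]
          continuous_on_compose2[OF \<alpha>(3)] continuous_on_compose2[OF smooth_continuous[OF \<alpha>(1)]]; simp)+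
    show "((\<lambda>s. \<Phi> (s, x)) has_real_derivative \<Phi>t (t, x)) (at t)" for t x
      unfolding \<Phi>_def \<Phi>t_def by (auto intro!: derivative_eq_intros \<alpha>(2) has_partialsD(3)[OF partials])
    show "((\<lambda>y. \<Phi> (t, y)) has_real_derivative \<Phi>x (t, x)) (at x)" for t x
      unfolding \<Phi>_def \<Phi>x_def by (auto intro!: derivative_eq_intros has_partialsD(4)[OF partials])
  qed
  have "{p. \<Phi> p \<noteq> 0} \<subseteq> {a..b + h} \<times> {- N..N}"
  proof
    fix p assume "p \<in> {p. \<Phi> p \<noteq> 0}"
    then have "\<alpha> (fst p) \<noteq> 0" "\<phi> (fst p, snd p) \<noteq> 0" by (auto simp: \<Phi>_def)
    with \<alpha>(5) supp[of "fst p" "snd p"] ab show "p \<in> {a..b + h} \<times> {- N..N}"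
      by (force simp: mem_Times_iff abs_le_iff)
  qed
  then have cl: "closure {p. \<Phi> p \<noteq> 0} \<subseteq> {a..b + h} \<times> {- N..N}"
    by (rule closure_minimal) (intro closed_Times closed_atLeastAtMost)
  have "compact (closure {p. \<Phi> p \<noteq> 0})"
    by (rule compact_Int_closed[of "{a..b + h} \<times> {- N..N}" "closure {p. \<Phi> p \<noteq> 0}", simplified Int_absorb1[OF cl]])
      (intro compact_Times compact_Icc, simp)
  then have cs: "compact_support \<Phi>" by (simp add: compact_support_def)
  have supp\<Phi>: "closure {p. \<Phi> p \<noteq> 0} \<subseteq> {0<..<T} \<times> UNIV" using cl ab by auto
  obtain B where B: "0 \<le> B" "\<And>p. \<bar>\<Phi>t p\<bar> \<le> B" "\<And>p. \<bar>\<Phi>x p\<bar> \<le> B"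
    using compact_support_derivatives_bounded[OF cs partials\<Phi>] by blast
  define q where "q t = (\<integral>x. \<Phi>t (t, x) + \<Phi>x (t, x) * velocity (\<nu> t) x \<partial>\<nu> t)" for t
  have q0: "(\<integral>t. indicator {0..T} t * q t \<partial>lborel) = 0"
    unfolding q_def by (rule \<nu>_test_equation[OF s\<Phi> cs supp\<Phi> partials\<Phi>])
  have qi: "integrable lborel (\<lambda>t. indicator {0..T} t * q t)"
    unfolding q_def by (rule \<nu>_test_rate_integrable[OF partials\<Phi> B(2,3)])
  have ai: "integrable lborel (\<lambda>t. indicator {0..T} t * \<alpha>' t)"
    using borel_integrable_compact[of "{0..T}" \<alpha>'] continuous_on_subset[OF \<alpha>(3)] by simp
  have a0: "(\<integral>t. indicator {0..T} t * \<alpha>' t \<partial>lborel) = 0"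
  proof -
    have "(\<integral>t. indicator {0..T} t *\<^sub>R \<alpha>' t \<partial>lborel) = \<alpha> T - \<alpha> 0"
      using T \<alpha>(2) continuous_on_subset[OF \<alpha>(3)]
      by (intro integral_FTC_atLeastAtMost)
        (auto simp: has_real_derivative_iff_has_vector_derivative intro: has_vector_derivative_at_within)
    moreover have "\<alpha> T = 0" "\<alpha> 0 = 0" using \<alpha>(5)[of T] \<alpha>(5)[of 0] ab by auto
    ultimately show ?thesis by simp
  qed
  have q_ge: "\<alpha>' t * P t \<le> q t" if t: "t \<in> {0..T}" for t
  proof -
    interpret N: finite_measure "\<nu> t" by (rule \<nu>_finite[OF t])
    note mc = measurable_cong_sets[OF \<nu>_sets[OF t] refl]
    have cont: "(\<lambda>x. f (t, x)) \<in> borel_measurable borel" if "continuous_on UNIV f" for f :: "real \<times> real \<Rightarrow> real"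
      by (intro borel_measurable_continuous_onI continuous_on_compose2[OF that]) (auto intro!: continuous_intros)
    have m1: "(\<lambda>x. \<Phi>t (t, x) + \<Phi>x (t, x) * velocity (\<nu> t) x) \<in> borel_measurable borel"
      by (intro borel_measurable_add borel_measurable_times cont has_partialsD(1,2)[OF partials\<Phi>] \<nu>_velocity_borel t)
    have bound: "\<bar>\<Phi>t (t, x) + \<Phi>x (t, x) * velocity (\<nu> t) x\<bar> \<le> B + B * V" for x
      by (rule transport_rate_bound[OF B(2,3)])
    have i1: "integrable (\<nu> t) (\<lambda>x. \<Phi>t (t, x) + \<Phi>x (t, x) * velocity (\<nu> t) x)"
      using m1 bound mc by (intro N.integrable_const_bound[of _ "B + B * V"]) auto
    have "compact ((\<lambda>x. (t, x)) ` {- N..N})" by (intro compact_continuous_image compact_Icc continuous_intros)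
    then have "bounded (\<phi> ` (\<lambda>x. (t, x)) ` {- N..N})"
      by (rule compact_imp_bounded[OF compact_continuous_image[OF
            continuous_on_subset[OF smooth_continuous[OF \<phi>] subset_UNIV]]])
    then obtain B' where "\<forall>x\<in>{- N..N}. \<bar>\<phi> (t, x)\<bar> \<le> B'" unfolding bounded_iff by auto
    then have B': "\<bar>\<phi> (t, x)\<bar> \<le> B'" if "x \<in> {- N..N}" for x using that by blast
    have "\<bar>\<phi> (t, x)\<bar> \<le> max B' 0" for x
      using B'[of x] supp[OF t, of x] by (cases "\<phi> (t, x) = 0") (auto simp: abs_le_iff le_max_iff_disj)
    then have i2: "integrable (\<nu> t) (\<lambda>x. \<phi> (t, x))"
      using cont[OF smooth_continuous[OF \<phi>]] mc by (intro N.integrable_const_bound[of _ "max B' 0"]) auto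
    have "0 \<le> (\<integral>x. (\<Phi>t (t, x) + \<Phi>x (t, x) * velocity (\<nu> t) x) - \<alpha>' t * \<phi> (t, x) \<partial>\<nu> t)"
    proof (rule Bochner_Integration.integral_nonneg)
      fix x
      have "(\<Phi>t (t, x) + \<Phi>x (t, x) * velocity (\<nu> t) x) - \<alpha>' t * \<phi> (t, x) =
          \<alpha> t * (\<phi>t (t, x) + \<phi>x (t, x) * velocity (\<nu> t) x)"
        by (simp add: \<Phi>t_def \<Phi>x_def algebra_simps)
      then show "0 \<le> (\<Phi>t (t, x) + \<Phi>x (t, x) * velocity (\<nu> t) x) - \<alpha>' t * \<phi> (t, x)"
        using \<alpha>(4)[of t] ineq[OF t, of x] by simp
    qed
    then show ?thesis using i1 i2 by (simp add: q_def P_def)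
  qed
  have sign: "\<alpha>' t * m \<le> \<alpha>' t * P t" if t: "t \<in> {0..T}" for t
  proof -
    consider "0 < \<alpha>' t" | "\<alpha>' t = 0" | "\<alpha>' t < 0" by linarith
    then show ?thesis
    proof cases
      case 1
      then have "m < P t" using \<alpha>(6)[OF 1] h(1,2) by (intro d1(2) t) (auto simp: a_def)
      then show ?thesis using 1 by simp
    next
      case 3
      then have "P t < m" using \<alpha>(7)[OF 3] h(1,3) by (intro d2(2) t) (auto simp: b_def)
      then show ?thesis using 3 by (intro mult_left_mono_neg) auto
    qed simp
  qed
  let ?g = "\<lambda>t. indicator {0..T} t * q t - m * (indicator {0..T} t * \<alpha>' t)"
  have "integrable lborel ?g" using qi ai by simp
  moreover have "(\<integral>t. ?g t \<partial>lborel) = 0" using qi ai q0 a0 by simp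
  moreover have "0 \<le> ?g t" for t
  proof (cases "t \<in> {0..T}")
    case True
    then show ?thesis using q_ge[OF True] sign[OF True] by (simp add: mult.commute)
  qed simp
  ultimately have "AE t in lborel. ?g t = 0"
    using integral_nonneg_eq_0_iff_AE[of lborel ?g] by simp
  have "isCont \<alpha>' (a + h / 2)" using \<alpha>(3) by (simp add: continuous_on_eq_continuous_at)
  then have "\<forall>\<^sub>F t in nhds (a + h / 2). 0 < \<alpha>' t"
    using \<alpha>(8) by (intro order_tendstoD(1)[of _ "\<alpha>' (a + h / 2)"]) (simp add: isCont_def tendsto_at_iff_tendsto_nhds)
  then obtain r where r: "0 < r" "\<And>t. dist t (a + h / 2) < r \<Longrightarrow> 0 < \<alpha>' t"
    unfolding eventually_nhds_metric by blast
  define I where "I = {a + h / 2 - r<..<a + h / 2 + r}"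
  have "AE t in lborel. t \<notin> I"
    using \<open>AE t in lborel. ?g t = 0\<close>
  proof eventually_elim
    case (elim t)
    show ?case
    proof
      assume "t \<in> I"
      then have pos: "0 < \<alpha>' t" using r(2)[of t] by (auto simp: I_def dist_real_def abs_less_iff)
      have t: "t \<in> {0..T}" using \<alpha>(6)[OF pos] ab h(1) by auto
      have "m < P t" using \<alpha>(6)[OF pos] h(1,2) by (intro d1(2) t) (auto simp: a_def)
      then have "\<alpha>' t * m < q t" using q_ge[OF t] pos by (smt (verit) mult_strict_left_mono)
      then show False using elim t by (simp add: mult.commute)
    qed
  qed
  then have "I \<in> null_sets lborel"
    by (subst AE_iff_null_sets) (simp_all add: I_def)
  then show False using r(1) by (simp add: I_def null_sets_def)
qed

end

section \<open>Barriers for a weak solution\<close>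

lemma ramp_mono: "x \<le> y \<Longrightarrow> ramp x \<le> ramp y"
  by (rule DERIV_nonneg_imp_nondecreasing[of x y ramp])
    (assumption, intro exI conjI, rule ramp_has_derivative, rule ramp'_nonneg)

text \<open>Trajectories of the flow are continuously differentiable only, whereas barriers enter test functions and must be
smooth. A polynomial close to the derivative provides a smooth substitute.\<close>

lemma C1_smooth_approximation:
  assumes "0 \<le> T" and y: "\<And>t. t \<in> {0..T} \<Longrightarrow> (y has_real_derivative c t) (at t within {0..T})"
    and c: "continuous_on {0..T} c" and "0 < \<gamma>"
  obtains P P' where "smooth P" "continuous_on UNIV P'" "\<And>t. (P has_real_derivative P' t) (at t)"
    "P 0 = y 0" "\<And>t. t \<in> {0..T} \<Longrightarrow> \<bar>P t - y t\<bar> \<le> \<gamma>" "\<And>t. t \<in> {0..T} \<Longrightarrow> \<bar>P' t - c t\<bar> \<le> \<gamma>"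
proof -
  \<comment> \<open>an error of size \<open>\<gamma>'\<close> in the derivative accumulates to at most \<open>\<gamma>\<close> over \<open>[0, T]\<close>\<close>
  define \<gamma>' where "\<gamma>' = \<gamma> / (1 + T)"
  have \<gamma>': "0 < \<gamma>'" "\<gamma>' \<le> \<gamma>" "\<gamma>' * T \<le> \<gamma>"
    using \<open>0 < \<gamma>\<close> \<open>0 \<le> T\<close> by (auto simp: \<gamma>'_def field_simps)
  obtain g where g: "real_polynomial_function g" "\<And>t. t \<in> {0..T} \<Longrightarrow> \<bar>c t - g t\<bar> < \<gamma>'"
    using Stone_Weierstrass_real_polynomial_function[OF compact_Icc c \<gamma>'(1)] by blast
  obtain a n where g_eq: "g = (\<lambda>x. \<Sum>i\<le>n. a i * x ^ i)"
    using g(1) unfolding real_polynomial_function_iff_sum by blast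
  have "g = poly (\<Sum>i\<le>n. monom (a i) i)"
    unfolding g_eq by (simp add: poly_sum poly_monom fun_eq_iff)
  then have sg: "smooth g" using smooth_poly by simp
  obtain F where F: "\<And>t. (F has_real_derivative g t) (at t)"
    using continuous_antiderivative_exists[OF smooth_continuous[OF sg]] by blast
  define P where "P t = F t + (y 0 - F 0)" for t
  have P: "(P has_real_derivative g t) (at t)" for t
    unfolding P_def by (auto intro!: derivative_eq_intros F)
  have d: "((\<lambda>t. P t - y t) has_real_derivative g t - c t) (at t within {0..T})" if "t \<in> {0..T}" for t
    by (intro derivative_intros has_field_derivative_at_within[OF P] y that)
  have "\<bar>P t - y t\<bar> \<le> \<gamma>" if t: "t \<in> {0..T}" for t
  proof -
    have "\<bar>(P t - y t) - (P 0 - y 0)\<bar> \<le> \<gamma>' * \<bar>t - 0\<bar>"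
    proof (rule deriv_within_bounded_imp_lipschitz[OF d _ t])
      show "\<bar>g s - c s\<bar> \<le> \<gamma>'" if "s \<in> {0..T}" for s using g(2)[OF that] by linarith
    qed (use \<open>0 \<le> T\<close> in auto)
    also have "\<dots> \<le> \<gamma>' * T" using t \<gamma>' by (intro mult_left_mono) auto
    also have "\<dots> \<le> \<gamma>" by (rule \<gamma>'(3))
    finally show ?thesis by (simp add: P_def)
  qed
  moreover have "\<bar>g t - c t\<bar> \<le> \<gamma>" if "t \<in> {0..T}" for t using g(2)[OF that] \<gamma>'(2) by linarith
  moreover have "smooth P" by (rule smooth_antiderivative[OF sg P])
  moreover have "P 0 = y 0" by (simp add: P_def)
  ultimately show ?thesis using that[of P g] smooth_continuous[OF sg] P by blast
qed

context weak_traffic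
begin

text \<open>Let \<open>n\<close> tend to infinity in the test functions \<open>ramp (n f) ramp (n (g + n))\<close>. The first factor tends to the
indicator of \<open>f > 0\<close>; the second one tends to \<open>1\<close> and makes the support bounded. Both arguments are
nondecreasing along the velocity of \<open>\<nu>\<close> where it matters.\<close>

lemma \<nu>_superlevel_monotone:
  fixes f ft fx g gt gx :: "real \<times> real \<Rightarrow> real"
  assumes f: "smooth f" "has_partials f ft fx"
    and f_ineq: "\<And>t x. t \<in> {0..T} \<Longrightarrow> 0 < f (t, x) \<Longrightarrow> 0 \<le> ft (t, x) + fx (t, x) * velocity (\<nu> t) x"
    and g: "smooth g" "has_partials g gt gx"
    and g_ineq: "\<And>t x. t \<in> {0..T} \<Longrightarrow> 0 \<le> gt (t, x) + gx (t, x) * velocity (\<nu> t) x"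
    and bounded: "\<And>n::nat. \<exists>N. \<forall>t\<in>{0..T}. \<forall>x. 0 < f (t, x) \<longrightarrow> 0 < g (t, x) + real n \<longrightarrow> \<bar>x\<bar> \<le> N"
    and t: "t \<in> {0..T}"
  shows "measure (\<nu> 0) {x. 0 < f (0, x)} \<le> measure (\<nu> t) {x. 0 < f (t, x)}"
proof -
  define \<phi> where "\<phi> n p = ramp (real n * f p) * ramp (real n * (g p + real n))" for n p
  define \<phi>t where "\<phi>t n p = ramp' (real n * f p) * (real n * ft p) * ramp (real n * (g p + real n)) +
      ramp (real n * f p) * (ramp' (real n * (g p + real n)) * (real n * gt p))" for n p
  define \<phi>x where "\<phi>x n p = ramp' (real n * f p) * (real n * fx p) * ramp (real n * (g p + real n)) +
      ramp (real n * f p) * (ramp' (real n * (g p + real n)) * (real n * gx p))" for n p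
  have step: "(\<integral>x. \<phi> n (0, x) \<partial>\<nu> 0) \<le> (\<integral>x. \<phi> n (t, x) \<partial>\<nu> t)" for n
  proof -
    obtain N where N: "\<And>t x. t \<in> {0..T} \<Longrightarrow> 0 < f (t, x) \<Longrightarrow> 0 < g (t, x) + real n \<Longrightarrow> \<bar>x\<bar> \<le> N"
      using bounded[of n] by blast
    show ?thesis
    proof (rule \<nu>_test_monotone[where N = N and \<phi>t = "\<phi>t n" and \<phi>x = "\<phi>x n"])
      show "smooth (\<phi> n)"
        unfolding \<phi>_def
        by (intro smooth_mult[of "\<lambda>p. ramp (real n * f p)"] smooth_comp[OF smooth_ramp]
            smooth_mult[OF smooth_const] smooth_add smooth_const f(1) g(1))
      show "\<bar>x\<bar> \<le> N" if "t \<in> {0..T}" "\<phi> n (t, x) \<noteq> 0" for t x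
        using that(2) N[OF that(1), of x] by (auto simp: \<phi>_def ramp_bounds(3) zero_less_mult_iff)
      show "has_partials (\<phi> n) (\<phi>t n) (\<phi>x n)"
        unfolding has_partials_def
      proof (intro conjI allI)
        show "continuous_on UNIV (\<phi>t n)" "continuous_on UNIV (\<phi>x n)"
          unfolding \<phi>t_def \<phi>x_def
          by (intro continuous_intros has_partialsD(1,2)[OF f(2)] has_partialsD(1,2)[OF g(2)]
              smooth_continuous[OF f(1)] smooth_continuous[OF g(1)]
              continuous_on_compose2[OF smooth_continuous[OF smooth_ramp]]
              continuous_on_compose2[OF smooth_continuous[OF smooth_ramp']] subset_UNIV)+
        show "((\<lambda>s. \<phi> n (s, x)) has_real_derivative \<phi>t n (t, x)) (at t)" for t x
          unfolding \<phi>_def \<phi>t_def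
          by (auto intro!: derivative_eq_intros DERIV_chain2[OF ramp_has_derivative]
              has_partialsD(3)[OF f(2)] has_partialsD(3)[OF g(2)])
        show "((\<lambda>y. \<phi> n (t, y)) has_real_derivative \<phi>x n (t, x)) (at x)" for t x
          unfolding \<phi>_def \<phi>x_def
          by (auto intro!: derivative_eq_intros DERIV_chain2[OF ramp_has_derivative]
              has_partialsD(4)[OF f(2)] has_partialsD(4)[OF g(2)])
      qed
      show "0 \<le> \<phi>t n (t, x) + \<phi>x n (t, x) * velocity (\<nu> t) x" if "t \<in> {0..T}" for t x
      proof -
        let ?b = "velocity (\<nu> t) x" and ?r = "\<lambda>p. ramp (real n * (g p + real n))"
        have "\<phi>t n (t, x) + \<phi>x n (t, x) * ?b =
            ramp' (real n * f (t, x)) * real n * (ft (t, x) + fx (t, x) * ?b) * ?r (t, x) +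
            ramp (real n * f (t, x)) * (ramp' (real n * (g (t, x) + real n)) * real n * (gt (t, x) + gx (t, x) * ?b))"
          by (simp add: \<phi>t_def \<phi>x_def algebra_simps)
        moreover have "0 \<le> ramp' (real n * f (t, x)) * real n * (ft (t, x) + fx (t, x) * ?b)"
        proof (cases "ramp' (real n * f (t, x)) = 0")
          case False
          then have "0 < f (t, x)" using ramp_bounds(5)[of "real n * f (t, x)"] by (simp add: zero_less_mult_iff)
          then show ?thesis using f_ineq[OF that] ramp'_nonneg by simp
        qed simp
        ultimately show ?thesis
          using g_ineq[OF that] ramp'_nonneg ramp_bounds(1) by simp
      qed
    qed (use t T in auto)
  qed
  have lim: "(\<lambda>n. \<integral>x. \<phi> n (s, x) \<partial>\<nu> s) \<longlonglongrightarrow> measure (\<nu> s) {x. 0 < f (s, x)}" if s: "s \<in> {0..T}" for s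
  proof -
    interpret N: finite_measure "\<nu> s" by (rule \<nu>_finite[OF s])
    have cs: "continuous_on UNIV (\<lambda>x. h (s, x))" if "continuous_on UNIV h" for h :: "real \<times> real \<Rightarrow> real"
      by (rule continuous_on_compose2[OF that]) (auto intro!: continuous_intros)
    have mf[measurable]: "(\<lambda>x. f (s, x)) \<in> borel_measurable borel" "(\<lambda>x. g (s, x)) \<in> borel_measurable borel"
      "ramp \<in> borel_measurable borel"
      by (intro borel_measurable_continuous_onI cs smooth_continuous[OF f(1)] smooth_continuous[OF g(1)]
          smooth_continuous[OF smooth_ramp])+
    have [measurable_cong]: "sets (\<nu> s) = sets borel" by (rule \<nu>_sets[OF s])
    have S: "{x. 0 < f (s, x)} \<in> sets (\<nu> s)" unfolding \<nu>_sets[OF s] by measurable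
    have "(\<lambda>n. \<integral>x. \<phi> n (s, x) \<partial>\<nu> s) \<longlonglongrightarrow> (\<integral>x. indicator {x. 0 < f (s, x)} x \<partial>\<nu> s)"
    proof (rule integral_dominated_convergence[where w = "\<lambda>_. 1"])
      show "(\<lambda>x. \<phi> n (s, x)) \<in> borel_measurable (\<nu> s)" for n unfolding \<phi>_def by measurable
      show "(\<lambda>x. indicator {x. 0 < f (s, x)} x :: real) \<in> borel_measurable (\<nu> s)" using S by simp
      show "AE x in \<nu> s. norm (\<phi> n (s, x)) \<le> 1" for n
        using ramp_bounds(1,2) by (auto simp: \<phi>_def abs_mult intro!: mult_le_one)
      show "AE x in \<nu> s. (\<lambda>n. \<phi> n (s, x)) \<longlonglongrightarrow> indicator {x. 0 < f (s, x)} x"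
      proof (rule AE_I2)
        fix x
        have "(\<lambda>n. ramp (real n * (g (s, x) + real n))) \<longlonglongrightarrow> 1"
        proof (rule tendsto_sandwich)
          show "(\<lambda>n. ramp (real n * 1)) \<longlonglongrightarrow> 1" using ramp_scaled_tendsto[of 1] by simp
          have "\<forall>\<^sub>F n in sequentially. 1 - g (s, x) \<le> real n"
            using filterlim_real_sequentially by (simp add: filterlim_at_top)
          then show "\<forall>\<^sub>F n in sequentially. ramp (real n * 1) \<le> ramp (real n * (g (s, x) + real n))"
            by eventually_elim (intro ramp_mono mult_left_mono, auto)
        qed (auto simp: ramp_bounds)
        from tendsto_mult[OF ramp_scaled_tendsto[of "f (s, x)"] this]
        show "(\<lambda>n. \<phi> n (s, x)) \<longlonglongrightarrow> indicator {x. 0 < f (s, x)} x"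
          by (auto simp: \<phi>_def split: if_splits)
      qed
    qed simp
    then show ?thesis using S by simp
  qed
  show ?thesis
    using lim[of 0] lim[OF t] step T by (intro LIMSEQ_le) auto
qed

text \<open>No mass of \<open>\<nu>\<close> crosses a moving barrier \<open>Z\<close> in the direction of \<open>\<sigma>\<close>. The hypothesis compares the
velocity at \<open>x\<close> with the speed of the barrier up to an error proportional to the distance; the factor
\<open>exp (L t)\<close> in \<open>f\<close> absorbs this error. The cutoff \<open>g\<close> is at rest for \<open>\<sigma> = 1\<close> and
moves with the maximal speed \<open>V\<close> for \<open>\<sigma> = - 1\<close>, so that no mass leaves the region that it selects.\<close>

lemma \<nu>_mass_beside_barrier:
  assumes \<sigma>: "\<sigma> = 1 \<or> \<sigma> = - 1"
    and Z: "smooth Z" "continuous_on UNIV Z'" "\<And>t. (Z has_real_derivative Z' t) (at t)"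
    and ineq: "\<And>t x. t \<in> {0..T} \<Longrightarrow> 0 < \<sigma> * (Z t - x) \<Longrightarrow> 0 \<le> \<sigma> * (Z' t + L * (Z t - x) - velocity (\<nu> t) x)"
    and t: "t \<in> {0..T}"
  shows "measure m0 {x. 0 < \<sigma> * (Z 0 - x)} \<le> measure (\<nu> t) {x. 0 < \<sigma> * (Z t - x)}"
proof -
  note cZ = smooth_continuous[OF Z(1)]
  define E where "E p = exp (L * fst p)" for p :: "real \<times> real"
  define f where "f p = E p * (\<sigma> * (Z (fst p) - snd p))" for p
  define ft where "ft p = E p * (\<sigma> * (Z' (fst p) + L * (Z (fst p) - snd p)))" for p
  define fx where "fx p = - \<sigma> * E p" for p
  define c where "c = (1 - \<sigma>) / 2 * V"
  define g where "g p = c * fst p + \<sigma> * snd p" for p :: "real \<times> real"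
  have f_pos: "0 < f (s, x) \<longleftrightarrow> 0 < \<sigma> * (Z s - x)" for s x
    by (simp add: f_def E_def zero_less_mult_iff)
  have "measure (\<nu> 0) {x. 0 < f (0, x)} \<le> measure (\<nu> t) {x. 0 < f (t, x)}"
  proof (rule \<nu>_superlevel_monotone[where ft = ft and fx = fx and g = g and gt = "\<lambda>_. c" and gx = "\<lambda>_. \<sigma>",
        OF _ _ _ _ _ _ _ t])
    show "smooth f" unfolding f_def E_def
      by (intro smooth_mult[of "\<lambda>p. exp (L * fst p)"] smooth_diff smooth_comp[OF smooth_exp]
          smooth_comp[OF Z(1)] smooth_mult[OF smooth_const] smooth_fst smooth_snd)
    show "has_partials f ft fx"
      unfolding has_partials_def
    proof (intro conjI allI)
      show "continuous_on UNIV ft" "continuous_on UNIV fx"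
        unfolding ft_def fx_def E_def
        by (auto intro!: continuous_intros continuous_on_compose2[OF cZ] continuous_on_compose2[OF Z(2)])
      show "((\<lambda>s. f (s, x)) has_real_derivative ft (t, x)) (at t)" for t x
        unfolding f_def ft_def E_def by (auto intro!: derivative_eq_intros Z(3) simp: algebra_simps)
      show "((\<lambda>y. f (t, y)) has_real_derivative fx (t, x)) (at x)" for t x
        unfolding f_def fx_def E_def by (auto intro!: derivative_eq_intros)
    qed
    show "0 \<le> ft (t, x) + fx (t, x) * velocity (\<nu> t) x" if "t \<in> {0..T}" "0 < f (t, x)" for t x
    proof -
      have "0 \<le> E (t, x) * (\<sigma> * (Z' t + L * (Z t - x) - velocity (\<nu> t) x))"
        using ineq[OF that(1), of x] that(2) f_pos by (simp add: E_def)
      then show ?thesis by (simp add: ft_def fx_def algebra_simps)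
    qed
    show "smooth g" unfolding g_def
      by (intro smooth_add smooth_mult[OF smooth_const] smooth_fst smooth_snd)
    show "has_partials g (\<lambda>_. c) (\<lambda>_. \<sigma>)"
      unfolding has_partials_def g_def by (auto intro!: derivative_eq_intros)
    show "0 \<le> c + \<sigma> * velocity (\<nu> t) x" for t x
      using \<sigma> velocity_bounds[of "\<nu> t" x] by (auto simp: c_def)
    show "\<exists>N. \<forall>t\<in>{0..T}. \<forall>x. 0 < f (t, x) \<longrightarrow> 0 < g (t, x) + real n \<longrightarrow> \<bar>x\<bar> \<le> N" for n
    proof -
      have "bounded (Z ` {0..T})"
        by (intro compact_imp_bounded compact_continuous_image continuous_on_subset[OF cZ]) auto
      then obtain B where "\<forall>t\<in>{0..T}. \<bar>Z t\<bar> \<le> B" unfolding bounded_iff by auto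
      then have B: "\<bar>Z t\<bar> \<le> B" if "t \<in> {0..T}" for t using that by blast
      have "\<bar>x\<bar> \<le> max B (V * T + real n)" if "s \<in> {0..T}" "0 < f (s, x)" "0 < g (s, x) + real n" for s x
      proof -
        have "0 \<le> V * s" "V * s \<le> V * T" using that(1) V_nonneg by (auto intro: mult_left_mono)
        then show ?thesis
          using \<sigma> that(2,3) B[OF that(1)] unfolding f_pos g_def c_def by (auto simp: abs_le_iff le_max_iff_disj)
      qed
      then show ?thesis by blast
    qed
  qed
  then show ?thesis by (simp only: f_pos \<nu>_0)
qed

lemma \<nu>_mass_left_of_supersolution:
  assumes Z: "smooth Z" "continuous_on UNIV Z'" "\<And>t. (Z has_real_derivative Z' t) (at t)"
    and ineq: "\<And>t x. t \<in> {0..T} \<Longrightarrow> x < Z t \<Longrightarrow> velocity (\<nu> t) x \<le> Z' t + L * (Z t - x)"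
    and t: "t \<in> {0..T}"
  shows "measure m0 {..<Z 0} \<le> measure (\<nu> t) {..<Z t}"
  using \<nu>_mass_beside_barrier[of 1, OF _ Z _ t, of L] ineq by (simp add: lessThan_def)

lemma \<nu>_mass_right_of_subsolution:
  assumes Z: "smooth Z" "continuous_on UNIV Z'" "\<And>t. (Z has_real_derivative Z' t) (at t)"
    and ineq: "\<And>t x. t \<in> {0..T} \<Longrightarrow> Z t < x \<Longrightarrow> Z' t - L * (x - Z t) \<le> velocity (\<nu> t) x"
    and t: "t \<in> {0..T}"
  shows "measure m0 {Z 0<..} \<le> measure (\<nu> t) {Z t<..}"
  using \<nu>_mass_beside_barrier[of "- 1", OF _ Z _ t, of L] ineq by (simp add: greaterThan_def algebra_simps)

section \<open>Uniqueness\<close>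

lemma \<nu>_mass_complement:
  assumes "t \<in> {0..T}"
  shows "measure (\<nu> t) {x..} = measure m0 UNIV - measure (\<nu> t) {..<x}"
proof -
  interpret N: finite_measure "\<nu> t" by (rule \<nu>_finite[OF assms])
  have "measure (\<nu> t) (UNIV - {..<x}) = measure (\<nu> t) UNIV - measure (\<nu> t) {..<x}"
    using N.finite_measure_compl[of "{..<x}"] by (simp add: \<nu>_sets[OF assms] \<nu>_space[OF assms])
  moreover have "UNIV - {..<x} = {x..}" by auto
  ultimately show ?thesis by (simp add: \<nu>_mass[OF assms])
qed

lemma \<nu>_tail_le_of_supersolution:
  assumes Z: "smooth Z" "continuous_on UNIV Z'" "\<And>t. (Z has_real_derivative Z' t) (at t)"
    and ineq: "\<And>t x. t \<in> {0..T} \<Longrightarrow> x < Z t \<Longrightarrow> velocity (\<nu> t) x \<le> Z' t + L * (Z t - x)"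
    and t: "t \<in> {0..T}"
  shows "measure (\<nu> t) {Z t..} \<le> measure m0 {Z 0..}"
  using \<nu>_mass_left_of_supersolution[OF assms] \<nu>_mass_complement[OF t, of "Z t"] \<nu>_mass_complement[of 0 "Z 0"] T
  by (simp add: \<nu>_0)

definition close_at :: "real \<Rightarrow> real \<Rightarrow> bool" where
  "close_at e t \<longleftrightarrow> shifted_le e (\<nu> t) (\<mu> t) \<and> shifted_le e (\<mu> t) (\<nu> t)"

lemma \<mu>_measure: "0 \<le> t \<Longrightarrow> A \<in> sets borel \<Longrightarrow> measure (\<mu> t) A = measure m0 {z. flow t z \<in> A}"
  unfolding \<mu>_def by (rule push_measure) simp_all

lemma \<mu>_tail_closed:
  assumes "0 \<le> t"
  shows "measure (\<mu> t) {x..} \<le> measure (\<mu> t) {x<..}"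
proof -
  have s: "sets (\<mu> t) = sets borel" using \<mu>_density_bounded[OF assms] by (simp add: density_bounded_def)
  have "{x..} = {x..x} \<union> {x<..}" by auto
  then have "measure (\<mu> t) {x..} \<le> measure (\<mu> t) {x..x} + measure (\<mu> t) {x<..}"
    using s by (simp only:) (rule measure_Un_le, simp_all)
  also have "measure (\<mu> t) {x..x} \<le> 0"
    using density_bounded_Icc[OF \<mu>_density_bounded[OF assms], of x x] by simp
  finally show ?thesis by simp
qed

text \<open>Every weak solution moves mass to the right with speed at most \<open>V\<close>: the barriers at rest and with speed
\<open>V\<close> apply.\<close>

lemma close_at_initial:
  assumes t: "t \<in> {0..T}"
  shows "close_at (V * T + 1) t"
  unfolding close_at_def shifted_le_def
proof (intro conjI allI)
  fix a
  interpret N: finite_measure "\<nu> t" by (rule \<nu>_finite[OF t])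
  have t0: "0 \<le> t" using t by simp
  have Vt: "V * t \<le> V * T" using t V_nonneg by (intro mult_left_mono) auto
  note [measurable] = flow_borel[OF t0]
  have "measure (\<nu> t) {a<..} \<le> measure (\<nu> t) {a..}"
    using \<nu>_sets[OF t] by (intro N.finite_measure_mono) auto
  also have "\<dots> \<le> measure m0 {a - V * t..}"
  proof -
    have "measure (\<nu> t) {V * t + (a - V * t)..} \<le> measure m0 {V * 0 + (a - V * t)..}"
      by (rule \<nu>_tail_le_of_supersolution[where Z = "\<lambda>s. V * s + (a - V * t)" and Z' = "\<lambda>_. V" and L = 0, OF _ _ _ _ t])
        (auto intro!: smooth_scaled_shift[OF smooth_linear[OF bounded_linear_ident]] derivative_eq_intros simp: velocity_bounds)
    then show ?thesis by simp
  qed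
  also have "\<dots> \<le> measure m0 {z. flow t z \<in> {a - (V * T + 1)<..}}"
  proof (rule m0.finite_measure_mono)
    show "{a - V * t..} \<subseteq> {z. flow t z \<in> {a - (V * T + 1)<..}}"
    proof
      fix z assume "z \<in> {a - V * t..}"
      then show "z \<in> {z. flow t z \<in> {a - (V * T + 1)<..}}" using flow_bounds(1)[OF t0, of z] Vt by simp
    qed
  qed simp
  finally show "measure (\<nu> t) {a<..} \<le> measure (\<mu> t) {a - (V * T + 1)<..}"
    using t0 by (simp add: \<mu>_measure)
  have "measure (\<mu> t) {a<..} = measure m0 {z. flow t z \<in> {a<..}}" using t0 by (simp add: \<mu>_measure)
  also have "\<dots> \<le> measure m0 {a - V * t<..}"
  proof (rule m0.finite_measure_mono)
    show "{z. flow t z \<in> {a<..}} \<subseteq> {a - V * t<..}"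
    proof
      fix z assume "z \<in> {z. flow t z \<in> {a<..}}"
      then show "z \<in> {a - V * t<..}" using flow_bounds(2)[OF t0, of z] by simp
    qed
  qed simp
  also have "\<dots> \<le> measure (\<nu> t) {a - V * t<..}"
    by (rule \<nu>_mass_right_of_subsolution[where Z = "\<lambda>_. a - V * t" and Z' = "\<lambda>_. 0" and L = 0, OF _ _ _ _ t])
      (auto intro!: smooth_const simp: velocity_bounds)
  also have "\<dots> \<le> measure (\<nu> t) {a - (V * T + 1)<..}"
    using \<nu>_sets[OF t] Vt by (intro N.finite_measure_mono) auto
  finally show "measure (\<mu> t) {a<..} \<le> measure (\<nu> t) {a - (V * T + 1)<..}" .
qed

text \<open>With \<open>c = Lv * K\<close>, one \<open>c\<close> accounts for the spreading of the barrier, two for the velocity error, and the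
summand \<open>1\<close> leaves room for the smooth approximation.\<close>

definition gap_rate :: real where "gap_rate = 3 * (Lv * K) + 1"

lemma gap_rate_pos: "0 < gap_rate"
  unfolding gap_rate_def using Lv_nonneg K_nonneg by (intro add_nonneg_pos) auto

text \<open>If \<open>\<nu>\<close> and the constructed solution are within \<open>A exp (gap_rate t)\<close> of each other, their velocities differ by
at most \<open>c A exp (gap_rate t)\<close>, and the velocity of the constructed solution is Lipschitz with constant \<open>c\<close>.
Therefore a smooth approximation of a trajectory, displaced by \<open>r = A / 2 exp (gap_rate t)\<close> to the right or to the
left, is a barrier for \<open>\<nu>\<close>: \<open>r\<close> grows fast enough to outrun all errors. Comparing the mass beyond the
barrier with the mass beyond the trajectory improves the distance to \<open>r + \<gamma>\<close>.\<close>

lemma close_at_improve: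
  assumes A: "0 < A" and close: "\<And>t. t \<in> {0..T} \<Longrightarrow> close_at (A * exp (gap_rate * t)) t" and t: "t \<in> {0..T}"
  shows "close_at (3 / 4 * A * exp (gap_rate * t)) t"
proof -
  define c where "c = Lv * K"
  have c: "0 \<le> c" unfolding c_def using Lv_nonneg K_nonneg by simp
  \<comment> \<open>the first bound keeps \<open>r + \<gamma>\<close> below three quarters of the old distance, the second one keeps the approximation error within the reserve of \<open>gap_rate\<close>\<close>
  define \<gamma> where "\<gamma> = min (A / 4) (A / 2 / (1 + c))"
  have "0 < \<gamma>" using A c by (simp add: \<gamma>_def)
  moreover have "\<gamma> \<le> A / 4" "\<gamma> \<le> A / 2 / (1 + c)"
    unfolding \<gamma>_def by (rule min.cobounded1, rule min.cobounded2)
  ultimately have \<gamma>: "0 < \<gamma>" "\<gamma> \<le> A / 4" "\<gamma> \<le> A / 2 / (1 + c)" .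
  have \<gamma>c: "(1 + c) * \<gamma> \<le> A / 2"
    using \<gamma>(3) c by (simp add: field_simps)
  define r where "r s = A / 2 * exp (gap_rate * s)" for s
  have r_ge: "A / 2 \<le> r s" if "s \<in> {0..T}" for s
    unfolding r_def using A that gap_rate_pos by (simp add: mult_le_cancel_left1)
  have r': "(r has_real_derivative gap_rate * r s) (at s)" for s
    unfolding r_def by (auto intro!: derivative_eq_intros)
  have rs: "smooth r" unfolding r_def
    by (intro smooth_mult[OF smooth_const] smooth_comp[OF smooth_exp] smooth_linear[OF bounded_linear_ident])
  have rate: "c * (r s + \<gamma>) + 2 * c * r s + \<gamma> \<le> gap_rate * r s" if "s \<in> {0..T}" for s
    using \<gamma>c r_ge[OF that] unfolding gap_rate_def c_def[symmetric] by (simp add: algebra_simps)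
  have fld: "\<bar>velocity (\<nu> s) x - speed (flow s) z\<bar> \<le> 2 * c * r s + c * \<bar>x - flow s z\<bar>" if s: "s \<in> {0..T}" for s x z
  proof -
    have s0: "0 \<le> s" using s by simp
    have "\<bar>velocity (\<nu> s) x - velocity (\<mu> s) x\<bar> \<le> Lv * K * (A * exp (gap_rate * s))"
      using close[OF s] A unfolding close_at_def
      by (intro velocity_close \<nu>_sets \<nu>_finite \<mu>_density_bounded \<mu>_mass s s0) auto
    moreover have "\<bar>velocity (\<mu> s) x - velocity (\<mu> s) (flow s z)\<bar> \<le> Lv * K * \<bar>x - flow s z\<bar>"
      by (intro velocity_lipschitz \<mu>_density_bounded \<mu>_mass s0)
    moreover have "velocity (\<mu> s) (flow s z) = speed (flow s) z" by (simp add: speed_def \<mu>_def)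
    ultimately show ?thesis unfolding c_def r_def by (simp add: mult_ac)
  qed
  have approx: "\<exists>P P'. smooth P \<and> continuous_on UNIV P' \<and> (\<forall>t. (P has_real_derivative P' t) (at t)) \<and> P 0 = z \<and>
      (\<forall>s\<in>{0..T}. \<bar>P s - flow s z\<bar> \<le> \<gamma> \<and> \<bar>P' s - speed (flow s) z\<bar> \<le> \<gamma>)" for z
    using C1_smooth_approximation[of T "\<lambda>s. flow s z" "\<lambda>s. speed (flow s) z" \<gamma>, OF _ flow_has_derivative
        trajectories_continuous(2)[OF flow_trajectories] \<gamma>(1)] T
    by (smt (verit) flow_0)
  interpret N: finite_measure "\<nu> t" by (rule \<nu>_finite[OF t])
  have t0: "0 \<le> t" using t by simp
  note [measurable] = flow_borel[OF t0]
  let ?e = "3 / 4 * A * exp (gap_rate * t)"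
  have e: "r t + \<gamma> \<le> ?e" using \<gamma>(2) r_ge[OF t] unfolding r_def by simp
  show ?thesis
    unfolding close_at_def shifted_le_def
  proof (intro conjI allI)
    fix a
    obtain z where z: "flow t z = a - ?e" using flow_surj[OF t0] .
    obtain P P' where P: "smooth P" "continuous_on UNIV P'" "\<And>t. (P has_real_derivative P' t) (at t)" "P 0 = z"
      "\<And>s. s \<in> {0..T} \<Longrightarrow> \<bar>P s - flow s z\<bar> \<le> \<gamma>" "\<And>s. s \<in> {0..T} \<Longrightarrow> \<bar>P' s - speed (flow s) z\<bar> \<le> \<gamma>"
      using approx[of z] by metis
    have "measure (\<nu> t) {P t + r t..} \<le> measure m0 {P 0 + r 0..}"
    proof (rule \<nu>_tail_le_of_supersolution[where Z = "\<lambda>s. P s + r s" and Z' = "\<lambda>s. P' s + gap_rate * r s" and L = c, OF _ _ _ _ t])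
      show "smooth (\<lambda>s. P s + r s)" by (intro smooth_add P rs)
      show "continuous_on UNIV (\<lambda>s. P' s + gap_rate * r s)" by (intro continuous_intros P smooth_continuous rs)
      show "((\<lambda>s. P s + r s) has_real_derivative P' s + gap_rate * r s) (at s)" for s by (intro derivative_intros P r')
      fix s x assume s: "s \<in> {0..T}" and x: "x < P s + r s"
      have "\<bar>x - flow s z\<bar> \<le> (P s + r s - x) + (r s + \<gamma>)"
        using P(5)[OF s] x r_ge[OF s] A by linarith
      then have "c * \<bar>x - flow s z\<bar> \<le> c * ((P s + r s - x) + (r s + \<gamma>))" using c by (rule mult_left_mono)
      then show "velocity (\<nu> s) x \<le> P' s + gap_rate * r s + c * (P s + r s - x)"
        using fld[OF s, of x z] P(6)[OF s] rate[OF s] unfolding distrib_left by linarith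
    qed
    moreover have "measure m0 {P 0 + r 0..} \<le> measure m0 {z'. flow t z' \<in> {flow t z..}}"
    proof (rule m0.finite_measure_mono)
      show "{P 0 + r 0..} \<subseteq> {z'. flow t z' \<in> {flow t z..}}"
        using admissible_mono[OF flow_admissible[OF t0]] P(4) A by (auto simp: r_def)
    qed simp
    moreover have "measure (\<nu> t) {a<..} \<le> measure (\<nu> t) {P t + r t..}"
      using P(5)[OF t] e z \<nu>_sets[OF t] by (intro N.finite_measure_mono) auto
    moreover have "measure m0 {z'. flow t z' \<in> {flow t z..}} \<le> measure (\<mu> t) {a - ?e<..}"
      using \<mu>_tail_closed[OF t0, of "a - ?e"] t0 z by (simp add: \<mu>_measure)
    ultimately show "measure (\<nu> t) {a<..} \<le> measure (\<mu> t) {a - ?e<..}" by linarith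
  next
    fix a
    obtain z where z: "flow t z = a" using flow_surj[OF t0] .
    obtain P P' where P: "smooth P" "continuous_on UNIV P'" "\<And>t. (P has_real_derivative P' t) (at t)" "P 0 = z"
      "\<And>s. s \<in> {0..T} \<Longrightarrow> \<bar>P s - flow s z\<bar> \<le> \<gamma>" "\<And>s. s \<in> {0..T} \<Longrightarrow> \<bar>P' s - speed (flow s) z\<bar> \<le> \<gamma>"
      using approx[of z] by metis
    have "measure m0 {P 0 - r 0<..} \<le> measure (\<nu> t) {P t - r t<..}"
    proof (rule \<nu>_mass_right_of_subsolution[where Z = "\<lambda>s. P s - r s" and Z' = "\<lambda>s. P' s - gap_rate * r s" and L = c, OF _ _ _ _ t])
      show "smooth (\<lambda>s. P s - r s)" by (intro smooth_diff P rs)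
      show "continuous_on UNIV (\<lambda>s. P' s - gap_rate * r s)" by (intro continuous_intros P smooth_continuous rs)
      show "((\<lambda>s. P s - r s) has_real_derivative P' s - gap_rate * r s) (at s)" for s by (intro derivative_intros P r')
      fix s x assume s: "s \<in> {0..T}" and x: "P s - r s < x"
      have "\<bar>x - flow s z\<bar> \<le> (x - (P s - r s)) + (r s + \<gamma>)"
        using P(5)[OF s] x r_ge[OF s] A by linarith
      then have "c * \<bar>x - flow s z\<bar> \<le> c * ((x - (P s - r s)) + (r s + \<gamma>))" using c by (rule mult_left_mono)
      then show "P' s - gap_rate * r s - c * (x - (P s - r s)) \<le> velocity (\<nu> s) x"
        using fld[OF s, of x z] P(6)[OF s] rate[OF s] unfolding distrib_left by linarith
    qed
    moreover have "measure (\<mu> t) {a<..} \<le> measure m0 {P 0 - r 0<..}"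
    proof -
      have "{z'. flow t z' \<in> {a<..}} \<subseteq> {P 0 - r 0<..}"
      proof
        fix z' assume "z' \<in> {z'. flow t z' \<in> {a<..}}"
        then have "z < z'" using admissible_mono[OF flow_admissible[OF t0], of z' z] z by force
        then show "z' \<in> {P 0 - r 0<..}" using P(4) A by (simp add: r_def)
      qed
      then show ?thesis using t0 by (simp add: \<mu>_measure) (rule m0.finite_measure_mono, auto)
    qed
    moreover have "measure (\<nu> t) {P t - r t<..} \<le> measure (\<nu> t) {a - ?e<..}"
      using P(5)[OF t] e z \<nu>_sets[OF t] by (intro N.finite_measure_mono) auto
    ultimately show "measure (\<mu> t) {a<..} \<le> measure (\<nu> t) {a - ?e<..}" by linarith
  qed
qed

lemma close_at_geometric:
  assumes "t \<in> {0..T}"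
  shows "close_at ((V * T + 1) * (3 / 4) ^ n * exp (gap_rate * t)) t"
  using assms
proof (induction n arbitrary: t)
  case 0
  interpret N: finite_measure "\<nu> t" by (rule \<nu>_finite[OF 0])
  have d: "density_bounded R (\<mu> t)" using \<mu>_density_bounded 0 by simp
  interpret M: finite_measure "\<mu> t" using d by (simp add: density_bounded_def)
  have s: "sets (\<mu> t) = sets borel" using d by (simp add: density_bounded_def)
  have "(V * T + 1) * 1 \<le> (V * T + 1) * exp (gap_rate * t)"
    using 0 gap_rate_pos V_nonneg T by (intro mult_left_mono) auto
  then have sub: "{a - (V * T + 1)<..} \<subseteq> {a - (V * T + 1) * exp (gap_rate * t)<..}" for a by simp
  have "measure (\<mu> t) {a - (V * T + 1)<..} \<le> measure (\<mu> t) {a - (V * T + 1) * exp (gap_rate * t)<..}"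
       "measure (\<nu> t) {a - (V * T + 1)<..} \<le> measure (\<nu> t) {a - (V * T + 1) * exp (gap_rate * t)<..}" for a
    using s \<nu>_sets[OF 0] sub by (auto intro!: N.finite_measure_mono M.finite_measure_mono)
  then show ?case
    using close_at_initial[OF 0] unfolding close_at_def shifted_le_def by (auto intro: order_trans)
next
  case (Suc n)
  have "close_at (3 / 4 * ((V * T + 1) * (3 / 4) ^ n) * exp (gap_rate * t)) t"
    using V_nonneg T by (intro close_at_improve Suc) (auto intro!: mult_pos_pos add_nonneg_pos)
  then show ?case by (simp add: mult_ac)
qed

text \<open>Iterating the improvement, the distance tends to zero; the bounded density of the constructed solution turns
tails that agree up to arbitrarily small shifts into equal tails.\<close>

lemma weak_solution_unique:
  assumes t: "t \<in> {0..T}"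
  shows "\<nu> t = \<mu> t"
proof -
  interpret N: finite_measure "\<nu> t" by (rule \<nu>_finite[OF t])
  have t0: "0 \<le> t" using t by simp
  have d: "density_bounded R (\<mu> t)" by (rule \<mu>_density_bounded[OF t0])
  interpret M: finite_measure "\<mu> t" using d by (simp add: density_bounded_def)
  have s: "sets (\<mu> t) = sets borel" using d by (simp add: density_bounded_def)
  define e where "e n = (V * T + 1) * (3 / 4) ^ n * exp (gap_rate * t)" for n :: nat
  have "e \<longlonglongrightarrow> (V * T + 1) * 0 * exp (gap_rate * t)"
    unfolding e_def by (intro tendsto_intros LIMSEQ_power_zero) simp
  then have e0: "e \<longlonglongrightarrow> 0" by simp
  have e_nonneg: "0 \<le> e n" for n unfolding e_def using V_nonneg T by simp
  have le: "shifted_le (e n) (\<nu> t) (\<mu> t)" "shifted_le (e n) (\<mu> t) (\<nu> t)" for n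
    using close_at_geometric[OF t, of n] unfolding close_at_def e_def by auto
  have tail: "measure (\<nu> t) {a<..} = measure (\<mu> t) {a<..}" for a
  proof (rule antisym)
    have "measure (\<nu> t) {a<..} \<le> measure (\<mu> t) {a..} + R * e n" for n
    proof -
      have "measure (\<nu> t) {a<..} \<le> measure (\<mu> t) {a - e n<..}" using le(1) by (simp add: shifted_le_def)
      also have "\<dots> \<le> measure (\<mu> t) {a - e n..}" using s by (intro M.finite_measure_mono) auto
      also have "\<dots> \<le> measure (\<mu> t) {a..} + R * e n" by (rule density_bounded_Ici_shift[OF d e_nonneg])
      finally show ?thesis .
    qed
    moreover have "(\<lambda>n. measure (\<mu> t) {a..} + R * e n) \<longlonglongrightarrow> measure (\<mu> t) {a..} + R * 0"
      by (intro tendsto_intros e0)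
    ultimately have "measure (\<nu> t) {a<..} \<le> measure (\<mu> t) {a..} + R * 0"
      by (intro LIMSEQ_le_const) auto
    then show "measure (\<nu> t) {a<..} \<le> measure (\<mu> t) {a<..}" using \<mu>_tail_closed[OF t0, of a] by simp
    have "measure (\<mu> t) {a<..} \<le> measure (\<nu> t) {a<..} + R * e n" for n
    proof -
      have "measure (\<mu> t) {a<..} \<le> measure (\<mu> t) {a + e n - e n..}"
        using s by (intro M.finite_measure_mono) auto
      also have "\<dots> \<le> measure (\<mu> t) {a + e n..} + R * e n" by (rule density_bounded_Ici_shift[OF d e_nonneg])
      also have "measure (\<mu> t) {a + e n..} \<le> measure (\<mu> t) {a + e n<..}" by (rule \<mu>_tail_closed[OF t0])
      also have "\<dots> \<le> measure (\<nu> t) {a + e n - e n<..}" using le(2) unfolding shifted_le_def by blast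
      finally show ?thesis by simp
    qed
    moreover have "(\<lambda>n. measure (\<nu> t) {a<..} + R * e n) \<longlonglongrightarrow> measure (\<nu> t) {a<..} + R * 0"
      by (intro tendsto_intros e0)
    ultimately have "measure (\<mu> t) {a<..} \<le> measure (\<nu> t) {a<..} + R * 0"
      by (intro LIMSEQ_le_const) auto
    then show "measure (\<mu> t) {a<..} \<le> measure (\<nu> t) {a<..}" by simp
  qed
  have compl: "UNIV - {a<..} = {..a}" for a :: real by auto
  have "cdf (\<nu> t) a = cdf (\<mu> t) a" for a
    using N.finite_measure_compl[of "{a<..}"] M.finite_measure_compl[of "{a<..}"] tail[of a]
      \<nu>_mass[OF t] \<mu>_mass[OF t0] s \<nu>_sets[OF t] \<nu>_space[OF t] sets_eq_imp_space_eq[OF s]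
    by (simp add: cdf_def compl)
  moreover have "finite_borel_measure (\<nu> t)" "finite_borel_measure (\<mu> t)"
    by (intro finite_borel_measure.intro finite_borel_measure_axioms.intro N.finite_measure_axioms
        M.finite_measure_axioms s \<nu>_sets[OF t])+
  ultimately show ?thesis by (intro cdf_unique') auto
qed

end

section \<open>The Cauchy problem\<close>

lemma density_bounded_density:
  fixes \<rho> :: "real \<Rightarrow> real"
  assumes [measurable]: "\<rho> \<in> borel_measurable borel" and R: "0 \<le> R"
    and le: "AE x in lborel. \<rho> x \<le> R" and supp: "\<And>x. \<rho> x \<noteq> 0 \<Longrightarrow> x \<in> {c..d}"
  shows "density_bounded R (density lborel (\<lambda>x. ennreal (\<rho> x)))" (is "density_bounded R ?m")
  unfolding density_bounded_def
proof (intro conjI allI impI R)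
  have le': "emeasure ?m A \<le> ennreal R * emeasure lborel A" if [measurable]: "A \<in> sets borel" for A
  proof -
    have "emeasure ?m A = (\<integral>\<^sup>+x. ennreal (\<rho> x) * indicator A x \<partial>lborel)"
      by (rule emeasure_density) auto
    also have "\<dots> \<le> (\<integral>\<^sup>+x. ennreal R * indicator A x \<partial>lborel)"
      using le by (intro nn_integral_mono_AE) (auto simp: indicator_def intro: ennreal_leI)
    also have "\<dots> = ennreal R * emeasure lborel A" by (simp add: nn_integral_cmult_indicator)
    finally show ?thesis .
  qed
  show "sets ?m = sets borel" by simp
  show "finite_measure ?m"
  proof
    have "emeasure ?m UNIV = (\<integral>\<^sup>+x. ennreal (\<rho> x) * indicator UNIV x \<partial>lborel)"
      by (rule emeasure_density) auto
    also have "\<dots> = (\<integral>\<^sup>+x. ennreal (\<rho> x) * indicator {c..d} x \<partial>lborel)"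
    proof (rule nn_integral_cong)
      fix x
      show "ennreal (\<rho> x) * indicator UNIV x = ennreal (\<rho> x) * indicator {c..d} x"
        using supp[of x] by (cases "\<rho> x = 0") auto
    qed
    also have "\<dots> = emeasure ?m {c..d}" by (rule emeasure_density[symmetric]) auto
    also have "\<dots> \<le> ennreal R * emeasure lborel {c..d}" by (rule le') simp
    also have "\<dots> < \<infinity>" by (simp add: ennreal_mult_less_top emeasure_lborel_Icc_eq)
    finally show "emeasure ?m (space ?m) \<noteq> \<infinity>" by simp
  qed
  then interpret finite_measure ?m .
  fix a b :: real assume "a \<le> b"
  then show "measure ?m {a<..<b} \<le> R * (b - a)"
    using le'[of "{a<..<b}"] R by (simp add: emeasure_eq_measure ennreal_mult[symmetric])
qed

lemma esssup_bounded_real: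
  fixes \<rho> :: "real \<Rightarrow> real"
  assumes \<rho>: "\<rho> \<in> borel_measurable borel" "\<And>x. 0 \<le> \<rho> x" "\<And>x. \<rho> x \<le> 1"
  obtains R where "0 \<le> R" "esssup lborel (\<lambda>x. ereal (\<rho> x)) = ereal R" "AE x in lborel. \<rho> x \<le> R"
proof -
  let ?E = "esssup lborel (\<lambda>x. ereal (\<rho> x))"
  have meas: "(\<lambda>x. ereal (\<rho> x)) \<in> borel_measurable lborel" using \<rho>(1) by simp
  have AE: "AE x in lborel. ereal (\<rho> x) \<le> ?E" by (rule esssup_AE)
  have "?E \<le> 1" using \<rho>(3) by (intro esssup_I meas) auto
  moreover have "0 \<le> ?E"
  proof (rule ccontr)
    assume "\<not> 0 \<le> ?E"
    then have "?E < 0" by simp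
    have "\<not> ereal (\<rho> x) \<le> ?E" for x
    proof
      assume "ereal (\<rho> x) \<le> ?E"
      then have "ereal (\<rho> x) < 0" using \<open>?E < 0\<close> by (rule le_less_trans)
      then show False using \<rho>(2)[of x] by simp
    qed
    then have "AE x :: real in lborel. False" using AE by simp
    then show False by (simp add: AE_iff_measurable[of UNIV lborel])
  qed
  ultimately obtain R where R: "?E = ereal R" by (cases ?E) auto
  show ?thesis
  proof (rule that[of R])
    show "0 \<le> R" using \<open>0 \<le> ?E\<close> R by simp
    show "AE x in lborel. \<rho> x \<le> R" using AE unfolding R by simp
  qed (rule R)
qed

theorem theorem2:
  fixes \<eta> :: real and w v \<rho>\<^sub>0 :: "real \<Rightarrow> real"
  assumes "\<eta> > 0"
    and "\<And>x. x \<in> {0..\<eta>} \<Longrightarrow> w x \<ge> 0"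
    and "antimono_on {0..\<eta>} w"
    and "\<exists>L. L-lipschitz_on {0..\<eta>} w"
    and "set_lebesgue_integral lborel {0..\<eta>} w = 1"
    and "\<And>s. s \<in> {0..1} \<Longrightarrow> v s \<ge> 0"
    and "antimono_on {0..1} v"
    and "\<exists>L. L-lipschitz_on {0..1} v"
    and "v 1 = 0"
    and "\<rho>\<^sub>0 \<in> BV_c"
  shows "\<forall>T>0. \<exists>\<mu>. weak_solution \<eta> w v \<rho>\<^sub>0 T \<mu> \<and>
           (\<forall>\<nu>. weak_solution \<eta> w v \<rho>\<^sub>0 T \<nu> \<longrightarrow> (\<forall>t\<in>{0..T}. \<nu> t = \<mu> t)) \<and>
           (\<exists>\<rho> :: real \<Rightarrow> real \<Rightarrow> real. \<forall>t\<in>{0<..T}.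
              \<rho> t \<in> borel_measurable borel \<and>
              \<mu> t = density lborel (\<lambda>x. ennreal (\<rho> t x)) \<and>
              (AE x in lborel. 0 \<le> \<rho> t x \<and>
                 ereal (\<rho> t x) \<le> esssup lborel (\<lambda>x. ereal (\<rho>\<^sub>0 x))))"
proof (intro allI impI)
  fix T :: real assume "0 < T"
  obtain Lw where Lw: "Lw-lipschitz_on {0..\<eta>} w" using assms(4) by blast
  obtain Lv where Lv: "Lv-lipschitz_on {0..1} v" using assms(8) by blast
  have \<rho>_bounds: "0 \<le> \<rho>\<^sub>0 x" "\<rho>\<^sub>0 x \<le> 1" for x
    using assms(10) by (auto simp: BV_c_def image_subset_iff)
  have \<rho>_borel: "\<rho>\<^sub>0 \<in> borel_measurable borel"
    using assms(10) by (intro bounded_variation_borel_measurable) (simp add: BV_c_def)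
  have "compact (closure {x. \<rho>\<^sub>0 x \<noteq> 0})" using assms(10) by (simp add: BV_c_def compact_support_def)
  then have "bounded {x. \<rho>\<^sub>0 x \<noteq> 0}"
    by (rule bounded_subset[OF compact_imp_bounded closure_subset])
  then obtain B where "\<forall>x\<in>{x. \<rho>\<^sub>0 x \<noteq> 0}. \<bar>x\<bar> \<le> B" unfolding bounded_iff by auto
  then have supp: "x \<in> {- B..B}" if "\<rho>\<^sub>0 x \<noteq> 0" for x using that by (auto simp: abs_le_iff)
  obtain R where R: "0 \<le> R" "esssup lborel (\<lambda>x. ereal (\<rho>\<^sub>0 x)) = ereal R" "AE x in lborel. \<rho>\<^sub>0 x \<le> R"
    using esssup_bounded_real[OF \<rho>_borel \<rho>_bounds] by blast
  define k where "k u = (if u \<in> {0..\<eta>} then w u else 0)" for u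
  \<comment> \<open>beyond \<open>1\<close> the extension by zero is the constant extension, since \<open>v 1 = 0\<close>\<close>
  define clip where "clip s = max 0 (min 1 s)" for s :: real
  have clip: "clip s \<in> {0..1}" for s by (auto simp: clip_def)
  define m0 where "m0 = density lborel (\<lambda>x. ennreal (\<rho>\<^sub>0 x))"
  interpret traffic \<eta> k Lw "\<lambda>s. v (clip s)" "v 0" Lv m0 R w v \<rho>\<^sub>0
  proof
    show "0 < \<eta>" by (rule assms(1))
    show "k u = 0" if "u \<notin> {0..\<eta>}" for u using that unfolding k_def by (rule if_not_P)
    show "0 \<le> k u" for u using assms(2) by (simp add: k_def)
    show "k u' \<le> k u" if "0 \<le> u" "u \<le> u'" for u u'
      using that assms(2)[of u] monotone_onD[OF assms(3), of u u'] by (auto simp: k_def)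
    show "\<bar>k u - k u'\<bar> \<le> Lw * \<bar>u - u'\<bar>" if "u \<in> {0..\<eta>}" "u' \<in> {0..\<eta>}" for u u'
      using lipschitz_onD[OF Lw that] that by (simp add: k_def dist_real_def)
    show "v (clip s') \<le> v (clip s)" if "s \<le> s'" for s s'
      using monotone_onD[OF assms(7) clip clip, of s s'] that by (auto simp: clip_def)
    show "\<bar>v (clip s) - v (clip s')\<bar> \<le> Lv * \<bar>s - s'\<bar>" for s s'
    proof -
      have "\<bar>v (clip s) - v (clip s')\<bar> \<le> Lv * \<bar>clip s - clip s'\<bar>"
        using lipschitz_onD[OF Lv clip clip] by (simp add: dist_real_def)
      also have "\<dots> \<le> Lv * \<bar>s - s'\<bar>"
        using lipschitz_on_nonneg[OF Lv] by (intro mult_left_mono) (auto simp: clip_def)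
      finally show ?thesis .
    qed
    show "0 \<le> v (clip s)" for s using assms(6) clip by blast
    show "v (clip s) \<le> v 0" for s
      using monotone_onD[OF assms(7), of 0 "clip s"] clip[of s] by auto
    show "density_bounded R m0"
      unfolding m0_def by (rule density_bounded_density[OF \<rho>_borel R(1,3) supp])
    show "k u = w u" if "u \<in> {0..\<eta>}" for u using that by (simp add: k_def)
    show "extend_velocity v s = v (clip s)" if "0 \<le> s" for s
      using that assms(9) by (auto simp: extend_velocity_def clip_def)
    show "m0 = density lborel (\<lambda>x. ennreal (\<rho>\<^sub>0 x))" by (rule m0_def)
  qed
  have unique: "\<nu> t = \<mu> t" if "weak_solution \<eta> w v \<rho>\<^sub>0 T \<nu>" "t \<in> {0..T}" for \<nu> t
  proof -
    interpret weak_traffic \<eta> k Lw "\<lambda>s. v (clip s)" "v 0" Lv m0 R w v \<rho>\<^sub>0 T \<nu>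
      by standard (use \<open>0 < T\<close> that in auto)
    show ?thesis by (rule weak_solution_unique[OF that(2)])
  qed
  have "\<forall>t\<in>{0<..T}. \<exists>\<rho>. \<rho> \<in> borel_measurable borel \<and>
      \<mu> t = density lborel (\<lambda>x. ennreal (\<rho> x)) \<and>
      (AE x in lborel. 0 \<le> \<rho> x \<and> ereal (\<rho> x) \<le> esssup lborel (\<lambda>x. ereal (\<rho>\<^sub>0 x)))"
  proof
    fix t assume "t \<in> {0<..T}"
    then have "density_bounded R (\<mu> t)" by (intro \<mu>_density_bounded) simp
    from density_bounded_imp_density[OF this] obtain \<rho> where "\<rho> \<in> borel_measurable borel" "\<And>x. 0 \<le> \<rho> x" "\<And>x. \<rho> x \<le> R"
      "\<mu> t = density lborel (\<lambda>x. ennreal (\<rho> x))"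
      by blast
    then show "\<exists>\<rho>. \<rho> \<in> borel_measurable borel \<and> \<mu> t = density lborel (\<lambda>x. ennreal (\<rho> x)) \<and>
      (AE x in lborel. 0 \<le> \<rho> x \<and> ereal (\<rho> x) \<le> esssup lborel (\<lambda>x. ereal (\<rho>\<^sub>0 x)))"
      by (intro exI[of _ \<rho>]) (simp add: R(2))
  qed
  then obtain \<rho> where "\<forall>t\<in>{0<..T}. \<rho> t \<in> borel_measurable borel \<and>
      \<mu> t = density lborel (\<lambda>x. ennreal (\<rho> t x)) \<and>
      (AE x in lborel. 0 \<le> \<rho> t x \<and> ereal (\<rho> t x) \<le> esssup lborel (\<lambda>x. ereal (\<rho>\<^sub>0 x)))"
    by (rule bchoice[THEN exE])
  then show "\<exists>\<mu>. weak_solution \<eta> w v \<rho>\<^sub>0 T \<mu> \<and>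
           (\<forall>\<nu>. weak_solution \<eta> w v \<rho>\<^sub>0 T \<nu> \<longrightarrow> (\<forall>t\<in>{0..T}. \<nu> t = \<mu> t)) \<and>
           (\<exists>\<rho> :: real \<Rightarrow> real \<Rightarrow> real. \<forall>t\<in>{0<..T}.
              \<rho> t \<in> borel_measurable borel \<and>
              \<mu> t = density lborel (\<lambda>x. ennreal (\<rho> t x)) \<and>
              (AE x in lborel. 0 \<le> \<rho> t x \<and>
                 ereal (\<rho> t x) \<le> esssup lborel (\<lambda>x. ereal (\<rho>\<^sub>0 x))))"
    using \<mu>_weak_solution[OF \<open>0 < T\<close>] unique by blast
qed

end
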